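(* Let $\mathfrak g=\mathfrak{spo}(2m|2n)$ with $n\ge2$. The Coxeter graph of the Coxeter group $\widehat{\mathscr C}(\mathfrak{spo}(2m|2n))$ is the following: the chain $$\widehat r_{\bar1}\overset{4}{-}\widehat r_{\overline{12}}-\widehat r_{\overline{23}}-\cdots-\widehat r_{\overline{m-1,m}}\overset{12}{-}\widehat r_{\overline m1}\overset{12}{-}\widehat r_{12}-\widehat r_{23}-\cdots-\widehat r_{n-2,n-1}-\widehat r_{n-1,n}$$ together with one further vertex $\widehat r'_{n-1,n}$, joined to $\widehat r_{n-2,n-1}$ by an unlabelled edge and to no other vertex. The edge between $\widehat r_{\bar1}$ and $\widehat r_{\overline{12}}$ is labelled $4$, the edges joining $\widehat r_{\overline m1}$ to $\widehat r_{\overline{m-1,m}}$ and to $\widehat r_{12}$ are labelled $12$, and all other edges are unlabelled. (The graph is displayed in this general form for all such $m,n$.)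
   Context: The ground field is algebraically closed of characteristic $0$; $m$ is a positive integer. $\mathfrak h$ is the Cartan subalgebra of diagonal matrices; $\mathfrak h^*$ has basis $\delta_1,\dots,\delta_m,\varepsilon_1,\dots,\varepsilon_n$ with bilinear form $(\delta_i,\delta_i)=1$, $(\varepsilon_j,\varepsilon_j)=-1$, other pairings zero. Roots of $\mathfrak{spo}(2m|2n)$: even $\pm\delta_i\pm\delta_{i'}$ ($i\neq i'$), $\pm2\delta_i$, $\pm\varepsilon_j\pm\varepsilon_{j'}$ ($j\ne j'$); odd $\pm\delta_i\pm\varepsilon_j$ (all isotropic). $\mathcal B$ is the (finite) set of Borel subalgebras containing $\mathfrak h$, identified with the set of fundamental (simple root) systems. For an isotropic odd root $\gamma$, the odd reflection $\widehat r_\gamma=\widehat r_{-\gamma}$ is the involution of $\mathcal B$ which sends $\Pi_1\ni\gamma$ to $\{-\gamma\}\cup\{\alpha\in\Pi_1: (\alpha,\gamma)=0,\alpha\ne\gamma\}\cup\{\alpha+\gamma:\alpha\in\Pi_1,(\alpha,\gamma)\neq0\}$, acts on $\Pi_1\ni-\gamma$ by the same rule with $-\gamma$ in place of $\gamma$, and fixes every fundamental system containing neither $\gamma$ nor $-\gamma$. For an even root $\alpha$, $\widehat r_\alpha$ is the permutation of $\mathcal B$ induced by the ordinary reflection $s_\alpha$. The super Weyl group $\widehat W$ is the group of permutations of $\mathcal B$ generated by all odd and ordinary reflections. $\widetilde\Pi=\{-2\delta_1\}\cup\{\delta_1-\delta_2,\dots,\delta_{m-1}-\delta_m,\delta_m-\varepsilon_1,\varepsilon_1-\varepsilon_2,\dots,\varepsilon_{n-1}-\varepsilon_n,\varepsilon_{n-1}+\varepsilon_n\}$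 and $\mathsf S_{\widetilde\Pi}=\{\widehat r_\theta:\theta\in\widetilde\Pi\}$, with $\widehat r_{\bar1}=\widehat r_{2\delta_1}=\widehat r_{-2\delta_1}$, $\widehat r_{\overline{i,i+1}}=\widehat r_{\delta_i-\delta_{i+1}}$ (so $\widehat r_{\overline{12}}=\widehat r_{\delta_1-\delta_2}$, etc.), $\widehat r_{\overline m1}=\widehat r_{\delta_m-\varepsilon_1}$, $\widehat r_{j,j+1}=\widehat r_{\varepsilon_j-\varepsilon_{j+1}}$ (so $\widehat r_{12}=\widehat r_{\varepsilon_1-\varepsilon_2}$, etc.), $\widehat r'_{n-1,n}=\widehat r_{\varepsilon_{n-1}+\varepsilon_n}$. The Coxeter group $\widehat{\mathscr C}$ is $\langle x\in\mathsf S_{\widetilde\Pi}\mid (xy)^{m_{xy}}=1\rangle$ where $m_{xy}$ is the order of $xy$ in $\widehat W$. In its Coxeter graph, with vertex set $\mathsf S_{\widetilde\Pi}$, distinct $x,y$ are joined by an edge iff $m_{xy}\ge3$, labelled by $m_{xy}$ if $m_{xy}\ge4$ (no edge means $m_{xy}=2$, an unlabelled edge means $m_{xy}=3$).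
   Formalization: Where displayed vertices do not exist the graph is corrected: for m=1 the first vertex is joined directly to the odd reflection with label 12 (no edge labelled 4); for n=2 the further vertex r'_{12} is joined to the odd reflection, with label 12 instead of unlabelled. *)

theory Defs
  imports
    "HOL-Algebra.Bij"
    "HOL-Algebra.Elementary_Groups"
    "HOL-Algebra.Multiplicative_Group"
    "HOL-Library.Function_Algebras"
begin

text \<open>
  All roots lie in the integral span of the $\delta_i$ and $\varepsilon_j$, so everything takes
  place in the real form of the dual of the Cartan subalgebra, independently of the ground field.
  A vector is its coordinate function; only the coordinates \<open>Dl 1, \<dots>, Dl m\<close> and
  \<open>Ep 1, \<dots>, Ep n\<close> are used.
\<close>

datatype coord = Dl nat | Ep nat

type_synonym weight = "coord \<Rightarrow> real"

definition delta :: "nat \<Rightarrow> weight" where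
  "delta i = (\<lambda>c. if c = Dl i then 1 else 0)"

definition eps :: "nat \<Rightarrow> weight" where
  "eps j = (\<lambda>c. if c = Ep j then 1 else 0)"

definition wform :: "nat \<Rightarrow> nat \<Rightarrow> weight \<Rightarrow> weight \<Rightarrow> real" where
  "wform m n u v = (\<Sum>i=1..m. u (Dl i) * v (Dl i)) - (\<Sum>j=1..n. u (Ep j) * v (Ep j))"

definition even_roots :: "nat \<Rightarrow> nat \<Rightarrow> weight set" where
  "even_roots m n =
     (\<Union>i\<in>{1..m}. \<Union>k\<in>{1..m} - {i}.
        {delta i + delta k, delta i - delta k, - delta i + delta k, - delta i - delta k})
   \<union> (\<Union>i\<in>{1..m}. {delta i + delta i, - delta i - delta i})
   \<union> (\<Union>j\<in>{1..n}. \<Union>k\<in>{1..n} - {j}.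
        {eps j + eps k, eps j - eps k, - eps j + eps k, - eps j - eps k})"

definition odd_roots :: "nat \<Rightarrow> nat \<Rightarrow> weight set" where
  "odd_roots m n =
     (\<Union>i\<in>{1..m}. \<Union>j\<in>{1..n}.
        {delta i + eps j, delta i - eps j, - delta i + eps j, - delta i - eps j})"

definition roots :: "nat \<Rightarrow> nat \<Rightarrow> weight set" where
  "roots m n = even_roots m n \<union> odd_roots m n"

text \<open>
  A Borel subalgebra containing the Cartan subalgebra is the sum of the Cartan subalgebra and the
  root spaces for the roots taking positive values at an element \<open>h\<close> of the real form of the
  Cartan subalgebra at which no root vanishes.  Here \<open>h\<close> is given by its coordinates in the basis
  dual to the $\delta_i$, $\varepsilon_j$.
\<close>

definition eval_at :: "nat \<Rightarrow> nat \<Rightarrow> (coord \<Rightarrow> real) \<Rightarrow> weight \<Rightarrow> real" where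
  "eval_at m n h v = (\<Sum>i=1..m. h (Dl i) * v (Dl i)) + (\<Sum>j=1..n. h (Ep j) * v (Ep j))"

definition positive_system :: "nat \<Rightarrow> nat \<Rightarrow> weight set \<Rightarrow> bool" where
  "positive_system m n P \<longleftrightarrow>
     (\<exists>h. (\<forall>\<alpha>\<in>roots m n. eval_at m n h \<alpha> \<noteq> 0) \<and> P = {\<alpha>\<in>roots m n. eval_at m n h \<alpha> > 0})"

definition simple_roots :: "weight set \<Rightarrow> weight set" where
  "simple_roots P = {\<alpha>\<in>P. \<not> (\<exists>\<beta>\<in>P. \<exists>\<gamma>\<in>P. \<alpha> = \<beta> + \<gamma>)}"

definition borels :: "nat \<Rightarrow> nat \<Rightarrow> weight set set" where
  "borels m n = {simple_roots P | P. positive_system m n P}"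

definition odd_step :: "nat \<Rightarrow> nat \<Rightarrow> weight \<Rightarrow> weight set \<Rightarrow> weight set" where
  "odd_step m n \<gamma> S =
     {- \<gamma>} \<union> {\<alpha>\<in>S. wform m n \<alpha> \<gamma> = 0 \<and> \<alpha> \<noteq> \<gamma>} \<union> {\<alpha> + \<gamma> | \<alpha>. \<alpha> \<in> S \<and> wform m n \<alpha> \<gamma> \<noteq> 0}"

definition root_reflection :: "nat \<Rightarrow> nat \<Rightarrow> weight \<Rightarrow> weight \<Rightarrow> weight" where
  "root_reflection m n \<alpha> v = (\<lambda>c. v c - 2 * wform m n v \<alpha> / wform m n \<alpha> \<alpha> * \<alpha> c)"

text \<open>
  Elements of \<open>BijGroup (borels m n)\<close> are extensional, i.e. \<open>undefined\<close> outside
  \<open>borels m n\<close>.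
\<close>

definition rhat :: "nat \<Rightarrow> nat \<Rightarrow> weight \<Rightarrow> (weight set \<Rightarrow> weight set)" where
  "rhat m n \<theta> = (\<lambda>S\<in>borels m n.
     if \<theta> \<in> odd_roots m n then
       (if \<theta> \<in> S then odd_step m n \<theta> S
        else if - \<theta> \<in> S then odd_step m n (- \<theta>) S
        else S)
     else root_reflection m n \<theta> ` S)"

definition super_weyl_group :: "nat \<Rightarrow> nat \<Rightarrow> (weight set \<Rightarrow> weight set) monoid" where
  "super_weyl_group m n = subgroup_generated (BijGroup (borels m n)) (rhat m n ` roots m n)"

text \<open>
  A Coxeter group is given by its presentation: the generators \<open>x\<close> and the exponents
  $m_{xy}$ of the relations $(xy)^{m_{xy}} = 1$.
\<close>

record 'g coxeter_presentation =
  generators :: "'g set"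
  exponent :: "'g \<Rightarrow> 'g \<Rightarrow> nat"

text \<open>An edge is the set of its two end points together with its label, if it has one.\<close>

record 'v labelled_graph =
  vertices :: "'v set"
  edges :: "('v set \<times> nat option) set"

text \<open>
  Only finite exponents are covered: \<open>group.ord\<close> is \<open>0\<close> on elements of infinite order,
  but the super Weyl group is finite.
\<close>

definition coxeter_graph :: "'g coxeter_presentation \<Rightarrow> 'g labelled_graph" where
  "coxeter_graph C =
     \<lparr>vertices = generators C,
      edges = {({x, y}, if exponent C x y \<ge> 4 then Some (exponent C x y) else None) | x y.
                 x \<in> generators C \<and> y \<in> generators C \<and> x \<noteq> y \<and> exponent C x y \<ge> 3}\<rparr>"

definition Pi_tilde :: "nat \<Rightarrow> nat \<Rightarrow> weight set" where
  "Pi_tilde m n =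
     {- delta 1 - delta 1} \<union> {delta i - delta (i + 1) | i. 1 \<le> i \<and> i < m}
   \<union> {delta m - eps 1} \<union> {eps j - eps (j + 1) | j. 1 \<le> j \<and> j < n} \<union> {eps (n - 1) + eps n}"

definition coxeter_C :: "nat \<Rightarrow> nat \<Rightarrow> (weight set \<Rightarrow> weight set) coxeter_presentation" where
  "coxeter_C m n =
     \<lparr>generators = rhat m n ` Pi_tilde m n,
      exponent = (\<lambda>x y. group.ord (super_weyl_group m n) (x \<otimes>\<^bsub>super_weyl_group m n\<^esub> y))\<rparr>"

definition r_bar1 :: "nat \<Rightarrow> nat \<Rightarrow> weight set \<Rightarrow> weight set" where
  "r_bar1 m n = rhat m n (- delta 1 - delta 1)"

definition r_bar :: "nat \<Rightarrow> nat \<Rightarrow> nat \<Rightarrow> weight set \<Rightarrow> weight set" where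
  "r_bar m n i = rhat m n (delta i - delta (i + 1))"

definition r_odd :: "nat \<Rightarrow> nat \<Rightarrow> weight set \<Rightarrow> weight set" where
  "r_odd m n = rhat m n (delta m - eps 1)"

definition r_eps :: "nat \<Rightarrow> nat \<Rightarrow> nat \<Rightarrow> weight set \<Rightarrow> weight set" where
  "r_eps m n j = rhat m n (eps j - eps (j + 1))"

definition r_prime :: "nat \<Rightarrow> nat \<Rightarrow> weight set \<Rightarrow> weight set" where
  "r_prime m n = rhat m n (eps (n - 1) + eps n)"

text \<open>
  In the boundary cases the missing vertex is replaced by the vertex preceding it in the chain.
  For \<open>m = 1\<close> there is no \<open>r_bar m n (m - 1)\<close>, and the left neighbour of \<open>r_odd\<close> is \<open>r_bar1\<close>.
  For \<open>n = 2\<close> there is no \<open>r_eps m n (n - 2)\<close>, and \<open>r_prime\<close> branches off at \<open>r_odd\<close>; as every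
  edge at \<open>r_odd\<close>, this edge has the label 12.
\<close>

definition spo_diagram :: "nat \<Rightarrow> nat \<Rightarrow> (weight set \<Rightarrow> weight set) labelled_graph" where
  "spo_diagram m n =
     \<lparr>vertices =
        {r_bar1 m n} \<union> {r_bar m n i | i. 1 \<le> i \<and> i < m} \<union> {r_odd m n}
        \<union> {r_eps m n j | j. 1 \<le> j \<and> j < n} \<union> {r_prime m n},
      edges =
        (if m = 1 then {({r_bar1 m n, r_odd m n}, Some 12)}
         else {({r_bar1 m n, r_bar m n 1}, Some 4), ({r_bar m n (m - 1), r_odd m n}, Some 12)})
        \<union> {({r_bar m n i, r_bar m n (i + 1)}, None) | i. 1 \<le> i \<and> i + 1 < m}
        \<union> {({r_odd m n, r_eps m n 1}, Some 12)}
        \<union> {({r_eps m n j, r_eps m n (j + 1)}, None) | j. 1 \<le> j \<and> j + 1 < n}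
        \<union> (if n = 2 then {({r_odd m n, r_prime m n}, Some 12)}
           else {({r_eps m n (n - 2), r_prime m n}, None)})\<rparr>"

end

theory Submission
  imports Defs
begin

text \<open>
  The ordinary reflections act on Borel subalgebras linearly, while the odd reflection
  \<open>r\<^sub>\<gamma>\<close> moves a Borel subalgebra only if \<open>\<gamma>\<close> or \<open>-\<gamma>\<close> is one of its simple roots.  Everything
  rests on the conjugation rule \<open>r\<^sub>a r\<^sub>\<theta> r\<^sub>a = r\<^sub>b\<close> with \<open>b = s\<^sub>a \<theta>\<close>, valid for an even root \<open>a\<close> and any
  root \<open>\<theta>\<close> (\<open>rhat_conjugate\<close>): the linear reflection \<open>s\<^sub>a\<close> preserves the roots, their parity and the
  bilinear form, and nothing else enters the definition of an odd reflection.
  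
  If at least one of two generators is even and their roots are orthogonal, the rule says that they
  commute.  For two even roots spanning a system of type \<open>A\<^sub>2\<close> or \<open>C\<^sub>2\<close> it gives the braid relation of
  length 3 or 4.  The remaining pairs consist of the odd root \<open>\<gamma> = \<delta>\<^sub>m - \<epsilon>\<^sub>1\<close> and an even
  root \<open>a\<close> with \<open>s\<^sub>a \<gamma> = \<gamma> + a\<close>.  Here \<open>(r\<^sub>\<gamma> r\<^sub>a)\<^sup>2\<close> is the product of the two odd reflections in \<open>\<gamma>\<close> and
  \<open>\<gamma>' = \<gamma> + a\<close>, which differ by a root.  If both of them move a Borel subalgebra, then, up to a common
  sign, \<open>\<gamma>\<close> and \<open>-\<gamma>'\<close> are simple in it, because the difference of two simple roots is not a root.
  After the first odd reflection \<open>-\<gamma>\<close> and \<open>-a\<close> are simple, and then neither \<open>\<gamma>'\<close> nor \<open>-\<gamma>'\<close>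
  can be (\<open>odd_reflections_separate\<close>).  So the orbits of the two odd reflections are paths with at
  most three vertices, on which their product has order 1, 2 or 3, and its sixth power is trivial.
  Paths with two and with three vertices both occur; hence the product has order 6 and
  \<open>r\<^sub>\<gamma> r\<^sub>a\<close> has order 12 (\<open>exponent_12\<close>).
  
  Two ingredients have to be supplied.  An odd reflection must map Borel subalgebras to Borel
  subalgebras: exchanging a simple isotropic root \<open>\<gamma>\<close> for \<open>-\<gamma>\<close> turns a positive system into
  another one, whose simple roots are read off from the root strings in the direction of \<open>\<gamma>\<close>
  (\<open>odd_flip_positive_system\<close>, \<open>odd_flip_simple\<close>).  And the lower bounds for the orders need
  explicit Borel subalgebras.  They come from functionals that are integral on the roots: a root
  of value 1 is simple (\<open>integral_label_borel\<close>).
\<close>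

section \<open>Roots as sums of two letters\<close>

text \<open>
  The weights \<open>\<plusminus>\<delta>\<^sub>i\<close> and \<open>\<plusminus>\<epsilon>\<^sub>j\<close> serve as letters: a root is a sum of two letters, and
  adding two roots whose sum is a root amounts to cancelling a pair of opposite letters.
  This replaces a case distinction over the types of the roots.
\<close>

definition dletters :: "nat \<Rightarrow> weight set" where
  "dletters m = (\<Union>i\<in>{1..m}. {delta i, - delta i})"

definition eletters :: "nat \<Rightarrow> weight set" where
  "eletters n = (\<Union>j\<in>{1..n}. {eps j, - eps j})"

definition letters :: "nat \<Rightarrow> nat \<Rightarrow> weight set" where
  "letters m n = dletters m \<union> eletters n"

locale spo =
  fixes m n :: nat
begin

text \<open>
  The pairing of a functional with a weight is also applied to two weights; it is then the
  Euclidean inner product for which the \<open>\<delta>\<^sub>i\<close> and \<open>\<epsilon>\<^sub>j\<close> are orthonormal.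
\<close>

abbreviation (input) "E \<equiv> eval_at m n"
abbreviation (input) "B \<equiv> wform m n"
abbreviation (input) "R \<equiv> roots m n"
abbreviation (input) "L \<equiv> letters m n"

lemma eval_at_add: "E h (u + v) = E h u + E h v"
  by (simp add: eval_at_def algebra_simps sum.distrib)

lemma eval_at_minus: "E h (- u) = - E h u"
  by (simp add: eval_at_def sum_negf)

lemma eval_at_diff: "E h (u - v) = E h u - E h v"
  using eval_at_add[of h u "- v"] by (simp add: eval_at_minus)

lemma eval_at_zero: "E h 0 = 0"
  by (simp add: eval_at_def)

lemma eval_at_scale: "E h (\<lambda>c. k * v c) = k * E h v"
  by (simp add: eval_at_def sum_distrib_left algebra_simps)

lemma eval_at_commute: "E u v = E v u"
  by (simp add: eval_at_def mult.commute)

lemmas eval_at_linear = eval_at_add eval_at_minus eval_at_diff eval_at_zero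

lemma wform_add: "B (u + v) w = B u w + B v w"
  by (simp add: wform_def algebra_simps sum.distrib)

lemma wform_minus: "B (- u) w = - B u w"
  by (simp add: wform_def sum_negf)

lemma wform_diff: "B (u - v) w = B u w - B v w"
  using wform_add[of u "- v" w] by (simp add: wform_minus)

lemma wform_scale: "B (\<lambda>c. k * v c) w = k * B v w"
  by (simp add: wform_def sum_distrib_left algebra_simps)

lemma wform_commute: "B u v = B v u"
  by (simp add: wform_def mult.commute)

lemma wform_add2: "B w (u + v) = B w u + B w v"
  and wform_minus2: "B w (- u) = - B w u"
  and wform_diff2: "B w (u - v) = B w u - B w v"
  using wform_add wform_minus wform_diff wform_commute by metis+

lemmas wform_linear = wform_add wform_minus wform_diff wform_add2 wform_minus2 wform_diff2

lemma eval_at_delta: "i \<in> {1..m} \<Longrightarrow> E h (delta i) = h (Dl i)"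
  and eval_at_eps: "j \<in> {1..n} \<Longrightarrow> E h (eps j) = h (Ep j)"
  by (auto simp: eval_at_def delta_def eps_def if_distrib cong: if_cong)

lemma wform_delta: "i \<in> {1..m} \<Longrightarrow> B (delta i) v = v (Dl i)"
  and wform_eps: "j \<in> {1..n} \<Longrightarrow> B (eps j) v = - v (Ep j)"
  by (auto simp: wform_def delta_def eps_def if_distrib[of "\<lambda>x. x * _"] cong: if_cong)

lemma delta_apply: "delta i (Dl k) = (if k = i then 1 else 0)" "delta i (Ep j) = 0"
  and eps_apply: "eps j (Ep l) = (if l = j then 1 else 0)" "eps j (Dl k) = 0"
  by (auto simp: delta_def eps_def)

lemma letter_coordinate:
  assumes "p \<in> L"
  obtains c \<sigma> where "\<sigma> = 1 \<or> \<sigma> = -1" "p = (\<lambda>d. if d = c then \<sigma> else 0)"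
    "\<And>v. E v p = \<sigma> * v c" "c \<in> Dl ` {1..m} \<or> c \<in> Ep ` {1..n} \<and> p \<in> eletters n"
proof -
  consider i where "i \<in> {1..m}" "p = delta i" | i where "i \<in> {1..m}" "p = - delta i"
    | j where "j \<in> {1..n}" "p = eps j" | j where "j \<in> {1..n}" "p = - eps j"
    using assms by (auto simp: letters_def dletters_def eletters_def)
  then show ?thesis
  proof cases
    case 1
    then have "E v p = v (Dl i)" for v by (simp add: eval_at_delta)
    moreover have "p = (\<lambda>d. if d = Dl i then 1 else 0)" using 1 by (auto simp: delta_def)
    ultimately show ?thesis using that[of 1 "Dl i"] 1 by simp
  next
    case 2
    then have "E v p = - v (Dl i)" for v by (simp add: eval_at_delta eval_at_minus)
    moreover have "p = (\<lambda>d. if d = Dl i then -1 else 0)" using 2 by (auto simp: delta_def)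
    ultimately show ?thesis using that[of "-1" "Dl i"] 2 by simp
  next
    case 3
    then have "E v p = v (Ep j)" for v by (simp add: eval_at_eps)
    moreover have "p = (\<lambda>d. if d = Ep j then 1 else 0)" using 3 by (auto simp: eps_def)
    moreover have "p \<in> eletters n" using 3 unfolding eletters_def by blast
    ultimately show ?thesis using that[of 1 "Ep j"] 3 by simp
  next
    case 4
    then have "E v p = - v (Ep j)" for v by (simp add: eval_at_eps eval_at_minus)
    moreover have "p = (\<lambda>d. if d = Ep j then -1 else 0)" using 4 by (auto simp: eps_def)
    moreover have "p \<in> eletters n" using 4 unfolding eletters_def by blast
    ultimately show ?thesis using that[of "-1" "Ep j"] 4 by simp
  qed
qed

lemma letter_pairing:
  assumes "p \<in> L" "q \<in> L"
  shows "E p q = (if p = q then 1 else if q = - p then -1 else 0)"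
proof -
  obtain c \<sigma> where p: "\<sigma> = 1 \<or> \<sigma> = -1" "p = (\<lambda>d. if d = c then \<sigma> else 0)"
    by (rule letter_coordinate[OF assms(1)])
  obtain d \<tau> where q: "\<tau> = 1 \<or> \<tau> = -1" "q = (\<lambda>e. if e = d then \<tau> else 0)"
    "\<And>v. E v q = \<tau> * v d"
    by (rule letter_coordinate[OF assms(2)]) blast
  have ne: "p \<noteq> q \<and> q \<noteq> - p" if "c \<noteq> d"
    using that p q(1,2) by (auto simp: fun_eq_iff)
  have ne': "p \<noteq> - p"
    using p by (auto simp: fun_eq_iff)
  show ?thesis
    using p q(1,2) ne ne' unfolding q(3) by (cases "c = d") (auto simp: fun_eq_iff)
qed

lemma minus_letter: "p \<in> L \<Longrightarrow> - p \<in> L" "p \<in> dletters m \<Longrightarrow> - p \<in> dletters m"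
  "p \<in> eletters n \<Longrightarrow> - p \<in> eletters n"
  by (auto simp: letters_def dletters_def eletters_def)

lemma dletters_letters: "p \<in> dletters m \<Longrightarrow> p \<in> L"
  and eletters_letters: "p \<in> eletters n \<Longrightarrow> p \<in> L"
  by (auto simp: letters_def)

lemma letter_self: "p \<in> L \<Longrightarrow> p \<noteq> - p"
  using letter_pairing[of p p] letter_pairing[of p "-p"] minus_letter eval_at_minus[of p p]
  by fastforce

lemma wform_dletter: "p \<in> dletters m \<Longrightarrow> B p v = E p v"
proof -
  assume "p \<in> dletters m"
  then obtain i where "i \<in> {1..m}" "p = delta i \<or> p = - delta i" by (auto simp: dletters_def)
  then show ?thesis
    by (auto simp: wform_minus wform_delta eval_at_delta eval_at_commute[of _ v] eval_at_minus)
qed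

lemma wform_eletter: "p \<in> eletters n \<Longrightarrow> B p v = - E p v"
proof -
  assume "p \<in> eletters n"
  then obtain i where "i \<in> {1..n}" "p = eps i \<or> p = - eps i" by (auto simp: eletters_def)
  then show ?thesis
    by (auto simp: wform_minus wform_eps eval_at_eps eval_at_commute[of _ v] eval_at_minus)
qed

lemma dletter_not_eletter: "p \<in> dletters m \<Longrightarrow> p \<notin> eletters n"
proof
  assume "p \<in> dletters m" "p \<in> eletters n"
  then have "E p p = - E p p" using wform_dletter wform_eletter by metis
  then show False using letter_pairing[of p p] dletters_letters \<open>p \<in> dletters m\<close> by simp
qed

lemma dletter_eletter_neq:
  assumes "p \<in> dletters m" "q \<in> eletters n"
  shows "p \<noteq> q" "q \<noteq> - p" "p \<noteq> - q" "q \<noteq> p"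
  using assms dletter_not_eletter minus_letter by metis+

lemma letter_sum_eq:
  assumes "p \<in> L" "q \<in> L" "u \<in> L" "v \<in> L" and eq: "p + q = u + v" and "q \<noteq> - p"
  shows "p = u \<and> q = v \<or> p = v \<and> q = u"
proof -
  have "E p p + E p q = E p u + E p v"
    using eq by (simp flip: eval_at_add)
  then have "p = u \<or> p = v"
    using assms(1-4,6) by (auto simp: letter_pairing split: if_splits)
  with eq show ?thesis by (auto simp: add.commute)
qed

lemma even_root_iff:
  "\<alpha> \<in> even_roots m n \<longleftrightarrow>
    (\<exists>p q. (p \<in> dletters m \<and> q \<in> dletters m \<and> q \<noteq> - p \<or>
        p \<in> eletters n \<and> q \<in> eletters n \<and> q \<noteq> - p \<and> q \<noteq> p) \<and> \<alpha> = p + q)" (is "_ \<longleftrightarrow> ?R")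
proof
  have d: "delta i = delta k \<longleftrightarrow> i = k" "delta i \<noteq> - delta k" "- delta i \<noteq> delta k" for i k
  proof -
    have "i = k" if "delta i = delta k"
      using fun_cong[OF that, of "Dl i"] by (simp add: delta_apply split: if_splits)
    then show "delta i = delta k \<longleftrightarrow> i = k" by blast
    show "delta i \<noteq> - delta k"
    proof
      assume "delta i = - delta k"
      from fun_cong[OF this, of "Dl i"] show False by (simp add: delta_apply split: if_splits)
    qed
    show "- delta i \<noteq> delta k"
    proof
      assume "- delta i = delta k"
      from fun_cong[OF this, of "Dl i"] show False by (simp add: delta_apply split: if_splits)
    qed
  qed
  have e: "eps i = eps k \<longleftrightarrow> i = k" "eps i \<noteq> - eps k" "- eps i \<noteq> eps k" for i k
  proof -
    have "i = k" if "eps i = eps k"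
      using fun_cong[OF that, of "Ep i"] by (simp add: eps_apply split: if_splits)
    then show "eps i = eps k \<longleftrightarrow> i = k" by blast
    show "eps i \<noteq> - eps k"
    proof
      assume "eps i = - eps k"
      from fun_cong[OF this, of "Ep i"] show False by (simp add: eps_apply split: if_splits)
    qed
    show "- eps i \<noteq> eps k"
    proof
      assume "- eps i = eps k"
      from fun_cong[OF this, of "Ep i"] show False by (simp add: eps_apply split: if_splits)
    qed
  qed
  {
    assume "\<alpha> \<in> even_roots m n"
    then consider
       i k where "i \<in> {1..m}" "k \<in> {1..m} - {i}"
         "\<alpha> \<in> {delta i + delta k, delta i - delta k, - delta i + delta k, - delta i - delta k}"
     | i where "i \<in> {1..m}" "\<alpha> \<in> {delta i + delta i, - delta i - delta i}"
     | i k where "i \<in> {1..n}" "k \<in> {1..n} - {i}"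
         "\<alpha> \<in> {eps i + eps k, eps i - eps k, - eps i + eps k, - eps i - eps k}"
      unfolding even_roots_def by blast
    then show ?R
    proof cases
      case 1
      then obtain p q where "p \<in> {delta i, - delta i}" "q \<in> {delta k, - delta k}" "\<alpha> = p + q"
        unfolding diff_conv_add_uminus by blast
      moreover from this have "q \<noteq> - p" using 1 d by (metis DiffE insertE singletonD singletonI add.inverse_inverse)
      moreover have "p \<in> dletters m" "q \<in> dletters m"
        using calculation 1 unfolding dletters_def by blast+
      ultimately show ?thesis by blast
    next
      case 2
      then obtain p where "p \<in> {delta i, - delta i}" "\<alpha> = p + p"
        unfolding diff_conv_add_uminus by blast
      moreover from this have "p \<noteq> - p" using d(2)[of i i] d(3)[of i i] by auto
      moreover have "p \<in> dletters m"
        using calculation 2 unfolding dletters_def by blast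
      ultimately show ?thesis by blast
    next
      case 3
      then obtain p q where "p \<in> {eps i, - eps i}" "q \<in> {eps k, - eps k}" "\<alpha> = p + q"
        unfolding diff_conv_add_uminus by blast
      moreover from this have "q \<noteq> - p" "q \<noteq> p" using 3 e
        by (metis DiffE insertE singletonD singletonI add.inverse_inverse)+
      moreover have "p \<in> eletters n" "q \<in> eletters n"
        using calculation 3 unfolding eletters_def by blast+
      ultimately show ?thesis by blast
    qed
  }
  assume ?R
  then obtain p q where pq: "\<alpha> = p + q" "q \<noteq> - p"
    and "p \<in> dletters m \<and> q \<in> dletters m \<or> p \<in> eletters n \<and> q \<in> eletters n \<and> q \<noteq> p" by blast
  then consider
    i k where "i \<in> {1..m}" "k \<in> {1..m}" "p \<in> {delta i, - delta i}" "q \<in> {delta k, - delta k}"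
  | i k where "i \<in> {1..n}" "k \<in> {1..n}" "p \<in> {eps i, - eps i}" "q \<in> {eps k, - eps k}" "q \<noteq> p"
    unfolding dletters_def eletters_def by blast
  then show "\<alpha> \<in> even_roots m n"
  proof cases
    case 1
    show ?thesis
    proof (cases "i = k")
      case True
      then have "\<alpha> \<in> {delta i + delta i, - delta i - delta i}" using 1 pq by auto
      then show ?thesis using 1 unfolding even_roots_def by blast
    next
      case False
      then have "\<alpha> \<in> {delta i + delta k, delta i - delta k, - delta i + delta k, - delta i - delta k}"
        using 1 pq by auto
      then show ?thesis using 1 False unfolding even_roots_def by blast
    qed
  next
    case 2
    then have "i \<noteq> k" using pq by auto
    moreover have "\<alpha> \<in> {eps i + eps k, eps i - eps k, - eps i + eps k, - eps i - eps k}"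
      using 2 pq by auto
    ultimately show ?thesis using 2 unfolding even_roots_def by blast
  qed
qed

lemma odd_root_iff:
  "\<alpha> \<in> odd_roots m n \<longleftrightarrow> (\<exists>p\<in>dletters m. \<exists>q\<in>eletters n. \<alpha> = p + q)"
  unfolding odd_roots_def dletters_def eletters_def by (auto 4 4)

lemma root_iff:
  "\<alpha> \<in> R \<longleftrightarrow> (\<exists>p\<in>L. \<exists>q\<in>L. \<alpha> = p + q \<and> q \<noteq> - p \<and> \<not> (p = q \<and> p \<in> eletters n))"
  (is "_ \<longleftrightarrow> ?R")
proof
  assume "\<alpha> \<in> R"
  then consider "\<alpha> \<in> even_roots m n" | "\<alpha> \<in> odd_roots m n" unfolding roots_def by blast
  then show ?R
  proof cases
    case 1
    then show ?thesis unfolding even_root_iff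
      using dletters_letters eletters_letters dletter_not_eletter by metis
  next
    case 2
    then show ?thesis unfolding odd_root_iff
      using dletters_letters eletters_letters dletter_eletter_neq by metis
  qed
next
  assume ?R
  then obtain p q where pq: "p \<in> L" "q \<in> L" "\<alpha> = p + q" "q \<noteq> - p" "\<not> (p = q \<and> p \<in> eletters n)"
    by blast
  then consider "p \<in> dletters m" "q \<in> dletters m" | "p \<in> eletters n" "q \<in> eletters n"
    | "p \<in> dletters m" "q \<in> eletters n" | "p \<in> eletters n" "q \<in> dletters m"
    unfolding letters_def by blast
  then show "\<alpha> \<in> R"
  proof cases
    case 1 then show ?thesis using pq unfolding roots_def by (auto simp: even_root_iff)
  next
    case 2 then show ?thesis using pq unfolding roots_def by (auto simp: even_root_iff)
  next
    case 3 then show ?thesis using pq unfolding roots_def by (auto simp: odd_root_iff)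
  next
    case 4 then show ?thesis 
      using pq bexI[of "\<lambda>x. \<exists>y\<in>eletters n. \<alpha> = x + y" q] unfolding roots_def
      by (auto simp: odd_root_iff add.commute[of p q])
  qed
qed

text \<open>
  The two letters of a root are determined up to order, so it can be decided
  on the letters whether a sum of two of them is a root.
\<close>

lemma letter_sum_root:
  assumes "p \<in> L" "q \<in> L"
  shows "p + q \<in> R \<longleftrightarrow> q \<noteq> - p \<and> \<not> (p = q \<and> p \<in> eletters n)" (is "_ \<longleftrightarrow> ?V p q")
proof
  assume "p + q \<in> R"
  then obtain u v where uv: "u \<in> L" "v \<in> L" "u + v = p + q" "?V u v"
    unfolding root_iff by metis
  then have "u = p \<and> v = q \<or> u = q \<and> v = p" using letter_sum_eq[of u v p q] assms by blast
  with uv(4) show "?V p q" by auto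
qed (use assms root_iff in blast)

lemma rootE:
  assumes "\<alpha> \<in> R"
  obtains p q where "p \<in> L" "q \<in> L" "\<alpha> = p + q" "q \<noteq> - p" "\<not> (p = q \<and> p \<in> eletters n)"
  using assms root_iff by blast

lemma oddE:
  assumes "\<gamma> \<in> odd_roots m n"
  obtains p q where "p \<in> dletters m" "q \<in> eletters n" "\<gamma> = p + q" "p \<in> L" "q \<in> L"
  using assms odd_root_iff dletters_letters eletters_letters by blast

lemma minus_root: "\<alpha> \<in> R \<Longrightarrow> - \<alpha> \<in> R"
proof -
  assume "\<alpha> \<in> R"
  then obtain p q where "p \<in> L" "q \<in> L" "\<alpha> = p + q" "q \<noteq> - p" "\<not> (p = q \<and> p \<in> eletters n)"
    by (rule rootE)
  then have "- p + - q \<in> R" using minus_letter[of p] minus_letter[of q] minus_letter(3)[of "-p"]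
    by (subst letter_sum_root) auto
  then show ?thesis using \<open>\<alpha> = p + q\<close> by (simp add: add.commute)
qed

lemma minus_root_iff: "- \<alpha> \<in> R \<longleftrightarrow> \<alpha> \<in> R"
  using minus_root[of \<alpha>] minus_root[of "-\<alpha>"] by auto

lemma minus_odd: "\<gamma> \<in> odd_roots m n \<Longrightarrow> - \<gamma> \<in> odd_roots m n"
  unfolding odd_root_iff using minus_letter(2,3) by (metis minus_add_distrib)

lemma minus_odd_iff: "- \<gamma> \<in> odd_roots m n \<longleftrightarrow> \<gamma> \<in> odd_roots m n"
  using minus_odd[of \<gamma>] minus_odd[of "-\<gamma>"] by auto

lemma odd_is_root: "\<gamma> \<in> odd_roots m n \<Longrightarrow> \<gamma> \<in> R"
  and even_is_root: "\<gamma> \<in> even_roots m n \<Longrightarrow> \<gamma> \<in> R"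
  by (auto simp: roots_def)

lemma root_nonzero: "\<alpha> \<in> R \<Longrightarrow> \<alpha> \<noteq> 0"
  by (metis root_iff eq_neg_iff_add_eq_0 add.commute)

lemma zero_not_root: "0 \<notin> R"
  using root_nonzero by blast

lemma odd_not_even: "\<gamma> \<in> odd_roots m n \<Longrightarrow> \<gamma> \<notin> even_roots m n"
proof
  assume "\<gamma> \<in> odd_roots m n" "\<gamma> \<in> even_roots m n"
  then obtain p q u v where pq: "p \<in> dletters m" "q \<in> eletters n" "\<gamma> = p + q" "\<gamma> = u + v"
    and uv: "u \<in> dletters m \<and> v \<in> dletters m \<or> u \<in> eletters n \<and> v \<in> eletters n"
    unfolding odd_root_iff even_root_iff by metis
  then have "p = u \<and> q = v \<or> p = v \<and> q = u"
    using letter_sum_eq[of p q u v] dletter_eletter_neq(2) dletters_letters eletters_letters by metis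
  with pq(1,2) uv show False using dletter_not_eletter by metis
qed

lemma root_not_odd_even: "\<alpha> \<in> R \<Longrightarrow> \<alpha> \<notin> odd_roots m n \<Longrightarrow> \<alpha> \<in> even_roots m n"
  by (auto simp: roots_def)

text \<open>
  A root has only two letters.  Without cancellation each of the four letters on the left would
  have a positive Euclidean product with the sum, hence be \<open>u\<close> or \<open>v\<close>; but no four letters
  taken from \<open>u\<close> and \<open>v\<close> add up to \<open>u + v\<close>.
\<close>

lemma letter_cancel:
  assumes L: "p \<in> L" "q \<in> L" "r \<in> L" "s \<in> L" "u \<in> L" "v \<in> L"
    and eq: "(p + q) + (r + s) = u + v" and "q \<noteq> - p" "s \<noteq> - r" "v \<noteq> - u"
  shows "r = - p \<or> r = - q \<or> s = - p \<or> s = - q"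
proof (rule ccontr)
  assume "\<not> ?thesis"
  then have nc: "r \<noteq> - p" "r \<noteq> - q" "s \<noteq> - p" "s \<noteq> - q"
      "p \<noteq> - r" "p \<noteq> - s" "q \<noteq> - r" "q \<noteq> - s" "p \<noteq> - q" "r \<noteq> - s" using assms(8,9) by auto
  have in_uv: "x = u \<or> x = v" if "x \<in> {p, q, r, s}" for x
  proof -
    have x: "x \<in> L" using that L by blast
    have "E x p + E x q + E x r + E x s = E x u + E x v"
      using eq by (simp add: add.assoc flip: eval_at_add)
    moreover have "E x p + E x q + E x r + E x s \<ge> 1"
      using that nc assms(8,9) x L by (auto simp: letter_pairing)
    ultimately show ?thesis using x L by (auto simp: letter_pairing split: if_splits)
  qed
  have "E u p + E u q + E u r + E u s = E u u + E u v"
    "E v p + E v q + E v r + E v s = E v u + E v v"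
    using eq by (simp_all add: add.assoc flip: eval_at_add)
  then show False
    using in_uv[of p] in_uv[of q] in_uv[of r] in_uv[of s] L assms(10)
    by (cases "u = v") (auto simp: letter_pairing split: if_splits)
qed

text \<open>
  The working form of the cancellation: if two roots add up to a root, then a letter \<open>p\<close> of the
  first one is cancelled by the letter \<open>-p\<close> of the second one.
\<close>

lemma root_sum_share:
  assumes "x \<in> R" "y \<in> R" "x + y \<in> R"
  obtains p q r where "p \<in> L" "q \<in> L" "r \<in> L" "x = p + q" "y = r + - p" "x + y = q + r"
proof -
  obtain a b where ab: "a \<in> L" "b \<in> L" "x = a + b" "b \<noteq> - a" using assms(1) by (rule rootE)
  obtain c d where cd: "c \<in> L" "d \<in> L" "y = c + d" "d \<noteq> - c" using assms(2) by (rule rootE)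
  obtain u v where uv: "u \<in> L" "v \<in> L" "x + y = u + v" "v \<noteq> - u" using assms(3) by (rule rootE)
  have "c = - a \<or> c = - b \<or> d = - a \<or> d = - b"
    using letter_cancel[of a b c d u v] ab cd uv by simp
  then consider "c = - a" | "c = - b" | "d = - a" | "d = - b" by blast
  then show ?thesis
  proof cases
    case 1 show ?thesis by (rule that[of a b d]) (use 1 ab cd in \<open>simp_all add: algebra_simps\<close>)
  next
    case 2 show ?thesis by (rule that[of b a d]) (use 2 ab cd in \<open>simp_all add: algebra_simps\<close>)
  next
    case 3 show ?thesis by (rule that[of a b c]) (use 3 ab cd in \<open>simp_all add: algebra_simps\<close>)
  next
    case 4 show ?thesis by (rule that[of b a c]) (use 4 ab cd in \<open>simp_all add: algebra_simps\<close>)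
  qed
qed

end

section \<open>Root strings in the direction of an isotropic root\<close>

context spo
begin

lemma eval_at_add_left: "E (u + v) w = E u w + E v w"
  by (simp add: eval_at_def algebra_simps sum.distrib)

lemma odd_isotropic: "\<gamma> \<in> odd_roots m n \<Longrightarrow> B \<gamma> \<gamma> = 0"
  and odd_norm: "\<gamma> \<in> odd_roots m n \<Longrightarrow> E \<gamma> \<gamma> = 2"
proof -
  assume "\<gamma> \<in> odd_roots m n"
  then obtain p q where pq: "p \<in> dletters m" "q \<in> eletters n" "\<gamma> = p + q" "p \<in> L" "q \<in> L"
    by (rule oddE)
  note ne = dletter_eletter_neq[OF pq(1,2)]
  have "B p p = 1" "B q q = -1" "B p q = 0"
    using pq ne by (simp_all add: wform_dletter wform_eletter letter_pairing)
  then show "B \<gamma> \<gamma> = 0" using pq(3) wform_commute[of p q] by (simp add: wform_linear)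
  have "E p p = 1" "E q q = 1" "E p q = 0" using pq ne by (simp_all add: letter_pairing)
  then show "E \<gamma> \<gamma> = 2"
    using pq(3) eval_at_commute[of p q] by (simp add: eval_at_add eval_at_add_left)
qed

lemma odd_letters:
  assumes "\<gamma> \<in> odd_roots m n" "\<gamma> = p + q" "p \<in> L" "q \<in> L"
  shows "p \<in> dletters m \<and> q \<in> eletters n \<or> q \<in> dletters m \<and> p \<in> eletters n"
proof -
  obtain g1 g2 where g: "g1 \<in> dletters m" "g2 \<in> eletters n" "\<gamma> = g1 + g2" "g1 \<in> L" "g2 \<in> L"
    using assms(1) by (rule oddE)
  have "g1 = p \<and> g2 = q \<or> g1 = q \<and> g2 = p"
    using letter_sum_eq[OF g(4,5) assms(3,4)] g assms dletter_eletter_neq[OF g(1,2)] by auto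
  with g show ?thesis by auto
qed

text \<open>
  The string of roots through \<open>\<beta>\<close> in the direction of an isotropic root \<open>\<gamma>\<close> is trivial if the
  two are orthogonal, and otherwise consists of \<open>\<beta>\<close> and exactly one of \<open>\<beta> + \<gamma>\<close> and \<open>\<beta> - \<gamma>\<close>
  (for \<open>\<beta> \<noteq> \<plusminus>\<gamma>\<close>).  This is the content of this lemma and the next two.
\<close>

lemma isotropic_string_nonorthogonal:
  assumes \<gamma>: "\<gamma> \<in> odd_roots m n" and \<beta>: "\<beta> \<in> R" and sum: "\<beta> + \<gamma> \<in> R"
  shows "B \<beta> \<gamma> \<noteq> 0"
proof -
  obtain p q r where L: "p \<in> L" "q \<in> L" "r \<in> L"
    and eq: "\<beta> = p + q" "\<gamma> = r + - p" "\<beta> + \<gamma> = q + r"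
    using root_sum_share[OF \<beta> odd_is_root[OF \<gamma>] sum] .
  have "q \<noteq> - p" "q \<noteq> - r"
    using root_nonzero[OF \<beta>] root_nonzero[OF sum] eq by auto
  then have ge: "E p q \<ge> 0" "E r q \<ge> 0" using L by (auto simp: letter_pairing)
  have "r \<in> dletters m \<and> - p \<in> eletters n \<or> - p \<in> dletters m \<and> r \<in> eletters n"
    using odd_letters[OF \<gamma> eq(2) L(3) minus_letter(1)[OF L(1)]] .
  then consider "r \<in> dletters m" "p \<in> eletters n" | "p \<in> dletters m" "r \<in> eletters n"
    using minus_letter(2,3)[of "- p"] by auto
  then show ?thesis
  proof cases
    case 1
    note ne = dletter_eletter_neq[OF 1]
    have "B p p = -1" "B p r = 0" "B q r = E r q" "B q p = - E p q"
      using 1 ne L wform_commute[of q r] wform_commute[of q p]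
      by (simp_all add: wform_dletter wform_eletter letter_pairing)
    then have "B \<beta> \<gamma> = 1 + E r q + E p q" using eq by (simp add: wform_linear)
    with ge show ?thesis by simp
  next
    case 2
    note ne = dletter_eletter_neq[OF 2]
    have "B p p = 1" "B p r = 0" "B q r = - E r q" "B q p = E p q"
      using 2 ne L wform_commute[of q r] wform_commute[of q p]
      by (simp_all add: wform_dletter wform_eletter letter_pairing)
    then have "B \<beta> \<gamma> = - (1 + E r q + E p q)" using eq by (simp add: wform_linear)
    with ge show ?thesis by simp
  qed
qed

lemma isotropic_string_exists:
  assumes \<gamma>: "\<gamma> \<in> odd_roots m n" and \<beta>: "\<beta> \<in> R" and nz: "B \<beta> \<gamma> \<noteq> 0"
  shows "\<beta> + \<gamma> \<in> R \<or> \<beta> - \<gamma> \<in> R"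
proof -
  obtain a b where g: "a \<in> dletters m" "b \<in> eletters n" "\<gamma> = a + b" "a \<in> L" "b \<in> L"
    using \<gamma> by (rule oddE)
  obtain p q where pq: "p \<in> L" "q \<in> L" "\<beta> = p + q" "q \<noteq> - p" "\<not> (p = q \<and> p \<in> eletters n)"
    using \<beta> by (rule rootE)
  note ne = dletter_eletter_neq[OF g(1,2)]
  have ok: "\<beta> + \<gamma> \<in> R \<or> \<beta> - \<gamma> \<in> R"
    if xy: "\<beta> = x + y" "x \<in> {a, - a, b, - b}" "y \<in> L" for x y
  proof -
    have yn: "\<beta> \<noteq> - \<gamma>" "\<beta> \<noteq> \<gamma>" using nz odd_isotropic[OF \<gamma>] by (auto simp: wform_linear)
    note ab = g(4,5) minus_letter(1)[OF g(4)] minus_letter(1)[OF g(5)]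
    have na: "a \<notin> eletters n" "- a \<notin> eletters n"
      using dletter_not_eletter[OF g(1)] dletter_not_eletter[OF minus_letter(2)[OF g(1)]] .
    consider "x = - a" "y \<noteq> b" | "x = - a" "y = b" | "x = a" "y \<noteq> - b" | "x = a" "y = - b"
      | "x = b" | "x = - b" using xy(2) by (metis insertE singletonD)
    then show ?thesis
    proof cases
      case 1
      then have "b \<noteq> - y" using yn(1) xy(1) g(3) by force
      then have "y + b \<in> R" using letter_sum_root[OF \<open>y \<in> L\<close> g(5)] 1 by blast
      moreover have "\<beta> + \<gamma> = y + b" using 1 xy(1) g(3) by simp
      ultimately show ?thesis by simp
    next
      case 2
      have "- a + - a \<in> R" using letter_sum_root[OF ab(3) ab(3)] na letter_self[OF ab(3)] by blast
      moreover have "\<beta> - \<gamma> = - a + - a" using 2 xy(1) g(3) by simp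
      ultimately show ?thesis by simp
    next
      case 3
      then have "- b \<noteq> - y" using yn(2) xy(1) g(3) by force
      then have "y + - b \<in> R" using letter_sum_root[OF \<open>y \<in> L\<close> ab(4)] 3 by blast
      moreover have "\<beta> - \<gamma> = y + - b" using 3 xy(1) g(3) by simp
      ultimately show ?thesis by simp
    next
      case 4
      have "a + a \<in> R" using letter_sum_root[OF g(4) g(4)] na letter_self[OF g(4)] by blast
      moreover have "\<beta> + \<gamma> = a + a" using 4 xy(1) g(3) by simp
      ultimately show ?thesis by simp
    next
      case 5
      then have "- a \<noteq> - y" using yn(2) xy(1) g(3) by (force simp: add.commute)
      then have "y + - a \<in> R" using letter_sum_root[OF \<open>y \<in> L\<close> ab(3)] na by blast
      moreover have "\<beta> - \<gamma> = y + - a" using 5 xy(1) g(3) by simp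
      ultimately show ?thesis by simp
    next
      case 6
      then have "a \<noteq> - y" using yn(1) xy(1) g(3) by force
      then have "y + a \<in> R" using letter_sum_root[OF \<open>y \<in> L\<close> g(4)] na by blast
      moreover have "\<beta> + \<gamma> = y + a" using 6 xy(1) g(3) by simp
      ultimately show ?thesis by simp
    qed
  qed
  have B: "B \<beta> \<gamma> = E a p + E a q - E b p - E b q"
  proof -
    have "B \<beta> \<gamma> = B a \<beta> + B b \<beta>" using g(3) by (simp add: wform_linear wform_commute[of \<beta> a] wform_commute[of \<beta> b])
    then show ?thesis unfolding wform_dletter[OF g(1)] wform_eletter[OF g(2)] pq(3) eval_at_add by simp
  qed
  have "p \<in> {a, - a, b, - b} \<or> q \<in> {a, - a, b, - b}"
  proof (rule ccontr)
    assume "\<not> ?thesis"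
    then have "E a p = 0" "E a q = 0" "E b p = 0" "E b q = 0"
      using g pq by (auto simp: letter_pairing)
    with B nz show False by simp
  qed
  then show ?thesis using ok[of p q] ok[of q p] pq by (auto simp: add.commute)
qed

text \<open>
  If both neighbours of \<open>\<beta> = p + q\<close> were roots, then \<open>\<gamma> = q - p\<close> up to order, and the neighbours
  would be \<open>2 q\<close> and \<open>2 p\<close>.  But one of the two letters of the odd root \<open>\<gamma>\<close> is some \<open>\<plusminus>\<epsilon>\<^sub>j\<close>,
  and \<open>2 \<epsilon>\<^sub>j\<close> is not a root.
\<close>

lemma isotropic_string_unique:
  assumes \<gamma>: "\<gamma> \<in> odd_roots m n" and \<beta>: "\<beta> \<in> R" and plus: "\<beta> + \<gamma> \<in> R"
  shows "\<beta> - \<gamma> \<notin> R"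
proof
  assume minus: "\<beta> - \<gamma> \<in> R"
  obtain p q r where L: "p \<in> L" "q \<in> L" "r \<in> L"
    and eq: "\<beta> = p + q" "\<gamma> = r + - p" "\<beta> + \<gamma> = q + r"
    using root_sum_share[OF \<beta> odd_is_root[OF \<gamma>] plus] .
  have "\<beta> + - \<gamma> \<in> R" using minus by simp
  then obtain p' q' r' where L': "p' \<in> L" "q' \<in> L" "r' \<in> L"
    and eq': "\<beta> = p' + q'" "- \<gamma> = r' + - p'" "\<beta> + - \<gamma> = q' + r'"
    using root_sum_share[OF \<beta> minus_root[OF odd_is_root[OF \<gamma>]]] by metis
  have qp: "q \<noteq> - p" using root_nonzero[OF \<beta>] eq by auto
  have rp: "r \<noteq> p" using root_nonzero[OF odd_is_root[OF \<gamma>]] eq by auto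
  have g: "r + - p = p' + - r'" using eq(2) eq'(2) by (simp add: eq_neg_iff_add_eq_0 algebra_simps)
  have g': "r = p' \<and> - p = - r' \<or> r = - r' \<and> - p = p'"
    using letter_sum_eq[OF L(3) minus_letter(1)[OF L(1)] L'(1) minus_letter(1)[OF L'(3)] g] rp
    by auto
  have "p = p' \<and> q = q' \<or> p = q' \<and> q = p'"
    using letter_sum_eq[OF L(1,2) L'(1,2)] eq eq' qp by auto
  with g' rp qp letter_self[OF L(1)] have r: "r = q" "r' = p" "q' = p" by auto
  have "q + q \<in> R" "p + p \<in> R" using plus \<open>\<beta> + - \<gamma> \<in> R\<close> eq(3) eq'(3) r by auto
  then have "q \<notin> eletters n" "p \<notin> eletters n"
    using letter_sum_root[OF L(2) L(2)] letter_sum_root[OF L(1) L(1)] by blast+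
  moreover have "- p \<in> eletters n \<or> q \<in> eletters n"
    using odd_letters[OF \<gamma> eq(2) L(3) minus_letter(1)[OF L(1)]] r by auto
  ultimately show False using minus_letter(3)[of "- p"] by auto
qed

text \<open>
  For root vectors this is the Jacobi identity: if the bracket of \<open>e\<^sub>\<gamma>\<close> with \<open>[e\<^sub>x, e\<^sub>y]\<close>
  does not vanish, then \<open>e\<^sub>\<gamma>\<close> has a nonzero bracket with \<open>e\<^sub>x\<close> or with \<open>e\<^sub>y\<close>.  It makes an
  indecomposable root remain so when \<open>\<gamma>\<close> is subtracted, see \<open>odd_flip_simple_subset\<close>.
\<close>

lemma odd_root_string_split:
  assumes \<gamma>: "\<gamma> \<in> odd_roots m n" and x: "x \<in> R" and y: "y \<in> R" and xy: "x + y \<in> R"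
    and xyg: "x + y + \<gamma> \<in> R" and "x \<noteq> - \<gamma>" "y \<noteq> - \<gamma>"
  shows "x + \<gamma> \<in> R \<or> y + \<gamma> \<in> R"
proof -
  obtain p q r where L: "p \<in> L" "q \<in> L" "r \<in> L"
    and eq: "x = p + q" "y = r + - p" "x + y = q + r"
    using root_sum_share[OF x y xy] .
  obtain a b c where L': "a \<in> L" "b \<in> L" "c \<in> L"
    and eq': "x + y = a + b" "\<gamma> = c + - a" "x + y + \<gamma> = b + c"
    using root_sum_share[OF xy odd_is_root[OF \<gamma>] xyg] .
  have qr: "r \<noteq> - q" using root_nonzero[OF xy] eq by auto
  then have "q = a \<and> r = b \<or> q = b \<and> r = a"
    using letter_sum_eq[OF L(2,3) L'(1,2)] eq(3) eq'(1) by simp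
  then have "q = a \<or> r = a" by blast
  note mp = minus_letter(1)[OF L(1)] and mq = minus_letter(1)[OF L(2)]
    and mr = minus_letter(1)[OF L(3)]
  then show ?thesis using \<open>q = a \<or> r = a\<close>
  proof (elim disjE)
    assume "r = a"
    then have yg: "y + \<gamma> = - p + c" using eq(2) eq'(2) \<open>r = a\<close> by (simp add: algebra_simps)
    show ?thesis
    proof (cases "y + \<gamma> \<in> R")
      case False
      then have "c = p \<or> c = - p" using letter_sum_root[OF mp L'(3)] yg by auto
      moreover have "c \<noteq> p" using \<open>y \<noteq> - \<gamma>\<close> eq eq' \<open>r = a\<close> by auto
      ultimately have c: "c = - p" by blast
      then have xg: "x + \<gamma> = q + - r" unfolding eq(1) eq'(2) \<open>r = a\<close> c by (simp add: algebra_simps)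
      have "q \<noteq> r" using \<open>x \<noteq> - \<gamma>\<close> eq eq' \<open>r = a\<close> c by auto
      then have "x + \<gamma> \<in> R" unfolding xg using letter_sum_root[OF L(2) mr] qr by auto
      then show ?thesis ..
    qed simp
  next
    assume "q = a"
    then have xg: "x + \<gamma> = p + c" using eq(1) eq'(2) \<open>q = a\<close> by (simp add: algebra_simps)
    show ?thesis
    proof (cases "x + \<gamma> \<in> R")
      case False
      then have "c = - p \<or> c = p" using letter_sum_root[OF L(1) L'(3)] xg by auto
      moreover have "c \<noteq> - p" using \<open>x \<noteq> - \<gamma>\<close> eq eq' \<open>q = a\<close> by auto
      ultimately have c: "c = p" by blast
      then have yg: "y + \<gamma> = r + - q" unfolding eq(2) eq'(2) \<open>q = a\<close> c by (simp add: algebra_simps)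
      have "q \<noteq> r" using \<open>y \<noteq> - \<gamma>\<close> eq eq' \<open>q = a\<close> c by auto
      then have "y + \<gamma> \<in> R" unfolding yg using letter_sum_root[OF L(3) mq] qr by auto
      then show ?thesis ..
    qed simp
  qed
qed

text \<open>
  Used for pushing a functional towards the wall of \<open>\<gamma>\<close>: only the roots at an acute Euclidean angle
  to \<open>\<gamma>\<close> lose value.  Where \<open>\<gamma>\<close> is simple, a positive one among them exceeds \<open>\<gamma>\<close> by a positive root,
  which keeps its value above 0.
\<close>

lemma acute_odd_root_difference:
  assumes \<gamma>: "\<gamma> \<in> odd_roots m n" and \<beta>: "\<beta> \<in> R" and "\<beta> \<noteq> \<gamma>" and pos: "E \<gamma> \<beta> > 0"
  shows "\<beta> - \<gamma> \<in> R \<and> E \<gamma> \<beta> \<le> 2"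
proof -
  obtain a b where g: "a \<in> dletters m" "b \<in> eletters n" "\<gamma> = a + b" "a \<in> L" "b \<in> L"
    using \<gamma> by (rule oddE)
  obtain p q where pq: "p \<in> L" "q \<in> L" "\<beta> = p + q" "q \<noteq> - p" "\<not> (p = q \<and> p \<in> eletters n)"
    using \<beta> by (rule rootE)
  note ne = dletter_eletter_neq[OF g(1,2)]
  have Ea: "E \<gamma> \<beta> = E a p + E b p + (E a q + E b q)"
    using g pq by (simp add: eval_at_add eval_at_add_left)
  have le: "E a x + E b x \<le> 1" if "x \<in> L" for x
    using g that ne by (auto simp: letter_pairing)
  have ok: "\<beta> - \<gamma> \<in> R" if xy: "\<beta> = x + y" "x = a \<or> x = b" "x \<in> L" "y \<in> L"
      "E \<gamma> \<beta> = E a x + E b x + (E a y + E b y)" for x y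
    using xy(2)
  proof
    assume "x = a"
    have "y \<noteq> b" "y \<noteq> - b"
      using \<open>\<beta> \<noteq> \<gamma>\<close> \<open>x = a\<close> xy g pos ne by (auto simp: letter_pairing split: if_splits)
    then have "y + - b \<in> R" using letter_sum_root[OF \<open>y \<in> L\<close> minus_letter(1)[OF g(5)]] by auto
    then show ?thesis using xy g \<open>x = a\<close> by (simp add: algebra_simps)
  next
    assume "x = b"
    have "y \<noteq> a" using \<open>\<beta> \<noteq> \<gamma>\<close> \<open>x = b\<close> xy g by (auto simp: add.commute)
    moreover have "- a \<notin> eletters n" using dletter_not_eletter[OF minus_letter(2)[OF g(1)]] .
    ultimately have "y + - a \<in> R"
      using letter_sum_root[OF \<open>y \<in> L\<close> minus_letter(1)[OF g(4)]] by auto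
    then show ?thesis using xy g \<open>x = b\<close> by (simp add: algebra_simps)
  qed
  have "p = a \<or> p = b \<or> q = a \<or> q = b"
  proof (rule ccontr)
    assume "\<not> ?thesis"
    then have "E a p \<le> 0" "E b p \<le> 0" "E a q \<le> 0" "E b q \<le> 0"
      using g pq by (auto simp: letter_pairing)
    with Ea pos show False by simp
  qed
  then have "\<beta> - \<gamma> \<in> R" using ok[of p q] ok[of q p] pq Ea by (auto simp: add.commute)
  then show ?thesis using Ea le[OF pq(1)] le[OF pq(2)] by simp
qed

section \<open>Simple systems and odd reflections\<close>

lemma finite_roots: "finite R"
  unfolding roots_def even_roots_def odd_roots_def by auto

lemma positive_systemE:
  assumes "positive_system m n P"
  obtains h where "\<forall>\<alpha>\<in>R. E h \<alpha> \<noteq> 0" "P = {\<alpha> \<in> R. E h \<alpha> > 0}"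
  using assms unfolding positive_system_def by blast

lemma positive_system_closed:
  assumes "positive_system m n P"
  shows "x \<in> P \<Longrightarrow> x \<in> R" "x \<in> R \<Longrightarrow> x \<notin> P \<Longrightarrow> - x \<in> P" "x \<in> P \<Longrightarrow> - x \<notin> P"
    "x \<in> P \<Longrightarrow> y \<in> P \<Longrightarrow> x + y \<in> R \<Longrightarrow> x + y \<in> P"
    "x \<in> P \<Longrightarrow> y \<in> P \<Longrightarrow> x + y \<noteq> 0"
proof -
  obtain h where h: "\<forall>\<alpha>\<in>R. E h \<alpha> \<noteq> 0" "P = {\<alpha> \<in> R. E h \<alpha> > 0}"
    using assms by (rule positive_systemE)
  show "x \<in> P \<Longrightarrow> x \<in> R" "x \<in> P \<Longrightarrow> - x \<notin> P"
    "x \<in> P \<Longrightarrow> y \<in> P \<Longrightarrow> x + y \<in> R \<Longrightarrow> x + y \<in> P"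
    unfolding h(2) by (auto simp: eval_at_linear)
  show "x \<in> R \<Longrightarrow> x \<notin> P \<Longrightarrow> - x \<in> P"
    using h(1) unfolding h(2) by (auto simp: eval_at_linear minus_root)
  have "E h (x + y) > 0" if "x \<in> P" "y \<in> P" using that unfolding h(2) by (auto simp: eval_at_linear)
  then show "x \<in> P \<Longrightarrow> y \<in> P \<Longrightarrow> x + y \<noteq> 0" by (auto simp: eval_at_zero)
qed

lemma simple_indecomposable:
  "\<alpha> \<in> simple_roots P \<Longrightarrow> \<beta> \<in> P \<Longrightarrow> \<gamma> \<in> P \<Longrightarrow> \<alpha> \<noteq> \<beta> + \<gamma>"
  by (auto simp: simple_roots_def)

lemma simple_is_positive: "\<alpha> \<in> simple_roots P \<Longrightarrow> \<alpha> \<in> P"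
  by (auto simp: simple_roots_def)

lemma difference_from_simple_positive:
  assumes P: "positive_system m n P" and \<gamma>: "\<gamma> \<in> simple_roots P" and "\<beta> \<in> P" and "\<beta> - \<gamma> \<in> R"
  shows "\<beta> - \<gamma> \<in> P"
proof (rule ccontr)
  assume "\<beta> - \<gamma> \<notin> P"
  then have "\<gamma> - \<beta> \<in> P" using positive_system_closed(2)[OF P assms(4)] by simp
  then have "\<gamma> \<noteq> \<beta> + (\<gamma> - \<beta>)" using simple_indecomposable[OF \<gamma>] assms(3) by blast
  then show False by simp
qed

lemma simple_difference_not_root:
  assumes P: "positive_system m n P" and "\<alpha> \<in> simple_roots P" "\<beta> \<in> simple_roots P"
  shows "\<alpha> - \<beta> \<notin> R"
proof
  assume "\<alpha> - \<beta> \<in> R"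
  then have "\<alpha> - \<beta> \<in> P"
    using difference_from_simple_positive[OF P] assms simple_is_positive by blast
  then have "\<alpha> \<noteq> (\<alpha> - \<beta>) + \<beta>"
    using simple_indecomposable assms(2) simple_is_positive[OF assms(3)] by blast
  then show False by simp
qed

lemma small_multiple_below:
  fixes f g :: "'a \<Rightarrow> real"
  assumes "finite A" "\<And>a. a \<in> A \<Longrightarrow> f a > 0"
  shows "\<exists>\<kappa>>0. \<forall>a\<in>A. \<kappa> * g a < f a"
  using assms
proof (induction A)
  case empty then show ?case by (intro exI[of _ 1]) auto
next
  case (insert a A)
  then obtain \<kappa> where \<kappa>: "\<kappa> > 0" "\<forall>a\<in>A. \<kappa> * g a < f a" by auto
  define \<mu> where "\<mu> = min \<kappa> (f a / (2 * (\<bar>g a\<bar> + 1)))"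
  have fa: "f a > 0" using insert by auto
  then have \<mu>: "\<mu> > 0" "\<mu> \<le> \<kappa>" using \<kappa> by (auto simp: \<mu>_def)
  have "\<mu> * g a \<le> \<mu> * (\<bar>g a\<bar> + 1)" using \<mu> by (intro mult_left_mono) auto
  also have "\<dots> \<le> f a / (2 * (\<bar>g a\<bar> + 1)) * (\<bar>g a\<bar> + 1)"
    by (intro mult_right_mono) (auto simp: \<mu>_def)
  also have "\<dots> = f a / 2" by (simp add: field_simps)
  finally have "\<mu> * g a < f a" using fa by simp
  moreover have "\<mu> * g b < f b" if "b \<in> A" for b
  proof (cases "g b \<ge> 0")
    case True
    then have "\<mu> * g b \<le> \<kappa> * g b" using \<mu> by (intro mult_right_mono) auto
    then show ?thesis using \<kappa> that by fastforce
  next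
    case False
    then have "\<mu> * g b < 0" using \<mu> by (simp add: mult_pos_neg)
    then show ?thesis using insert that by fastforce
  qed
  ultimately show ?case using \<mu> by auto
qed

text \<open>
  The functional \<open>h\<close> defining the positive system is moved, in the Euclidean direction of \<open>\<gamma>\<close>, onto the wall
  of \<open>\<gamma>\<close> and then slightly beyond it.  On the wall all positive roots other than \<open>\<gamma>\<close> still
  have positive values, so that only \<open>\<gamma>\<close> changes its sign.
\<close>

lemma odd_flip_positive_system:
  assumes P: "positive_system m n P" and \<gamma>: "\<gamma> \<in> simple_roots P" and odd: "\<gamma> \<in> odd_roots m n"
  shows "positive_system m n (insert (- \<gamma>) (P - {\<gamma>}))"
proof -
  obtain h where h: "\<forall>\<alpha>\<in>R. E h \<alpha> \<noteq> 0" "P = {\<alpha> \<in> R. E h \<alpha> > 0}"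
    using P by (rule positive_systemE)
  have gP: "\<gamma> \<in> P" using \<gamma> by (rule simple_is_positive)
  then have d: "E h \<gamma> > 0" and gR: "\<gamma> \<in> R" using h(2) by auto
  (* The values of the functional that has been moved onto the wall of \<open>\<gamma>\<close>. *)
  define w where "w \<beta> = E h \<beta> - E h \<gamma> / 2 * E \<gamma> \<beta>" for \<beta>
  have w0: "w \<gamma> = 0" using odd_norm[OF odd] by (simp add: w_def)
  have w_pos: "w \<beta> > 0" if \<beta>: "\<beta> \<in> P - {\<gamma>}" for \<beta>
  proof (cases "E \<gamma> \<beta> > 0")
    case True
    then have df: "\<beta> - \<gamma> \<in> R" "E \<gamma> \<beta> \<le> 2"
      using acute_odd_root_difference[OF odd, of \<beta>] \<beta> h(2) by auto
    then have "\<beta> - \<gamma> \<in> P" using difference_from_simple_positive[OF P \<gamma>] \<beta> by blast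
    then have "E h \<gamma> < E h \<beta>" using h(2) by (auto simp: eval_at_linear)
    moreover have "E h \<gamma> / 2 * E \<gamma> \<beta> \<le> E h \<gamma> / 2 * 2" using df d by (intro mult_left_mono) auto
    ultimately show ?thesis by (simp add: w_def)
  next
    case False
    then have "E h \<gamma> / 2 * E \<gamma> \<beta> \<le> 0" using d by (simp add: mult_nonneg_nonpos)
    moreover have "E h \<beta> > 0" using \<beta> h(2) by auto
    ultimately show ?thesis by (simp add: w_def)
  qed
  have "finite (P - {\<gamma>})" using finite_roots h(2) by auto
  (* How far one can go beyond the wall without reaching another one. *)
  then obtain \<kappa> where \<kappa>: "\<kappa> > 0" "\<forall>\<beta>\<in>P - {\<gamma>}. \<kappa> * E h \<beta> < w \<beta>"
    using small_multiple_below[of "P - {\<gamma>}" w "E h"] w_pos by blast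
  define h' where "h' = (\<lambda>c. (1 - \<kappa>) * h c) + - (\<lambda>c. E h \<gamma> / 2 * \<gamma> c)"
  have h': "E h' \<beta> = w \<beta> - \<kappa> * E h \<beta>" for \<beta>
  proof -
    have "E \<beta> h' = (1 - \<kappa>) * E \<beta> h + - (E h \<gamma> / 2 * E \<beta> \<gamma>)"
      unfolding h'_def eval_at_add eval_at_minus eval_at_scale ..
    then show ?thesis
      by (simp add: w_def algebra_simps eval_at_commute[of \<beta> h] eval_at_commute[of \<beta> \<gamma>]
          eval_at_commute[of \<beta> h'])
  qed
  have neg: "E h' \<gamma> < 0" using w0 \<kappa> d by (simp add: h')
  have sgn: "E h' \<alpha> > 0 \<longleftrightarrow> \<alpha> \<in> insert (- \<gamma>) (P - {\<gamma>})" "E h' \<alpha> \<noteq> 0" if \<alpha>: "\<alpha> \<in> R" for \<alpha>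
  proof -
    have pos: "E h' \<beta> > 0" if "\<beta> \<in> P - {\<gamma>}" for \<beta> using \<kappa> that by (simp add: h')
    consider "\<alpha> = \<gamma>" | "\<alpha> = - \<gamma>" | "\<alpha> \<in> P - {\<gamma>}" | "- \<alpha> \<in> P - {\<gamma>}"
      using positive_system_closed(2)[OF P \<alpha>] by (metis Diff_iff singletonD minus_minus)
    then have "(E h' \<alpha> > 0 \<longleftrightarrow> \<alpha> \<in> insert (- \<gamma>) (P - {\<gamma>})) \<and> E h' \<alpha> \<noteq> 0"
    proof cases
      case 1
      have "\<gamma> \<noteq> - \<gamma>" using positive_system_closed(3)[OF P gP] gP by metis
      then show ?thesis using 1 neg by auto
    next
      case 2
      then show ?thesis using neg by (auto simp: eval_at_minus)
    next
      case 3
      then show ?thesis using pos[of \<alpha>] by auto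
    next
      case 4
      then have "\<alpha> \<notin> P" using positive_system_closed(3)[OF P, of \<alpha>] by auto
      then show ?thesis using 4 pos[of "- \<alpha>"] by (auto simp: eval_at_minus)
    qed
    then show "E h' \<alpha> > 0 \<longleftrightarrow> \<alpha> \<in> insert (- \<gamma>) (P - {\<gamma>})" "E h' \<alpha> \<noteq> 0" by blast+
  qed
  have "insert (- \<gamma>) (P - {\<gamma>}) \<subseteq> R"
    using h(2) gR minus_root by auto
  with sgn show ?thesis unfolding positive_system_def by (intro exI[of _ h']) blast
qed

lemma odd_flip_minus_simple:
  assumes P: "positive_system m n P" and \<gamma>: "\<gamma> \<in> simple_roots P" and odd: "\<gamma> \<in> odd_roots m n"
  shows "- \<gamma> \<in> simple_roots (insert (- \<gamma>) (P - {\<gamma>}))"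
proof -
  let ?Q = "insert (- \<gamma>) (P - {\<gamma>})"
  note Q = odd_flip_positive_system[OF assms]
  note gR = odd_is_root[OF odd]
  have gP: "\<gamma> \<in> P" using \<gamma> by (rule simple_is_positive)
  have mP: "- \<gamma> \<notin> P" using positive_system_closed(3)[OF P gP] .
  have "- \<gamma> \<noteq> x + y" if "x \<in> ?Q" "y \<in> ?Q" for x y
  proof
    assume eq: "- \<gamma> = x + y"
    have "x \<noteq> - \<gamma>" "y \<noteq> - \<gamma>"
      using eq that positive_system_closed(1)[OF Q] zero_not_root by force+
    then have "x \<in> P" "y \<in> P" using that by auto
    then have "- \<gamma> \<in> P" using positive_system_closed(4)[OF P] eq minus_root[OF gR] by metis
    then show False using mP by blast
  qed
  then show ?thesis unfolding simple_roots_def by blast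
qed

text \<open>
  A simple root \<open>\<beta>\<close> of the new system that is orthogonal to \<open>\<gamma>\<close> has a trivial \<open>\<gamma>\<close>-string and
  remains indecomposable.  Otherwise \<open>\<beta> + \<gamma>\<close>, as a difference of the simple roots \<open>\<beta>\<close> and \<open>-\<gamma>\<close>, is
  not a root.  So \<open>\<beta> - \<gamma>\<close> is one, and a decomposition of it would yield one
  of \<open>\<beta>\<close> by adding \<open>\<gamma>\<close> to a suitable summand.
\<close>

lemma odd_flip_simple_subset:
  assumes P: "positive_system m n P" and \<gamma>: "\<gamma> \<in> simple_roots P" and odd: "\<gamma> \<in> odd_roots m n"
  shows "simple_roots (insert (- \<gamma>) (P - {\<gamma>})) \<subseteq> odd_step m n \<gamma> (simple_roots P)"
proof
  let ?Q = "insert (- \<gamma>) (P - {\<gamma>})"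
  note Q = odd_flip_positive_system[OF assms]
  note gR = odd_is_root[OF odd]
  have gP: "\<gamma> \<in> P" using \<gamma> by (rule simple_is_positive)
  fix \<beta> assume \<beta>: "\<beta> \<in> simple_roots ?Q"
  show "\<beta> \<in> odd_step m n \<gamma> (simple_roots P)"
  proof (cases "\<beta> = - \<gamma>")
    case True
    then show ?thesis by (auto simp: odd_step_def)
  next
    case False
    then have \<beta>P: "\<beta> \<in> P" "\<beta> \<noteq> \<gamma>" using simple_is_positive[OF \<beta>] by auto
    then have \<beta>R: "\<beta> \<in> R" using positive_system_closed(1)[OF P] by blast
    have indec: "\<beta> \<noteq> x + y" if "x \<in> P" "y \<in> P" "x \<noteq> \<gamma>" "y \<noteq> \<gamma>" for x y
      using simple_indecomposable[OF \<beta>, of x y] that by blast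
    show ?thesis
    proof (cases "B \<beta> \<gamma> = 0")
      case True
      have "\<beta> - \<gamma> \<notin> R"
      proof
        assume r: "\<beta> - \<gamma> \<in> R"
        have "B (\<beta> - \<gamma>) \<gamma> \<noteq> 0"
          using isotropic_string_nonorthogonal[OF odd r] \<beta>R by simp
        then show False using True odd_isotropic[OF odd] by (simp add: wform_linear)
      qed
      then have "\<beta> \<noteq> x + y" if "x \<in> P" "y \<in> P" for x y
        using that indec[OF that] positive_system_closed(1)[OF P] by (cases "x = \<gamma> \<or> y = \<gamma>") auto
      then have "\<beta> \<in> simple_roots P" using \<beta>P by (auto simp: simple_roots_def)
      then show ?thesis using True \<beta>P by (auto simp: odd_step_def)
    next
      case nz: False
      have "- \<gamma> \<in> simple_roots ?Q" using odd_flip_minus_simple[OF assms] .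
      then have "\<beta> - (- \<gamma>) \<notin> R" using simple_difference_not_root[OF Q \<beta>] by blast
      then have diff: "\<beta> - \<gamma> \<in> R" using isotropic_string_exists[OF odd \<beta>R nz] by simp
      then have diffP: "\<beta> - \<gamma> \<in> P" using difference_from_simple_positive[OF P \<gamma>] \<beta>P by blast
      have not_gamma: "\<beta> - \<gamma> \<noteq> \<gamma> + y" if "y \<in> P" for y
      proof
        assume eq: "\<beta> - \<gamma> = \<gamma> + y"
        then have "\<beta> - \<gamma> - \<gamma> \<in> R" using positive_system_closed(1)[OF P that] by simp
        moreover have "\<beta> - \<gamma> - \<gamma> \<notin> R" using isotropic_string_unique[OF odd diff] \<beta>R by simp
        ultimately show False by blast
      qed
      have "\<beta> - \<gamma> \<noteq> x + y" if xy: "x \<in> P" "y \<in> P" for x y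
      proof
        assume eq: "\<beta> - \<gamma> = x + y"
        have ne: "x \<noteq> \<gamma>" "y \<noteq> \<gamma>" using eq not_gamma[of y] not_gamma[of x] xy by (auto simp: add.commute)
        have ne': "x \<noteq> - \<gamma>" "y \<noteq> - \<gamma>" using xy gP positive_system_closed(3)[OF P gP] by auto
        have \<beta>eq: "\<beta> = x + y + \<gamma>" using eq by (simp add: algebra_simps)
        have "x + \<gamma> \<in> R \<or> y + \<gamma> \<in> R"
          using odd_root_string_split[OF odd _ _ _ _ ne'] xy positive_system_closed(1)[OF P]
            diff \<beta>R eq \<beta>eq by metis
        then show False
        proof
          assume "x + \<gamma> \<in> R"
          then have "x + \<gamma> \<in> P" using positive_system_closed(4)[OF P xy(1) gP] by blast
          moreover have "x + \<gamma> \<noteq> \<gamma>" using xy positive_system_closed(1)[OF P] zero_not_root by auto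
          ultimately have "\<beta> \<noteq> (x + \<gamma>) + y" using indec xy ne by blast
          then show False using \<beta>eq by (simp add: algebra_simps)
        next
          assume "y + \<gamma> \<in> R"
          then have "y + \<gamma> \<in> P" using positive_system_closed(4)[OF P xy(2) gP] by blast
          moreover have "y + \<gamma> \<noteq> \<gamma>" using xy positive_system_closed(1)[OF P] zero_not_root by auto
          ultimately have "\<beta> \<noteq> x + (y + \<gamma>)" using indec xy ne by blast
          then show False using \<beta>eq by (simp add: algebra_simps)
        qed
      qed
      then have "\<beta> - \<gamma> \<in> simple_roots P" using diffP by (auto simp: simple_roots_def)
      moreover have "B (\<beta> - \<gamma>) \<gamma> \<noteq> 0" using nz odd_isotropic[OF odd] by (simp add: wform_linear)
      moreover have "\<beta> = (\<beta> - \<gamma>) + \<gamma>" by simp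
      ultimately show ?thesis unfolding odd_step_def by blast
    qed
  qed
qed

text \<open>
  The inclusion that is left to prove is the same statement for the flip back: it bounds the old
  simple roots by the odd step in \<open>-\<gamma>\<close> applied to the new ones.
\<close>

lemma odd_flip_simple:
  assumes P: "positive_system m n P" and \<gamma>: "\<gamma> \<in> simple_roots P" and odd: "\<gamma> \<in> odd_roots m n"
  shows "simple_roots (insert (- \<gamma>) (P - {\<gamma>})) = odd_step m n \<gamma> (simple_roots P)"
    and "- \<gamma> \<in> simple_roots (insert (- \<gamma>) (P - {\<gamma>}))"
    and "insert \<gamma> (insert (- \<gamma>) (P - {\<gamma>}) - {- \<gamma>}) = P"
proof -
  let ?Q = "insert (- \<gamma>) (P - {\<gamma>})"
  note Q = odd_flip_positive_system[OF assms]
  note gR = odd_is_root[OF odd]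
  have gP: "\<gamma> \<in> P" using \<gamma> by (rule simple_is_positive)
  have mP: "- \<gamma> \<notin> P" using positive_system_closed(3)[OF P gP] .
  show mS: "- \<gamma> \<in> simple_roots ?Q" using odd_flip_minus_simple[OF assms] .
  show restore: "insert \<gamma> (?Q - {- \<gamma>}) = P" using gP mP by auto
  have sub: "simple_roots P \<subseteq> odd_step m n (- \<gamma>) (simple_roots ?Q)"
    using odd_flip_simple_subset[OF Q mS] odd minus_odd[OF odd] restore by simp
  have "odd_step m n \<gamma> (simple_roots P) \<subseteq> simple_roots ?Q"
  proof
    fix x assume "x \<in> odd_step m n \<gamma> (simple_roots P)"
    then consider "x = - \<gamma>" | "x \<in> simple_roots P" "B x \<gamma> = 0" "x \<noteq> \<gamma>"
      | a where "a \<in> simple_roots P" "B a \<gamma> \<noteq> 0" "x = a + \<gamma>"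
      unfolding odd_step_def by blast
    then show "x \<in> simple_roots ?Q"
    proof cases
      case 1 then show ?thesis using mS by simp
    next
      case 2
      then consider "x \<in> simple_roots ?Q"
        | a where "a \<in> simple_roots ?Q" "B a (- \<gamma>) \<noteq> 0" "x = a + - \<gamma>"
        using sub unfolding odd_step_def by auto
      then show ?thesis
      proof cases
        case (2 a)
        then have "B x \<gamma> \<noteq> 0" using odd_isotropic[OF odd] by (simp add: wform_linear)
        with \<open>B x \<gamma> = 0\<close> show ?thesis by simp
      qed
    next
      case (3 a)
      then have "a \<noteq> \<gamma>" using odd_isotropic[OF odd] by auto
      then consider "B a (- \<gamma>) = 0"
        | b where "b \<in> simple_roots ?Q" "a = b + - \<gamma>"
        using sub 3(1) unfolding odd_step_def by auto
      then show ?thesis using 3 by cases (auto simp: wform_linear)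
    qed
  qed
  with odd_flip_simple_subset[OF assms]
  show "simple_roots ?Q = odd_step m n \<gamma> (simple_roots P)" by blast
qed

lemma borelE:
  assumes "S \<in> borels m n"
  obtains P where "positive_system m n P" "S = simple_roots P"
  using assms by (auto simp: borels_def)

lemma odd_step_borel:
  assumes S: "S \<in> borels m n" and \<gamma>: "\<gamma> \<in> S" and odd: "\<gamma> \<in> odd_roots m n"
  shows "odd_step m n \<gamma> S \<in> borels m n" "odd_step m n (- \<gamma>) (odd_step m n \<gamma> S) = S"
proof -
  obtain P where P: "positive_system m n P" "S = simple_roots P" using S by (rule borelE)
  let ?Q = "insert (- \<gamma>) (P - {\<gamma>})"
  have g: "\<gamma> \<in> simple_roots P" using P \<gamma> by simp
  note Q = odd_flip_positive_system[OF P(1) g odd] and f = odd_flip_simple[OF P(1) g odd]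
  show "odd_step m n \<gamma> S \<in> borels m n"
    using Q f(1) P(2) unfolding borels_def by auto
  show "odd_step m n (- \<gamma>) (odd_step m n \<gamma> S) = S"
    using odd_flip_simple(1)[OF Q f(2) minus_odd[OF odd]] f(1,3) P(2) by simp
qed

lemma odd_step_contains:
  "- \<gamma> \<in> odd_step m n \<gamma> S"
  "\<alpha> \<in> S \<Longrightarrow> B \<alpha> \<gamma> \<noteq> 0 \<Longrightarrow> \<alpha> + \<gamma> \<in> odd_step m n \<gamma> S"
  by (auto simp: odd_step_def)

lemma borel_simple_difference:
  "S \<in> borels m n \<Longrightarrow> \<alpha> \<in> S \<Longrightarrow> \<beta> \<in> S \<Longrightarrow> \<alpha> - \<beta> \<notin> R"
  using simple_difference_not_root by (auto elim!: borelE)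

lemma borel_is_root: "S \<in> borels m n \<Longrightarrow> \<alpha> \<in> S \<Longrightarrow> \<alpha> \<in> R"
  by (auto elim!: borelE dest: simple_is_positive intro: positive_system_closed)

lemma borel_positive_functional:
  assumes "S \<in> borels m n"
  obtains h where "\<forall>\<alpha>\<in>S. E h \<alpha> > 0"
  using assms by (auto elim!: borelE positive_systemE dest: simple_is_positive)

lemma borel_minus: "S \<in> borels m n \<Longrightarrow> \<alpha> \<in> S \<Longrightarrow> - \<alpha> \<notin> S"
  by (metis borel_positive_functional eval_at_minus neg_0_less_iff_less order_less_asym)

lemma borel_sum3: "S \<in> borels m n \<Longrightarrow> \<alpha> \<in> S \<Longrightarrow> \<beta> \<in> S \<Longrightarrow> \<gamma> \<in> S \<Longrightarrow> \<alpha> + \<beta> + \<gamma> \<noteq> 0"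
proof
  assume S: "S \<in> borels m n" and abc: "\<alpha> \<in> S" "\<beta> \<in> S" "\<gamma> \<in> S" "\<alpha> + \<beta> + \<gamma> = 0"
  obtain h where "\<forall>\<alpha>\<in>S. E h \<alpha> > 0" using S by (rule borel_positive_functional)
  then have "E h \<alpha> > 0" "E h \<beta> > 0" "E h \<gamma> > 0" using abc by auto
  moreover have "E h \<alpha> + E h \<beta> + E h \<gamma> = 0"
    using abc(4) eval_at_zero[of h] by (simp flip: eval_at_add)
  ultimately show False by simp
qed

end

section \<open>Ordinary reflections\<close>

context spo
begin

abbreviation (input) "rfl \<equiv> root_reflection m n"

lemma even_norm_nonzero:
  assumes "a \<in> even_roots m n"
  shows "B a a \<noteq> 0"
proof -
  obtain p q where pq: "a = p + q" "q \<noteq> - p"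
    "p \<in> dletters m \<and> q \<in> dletters m \<or> p \<in> eletters n \<and> q \<in> eletters n \<and> q \<noteq> p"
    using assms unfolding even_root_iff by blast
  then have L: "p \<in> L" "q \<in> L" using dletters_letters eletters_letters by blast+
  have E: "E p p = 1" "E q q = 1" "E p q \<noteq> -1" "E q p \<noteq> -1"
    using L pq(2) by (auto simp: letter_pairing)
  show ?thesis using pq(3)
  proof
    assume d: "p \<in> dletters m \<and> q \<in> dletters m"
    then have "B a a = E p p + E p q + E q p + E q q"
      by (simp add: pq(1) wform_add wform_dletter eval_at_add)
    then show ?thesis using E L by (auto simp: letter_pairing split: if_splits)
  next
    assume e: "p \<in> eletters n \<and> q \<in> eletters n \<and> q \<noteq> p"
    then have "B a a = - (E p p + E p q + E q p + E q q)"
      by (simp add: pq(1) wform_add wform_eletter eval_at_add)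
    then show ?thesis using E L by (auto simp: letter_pairing split: if_splits)
  qed
qed

lemma refl_add: "rfl a (u + v) = rfl a u + rfl a v"
  by (auto simp: root_reflection_def wform_add fun_eq_iff add_divide_distrib algebra_simps)

lemma refl_minus: "rfl a (- u) = - rfl a u"
  by (auto simp: root_reflection_def wform_minus fun_eq_iff)

lemma refl_sub_scale: "rfl a (\<lambda>c. u c - k * v c) = (\<lambda>c. rfl a u c - k * rfl a v c)"
proof -
  have lin: "B (\<lambda>c. u c - k * v c) a = B u a - k * B v a"
    using wform_diff[of u "\<lambda>c. k * v c" a] by (simp add: wform_scale fun_diff_def)
  show ?thesis
    unfolding root_reflection_def lin by (simp add: algebra_simps diff_divide_distrib)
qed

lemma refl_minus_root: "rfl (- a) = rfl a"
  by (auto simp: root_reflection_def wform_linear fun_eq_iff)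

lemma refl_eqs:
  "B v a = 0 \<Longrightarrow> rfl a v = v"
  "2 * B v a = B a a \<Longrightarrow> B a a \<noteq> 0 \<Longrightarrow> rfl a v = v - a"
  "2 * B v a = - B a a \<Longrightarrow> B a a \<noteq> 0 \<Longrightarrow> rfl a v = v + a"
  by (auto simp: root_reflection_def fun_eq_iff)

lemma refl_self: "a \<in> even_roots m n \<Longrightarrow> rfl a a = - a"
  using even_norm_nonzero by (auto simp: root_reflection_def fun_eq_iff)

lemma wform_refl_left: "B (rfl a u) v = B u v - 2 * B u a / B a a * B a v"
proof -
  have "rfl a u = u - (\<lambda>c. 2 * B u a / B a a * a c)"
    by (simp add: root_reflection_def fun_diff_def)
  then show ?thesis by (simp only: wform_diff wform_scale)
qed

lemma wform_refl:
  assumes "a \<in> even_roots m n"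
  shows "B (rfl a u) (rfl a v) = B u v"
proof -
  have "B (rfl a u) (rfl a v) = B u (rfl a v) - 2 * B u a / B a a * B a (rfl a v)"
    by (rule wform_refl_left)
  also have "B u (rfl a v) = B u v - 2 * B v a / B a a * B a u"
    unfolding wform_commute[of u] by (rule wform_refl_left)
  also have "B a (rfl a v) = B v a - 2 * B v a / B a a * B a a"
    unfolding wform_commute[of a "rfl a v"] by (rule wform_refl_left)
  finally show ?thesis
    using even_norm_nonzero[OF assms] wform_commute[of a u] by (simp add: field_simps)
qed

lemma refl_involution:
  assumes "a \<in> even_roots m n"
  shows "rfl a (rfl a v) = v"
proof -
  have "rfl a (rfl a v) = (\<lambda>c. rfl a v c - 2 * B v a / B a a * rfl a a c)"
    using arg_cong[OF root_reflection_def[of m n a v], of "rfl a"] by (simp only: refl_sub_scale)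
  then show ?thesis by (simp add: refl_self[OF assms]) (simp add: root_reflection_def)
qed

lemma wform_refl_shift:
  assumes "a \<in> even_roots m n"
  shows "B (rfl a u) v = B u (rfl a v)"
  using wform_refl[OF assms, of u "rfl a v"] refl_involution[OF assms] by simp

text \<open>
  The classical rule \<open>s\<^sub>a s\<^sub>b s\<^sub>a = s\<^sub>c\<close> with \<open>c = s\<^sub>a b\<close>.
\<close>

lemma refl_refl_refl:
  assumes "a \<in> even_roots m n"
  shows "rfl a (rfl b (rfl a v)) = rfl (rfl a b) v"
proof -
  have "rfl a (rfl b (rfl a v))
      = (\<lambda>c. rfl a (rfl a v) c - 2 * B (rfl a v) b / B b b * rfl a b c)"
    using arg_cong[OF root_reflection_def[of m n b "rfl a v"], of "rfl a"]
    by (simp only: refl_sub_scale)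
  then show ?thesis
    by (simp add: refl_involution[OF assms] wform_refl_shift[OF assms, of v])
      (simp add: root_reflection_def[of m n "rfl a b"] wform_refl[OF assms])
qed

text \<open>
  For \<open>a = p + q\<close> the reflection exchanges \<open>p\<close> with \<open>-q\<close> and \<open>q\<close> with \<open>-p\<close> and fixes all other letters,
  so it permutes the letters of each kind.  This makes it a symmetry of the root system that
  respects parity.
\<close>

lemma refl_letter:
  assumes a: "a \<in> even_roots m n" and v: "v \<in> L"
  shows "rfl a v \<in> L" "v \<in> dletters m \<Longrightarrow> rfl a v \<in> dletters m"
    "v \<in> eletters n \<Longrightarrow> rfl a v \<in> eletters n"
proof -
  obtain p q where pq: "a = p + q" "q \<noteq> - p"
    "p \<in> dletters m \<and> q \<in> dletters m \<or> p \<in> eletters n \<and> q \<in> eletters n \<and> q \<noteq> p"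
    using a unfolding even_root_iff by blast
  then have L: "p \<in> L" "q \<in> L" using dletters_letters eletters_letters by blast+
  have "\<exists>\<sigma>. (\<sigma> = 1 \<or> \<sigma> = -1) \<and> (\<forall>v. B p v = \<sigma> * E p v \<and> B q v = \<sigma> * E q v)"
    using pq(3)
  proof
    assume "p \<in> dletters m \<and> q \<in> dletters m"
    then show ?thesis by (intro exI[of _ 1]) (simp add: wform_dletter)
  next
    assume "p \<in> eletters n \<and> q \<in> eletters n \<and> q \<noteq> p"
    then show ?thesis by (intro exI[of _ "-1"]) (simp add: wform_eletter)
  qed
  then obtain \<sigma> where \<sigma>: "\<sigma> = 1 \<or> \<sigma> = (-1::real)" "\<And>v. B p v = \<sigma> * E p v" "\<And>v. B q v = \<sigma> * E q v"
    by blast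
  have va: "B v a = \<sigma> * (E p v + E q v)" for v
    unfolding wform_commute[of v] pq(1) wform_add \<sigma>(2,3) by (simp add: algebra_simps)
  have aa: "B a a = \<sigma> * (2 + 2 * E p q)"
    unfolding va unfolding pq(1) eval_at_add eval_at_commute[of q p]
    using L by (simp add: letter_pairing algebra_simps)
  note nz = even_norm_nonzero[OF a]
  have "rfl a v \<in> {v, p, q, - p, - q} \<and> (rfl a v = v \<or> v \<in> {p, q, - p, - q})"
  proof (cases "v \<in> {p, q, - p, - q}")
    case False
    then have "B v a = 0" using L v by (auto simp: va letter_pairing)
    then show ?thesis by (simp add: refl_eqs)
  next
    case True
    (* This holds for \<open>p = q\<close> as well, where \<open>a\<close> is the long root \<open>2 p\<close>. *)
    have "2 * B p a = B a a" "2 * B q a = B a a"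
      using L unfolding va[of p] va[of q] aa eval_at_commute[of q p] by (simp_all add: letter_pairing algebra_simps)
    then have "rfl a p = p - a" "rfl a q = q - a" using nz by (simp_all add: refl_eqs(2))
    then have "rfl a p = - q" "rfl a q = - p" using pq(1) by auto
    then have "rfl a v \<in> {- p, - q, p, q}" using True by (auto simp: refl_minus)
    then show ?thesis using True by blast
  qed
  then show "rfl a v \<in> L" "v \<in> dletters m \<Longrightarrow> rfl a v \<in> dletters m"
    "v \<in> eletters n \<Longrightarrow> rfl a v \<in> eletters n"
    using v L pq(3) minus_letter[of p] minus_letter[of q] dletter_not_eletter
      minus_letter(2,3)[of "-p"] minus_letter(2,3)[of "-q"]
    by auto
qed

lemma refl_odd_root:
  assumes a: "a \<in> even_roots m n" and "\<gamma> \<in> odd_roots m n"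
  shows "rfl a \<gamma> \<in> odd_roots m n"
proof -
  obtain p q where pq: "p \<in> dletters m" "q \<in> eletters n" "\<gamma> = p + q" "p \<in> L" "q \<in> L"
    using assms(2) by (rule oddE)
  then show ?thesis
    using refl_letter(2)[OF a pq(4,1)] refl_letter(3)[OF a pq(5,2)]
    unfolding odd_root_iff pq(3) refl_add by blast
qed

lemma refl_even_root:
  assumes a: "a \<in> even_roots m n" and "b \<in> even_roots m n"
  shows "rfl a b \<in> even_roots m n"
proof -
  obtain p q where pq: "b = p + q" "q \<noteq> - p"
    and cl: "p \<in> dletters m \<and> q \<in> dletters m \<or> p \<in> eletters n \<and> q \<in> eletters n \<and> q \<noteq> p"
    using assms(2) unfolding even_root_iff by blast
  have L: "p \<in> L" "q \<in> L" using cl dletters_letters eletters_letters by blast+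
  have "rfl a q \<noteq> - rfl a p" "q \<noteq> p \<Longrightarrow> rfl a q \<noteq> rfl a p"
    using pq(2) refl_involution[OF a] refl_minus by metis+
  moreover have "rfl a b = rfl a p + rfl a q" using pq(1) refl_add by simp
  moreover have "rfl a p \<in> dletters m \<and> rfl a q \<in> dletters m
      \<or> rfl a p \<in> eletters n \<and> rfl a q \<in> eletters n \<and> q \<noteq> p"
    using cl refl_letter[OF a L(1)] refl_letter[OF a L(2)] by blast
  ultimately show ?thesis unfolding even_root_iff by blast
qed

lemma refl_root: "a \<in> even_roots m n \<Longrightarrow> b \<in> R \<Longrightarrow> rfl a b \<in> R"
  using refl_odd_root refl_even_root unfolding roots_def by blast

lemma refl_mem_image_iff:
  "a \<in> even_roots m n \<Longrightarrow> v \<in> rfl a ` S \<longleftrightarrow> rfl a v \<in> S"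
  by (metis image_iff refl_involution)

lemma refl_image_involution: "a \<in> even_roots m n \<Longrightarrow> rfl a ` rfl a ` S = S"
  by (auto simp: refl_involution image_image)

lemma simple_roots_refl:
  assumes a: "a \<in> even_roots m n"
  shows "simple_roots (rfl a ` P) = rfl a ` simple_roots P"
proof -
  have eq: "rfl a v = rfl a x + rfl a y \<longleftrightarrow> v = x + y" for v x y
    using refl_involution[OF a] refl_add by metis
  show ?thesis by (auto simp: simple_roots_def eq)
qed

text \<open>
  The adjoint of the reflection.  The form pairs with \<open>a\<close> as the Euclidean product does with the
  weight obtained from \<open>a\<close> by changing the sign of its \<open>\<epsilon>\<close>-part.
\<close>

lemma eval_at_refl:
  "\<exists>h'. \<forall>v. E h (rfl a v) = E h' v"
proof -
  define a' :: weight where "a' = (\<lambda>c. case c of Dl i \<Rightarrow> a c | Ep j \<Rightarrow> - a c)"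
  have a': "B v a = E a' v" for v
    by (simp add: a'_def wform_def eval_at_def sum_negf mult.commute)
  define h' where "h' = h + (\<lambda>c. (- 2 * E h a / B a a) * a' c)"
  have "E h (rfl a v) = E h' v" for v
  proof -
    have "rfl a v = v - (\<lambda>c. 2 * B v a / B a a * a c)"
      by (simp add: root_reflection_def fun_diff_def)
    then have "E h (rfl a v) = E h v - 2 * B v a / B a a * E h a"
      by (simp only: eval_at_diff eval_at_scale)
    moreover have "E h' v = E h v + (- 2 * E h a / B a a) * E a' v"
      unfolding eval_at_commute[of _ v] h'_def eval_at_add eval_at_scale by simp
    ultimately show ?thesis by (simp add: a')
  qed
  then show ?thesis by blast
qed

lemma refl_positive_system:
  assumes a: "a \<in> even_roots m n" and "positive_system m n P"
  shows "positive_system m n (rfl a ` P)"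
proof -
  obtain h where h: "\<forall>\<alpha>\<in>R. E h \<alpha> \<noteq> 0" "P = {\<alpha> \<in> R. E h \<alpha> > 0}"
    using assms(2) by (rule positive_systemE)
  obtain h' where h': "\<And>v. E h (rfl a v) = E h' v" using eval_at_refl by blast
  have "v \<in> rfl a ` P \<longleftrightarrow> v \<in> R \<and> E h' v > 0" for v
    unfolding refl_mem_image_iff[OF a] h(2)
    using refl_root[OF a, of v] refl_root[OF a, of "rfl a v"] by (auto simp: h' refl_involution[OF a])
  then have "rfl a ` P = {\<alpha> \<in> R. E h' \<alpha> > 0}" by blast
  moreover have "\<forall>\<alpha>\<in>R. E h' \<alpha> \<noteq> 0" using h(1) refl_root[OF a] h' by metis
  ultimately show ?thesis unfolding positive_system_def by blast
qed

lemma refl_borel: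
  "a \<in> even_roots m n \<Longrightarrow> S \<in> borels m n \<Longrightarrow> rfl a ` S \<in> borels m n"
  using refl_positive_system simple_roots_refl unfolding borels_def by fastforce

lemma odd_step_refl:
  assumes a: "a \<in> even_roots m n"
  shows "rfl a ` odd_step m n \<gamma> S = odd_step m n (rfl a \<gamma>) (rfl a ` S)"
proof -
  have *: "B (rfl a x) (rfl a \<gamma>) = B x \<gamma>" "rfl a x = rfl a \<gamma> \<longleftrightarrow> x = \<gamma>" for x
    using wform_refl[OF a] refl_involution[OF a] by metis+
  have "rfl a ` {\<alpha> + \<gamma> |\<alpha>. \<alpha> \<in> S \<and> B \<alpha> \<gamma> \<noteq> 0}
      = {\<alpha> + rfl a \<gamma> |\<alpha>. \<alpha> \<in> rfl a ` S \<and> B \<alpha> (rfl a \<gamma>) \<noteq> 0}"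
    by (auto simp: refl_add * image_iff) (metis refl_add)
  moreover have "rfl a ` {\<alpha> \<in> S. B \<alpha> \<gamma> = 0 \<and> \<alpha> \<noteq> \<gamma>}
      = {\<alpha> \<in> rfl a ` S. B \<alpha> (rfl a \<gamma>) = 0 \<and> \<alpha> \<noteq> rfl a \<gamma>}"
    by (auto simp: *)
  ultimately show ?thesis unfolding odd_step_def by (simp add: image_Un refl_minus)
qed

section \<open>Involutions of the set of Borel subalgebras\<close>

lemma rhat_even: "\<theta> \<in> even_roots m n \<Longrightarrow> S \<in> borels m n \<Longrightarrow> rhat m n \<theta> S = rfl \<theta> ` S"
  using odd_not_even by (auto simp: rhat_def)

lemma rhat_odd_simple:
  "\<gamma> \<in> odd_roots m n \<Longrightarrow> S \<in> borels m n \<Longrightarrow> \<gamma> \<in> S \<Longrightarrow> rhat m n \<gamma> S = odd_step m n \<gamma> S"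
  "\<gamma> \<in> odd_roots m n \<Longrightarrow> S \<in> borels m n \<Longrightarrow> - \<gamma> \<in> S \<Longrightarrow> rhat m n \<gamma> S = odd_step m n (- \<gamma>) S"
  "\<gamma> \<in> odd_roots m n \<Longrightarrow> S \<in> borels m n \<Longrightarrow> \<gamma> \<notin> S \<Longrightarrow> - \<gamma> \<notin> S \<Longrightarrow> rhat m n \<gamma> S = S"
  using borel_minus by (auto simp: rhat_def)

lemma rhat_borel:
  assumes "\<theta> \<in> R" "S \<in> borels m n"
  shows "rhat m n \<theta> S \<in> borels m n"
proof (cases "\<theta> \<in> odd_roots m n")
  case True
  then show ?thesis
    using odd_step_borel(1)[OF assms(2)] minus_odd[OF True] assms(2) by (auto simp: rhat_def)
next
  case False
  then show ?thesis using assms rhat_even root_not_odd_even refl_borel by metis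
qed

lemma rhat_involution:
  assumes "\<theta> \<in> R" "S \<in> borels m n"
  shows "rhat m n \<theta> (rhat m n \<theta> S) = S"
proof (cases "\<theta> \<in> odd_roots m n")
  case odd: True
  note T = rhat_borel[OF assms]
  consider "\<theta> \<in> S" | "- \<theta> \<in> S" | "\<theta> \<notin> S" "- \<theta> \<notin> S" by blast
  then show ?thesis
  proof cases
    case 1
    then have r: "rhat m n \<theta> S = odd_step m n \<theta> S" using rhat_odd_simple(1) odd assms by blast
    then show ?thesis
      using rhat_odd_simple(2)[OF odd T] odd_step_contains(1)[of \<theta> S]
        odd_step_borel(2)[OF assms(2) 1 odd] by simp
  next
    case 2
    then have r: "rhat m n \<theta> S = odd_step m n (- \<theta>) S" using rhat_odd_simple(2) odd assms by blast
    then show ?thesis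
      using rhat_odd_simple(1)[OF odd T] odd_step_contains(1)[of "- \<theta>" S]
        odd_step_borel(2)[OF assms(2) 2 minus_odd[OF odd]] by simp
  next
    case 3
    then show ?thesis using rhat_odd_simple(3)[OF odd assms(2)] by simp
  qed
next
  case False
  then have e: "\<theta> \<in> even_roots m n" using root_not_odd_even assms(1) by blast
  then show ?thesis
    using rhat_even[OF e] refl_borel[OF e] assms(2) refl_image_involution[OF e] by simp
qed

lemma rhat_minus: "\<theta> \<in> R \<Longrightarrow> rhat m n (- \<theta>) = rhat m n \<theta>"
  using borel_minus
  by (auto simp: rhat_def fun_eq_iff restrict_def minus_odd_iff refl_minus_root)

text \<open>
  True of both kinds of reflections; all lower bounds for orders are based on it.
\<close>

lemma minus_in_rhat:
  assumes "S \<in> borels m n" "\<theta> \<in> S"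
  shows "- \<theta> \<in> rhat m n \<theta> S"
proof (cases "\<theta> \<in> odd_roots m n")
  case True
  then show ?thesis using rhat_odd_simple(1) assms odd_step_contains(1) by metis
next
  case False
  then have "\<theta> \<in> even_roots m n" using root_not_odd_even borel_is_root assms by blast
  then show ?thesis using rhat_even assms refl_self by (metis image_eqI)
qed

text \<open>
  For odd \<open>\<theta>\<close> this is the equivariance of odd steps under the linear reflection \<open>s\<^sub>a\<close>, for even
  \<open>\<theta>\<close> it is the corresponding rule for linear reflections.
\<close>

lemma rhat_conjugate:
  assumes a: "a \<in> even_roots m n" and \<theta>: "\<theta> \<in> R" and S: "S \<in> borels m n"
  shows "rhat m n a (rhat m n \<theta> (rhat m n a S)) = rhat m n (rfl a \<theta>) S"
proof -
  note ra = rhat_even[OF a] and aS = refl_borel[OF a S]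
  have lhs: "rhat m n a (rhat m n \<theta> (rhat m n a S)) = rfl a ` rhat m n \<theta> (rfl a ` S)"
    using ra S aS rhat_borel[OF \<theta> aS] by simp
  show ?thesis
  proof (cases "\<theta> \<in> odd_roots m n")
    case True
    then have odd: "rfl a \<theta> \<in> odd_roots m n" using refl_odd_root[OF a] by blast
    have "\<theta> \<in> rfl a ` S \<longleftrightarrow> rfl a \<theta> \<in> S" "- \<theta> \<in> rfl a ` S \<longleftrightarrow> - rfl a \<theta> \<in> S"
      by (simp_all add: refl_mem_image_iff[OF a] refl_minus)
    then show ?thesis
      unfolding lhs using True odd S aS
      by (auto simp: rhat_def odd_step_refl[OF a] refl_image_involution[OF a] refl_minus)
  next
    case False
    then have e: "\<theta> \<in> even_roots m n" using \<theta> root_not_odd_even by blast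
    then show ?thesis
      unfolding lhs rhat_even[OF e aS] rhat_even[OF refl_even_root[OF a e] S]
      by (simp add: image_image refl_refl_refl[OF a])
  qed
qed

lemma rhat_Bij: "\<theta> \<in> R \<Longrightarrow> rhat m n \<theta> \<in> Bij (borels m n)"
  unfolding Bij_def
proof
  assume \<theta>: "\<theta> \<in> R"
  show "rhat m n \<theta> \<in> extensional (borels m n)" by (simp add: rhat_def)
  show "rhat m n \<theta> \<in> {f. bij_betw f (borels m n) (borels m n)}"
    using rhat_borel[OF \<theta>] rhat_involution[OF \<theta>]
    by (auto intro!: bij_betw_byWitness[where f' = "rhat m n \<theta>"])
qed

end

section \<open>Orders of products of two reflections\<close>

lemma funpow_comp_swap: "((g \<circ> f) ^^ k) (g x) = g (((f \<circ> g) ^^ k) x)"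
  by (induction k) auto

lemma divisor_eq:
  fixes e :: nat
  shows "e dvd 2 \<Longrightarrow> \<not> e dvd 1 \<Longrightarrow> e = 2"
    and "e dvd 3 \<Longrightarrow> \<not> e dvd 1 \<Longrightarrow> e = 3"
    and "e dvd 4 \<Longrightarrow> \<not> e dvd 2 \<Longrightarrow> e = 4"
    and "e dvd 12 \<Longrightarrow> \<not> e dvd 4 \<Longrightarrow> \<not> e dvd 6 \<Longrightarrow> e = 12"
proof -
  show "e = 2" if e: "e dvd 2" "\<not> e dvd 1"
  proof -
    have "e = 0 \<or> e = 1 \<or> e = 2" using dvd_imp_le[OF e(1)] by linarith
    then show ?thesis using e by (elim disjE) simp_all
  qed
  show "e = 3" if e: "e dvd 3" "\<not> e dvd 1"
  proof -
    have "e = 0 \<or> e = 1 \<or> e = 2 \<or> e = 3" using dvd_imp_le[OF e(1)] by linarith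
    then show ?thesis using e by (elim disjE) simp_all
  qed
  show "e = 4" if e: "e dvd 4" "\<not> e dvd 2"
  proof -
    have "e = 0 \<or> e = 1 \<or> e = 2 \<or> e = 3 \<or> e = 4" using dvd_imp_le[OF e(1)] by linarith
    then show ?thesis using e by (elim disjE) simp_all
  qed
  show "e = 12" if e: "e dvd 12" "\<not> e dvd 4" "\<not> e dvd 6"
  proof -
    have "e = 0 \<or> e = 1 \<or> e = 2 \<or> e = 3 \<or> e = 4 \<or> e = 5 \<or> e = 6 \<or> e = 7 \<or> e = 8 \<or> e = 9
      \<or> e = 10 \<or> e = 11 \<or> e = 12" using dvd_imp_le[OF e(1)] by simp presburger
    then show ?thesis using e by (elim disjE) simp_all
  qed
qed

context spo
begin

abbreviation (input) "X \<equiv> borels m n"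
abbreviation (input) "rh \<equiv> rhat m n"
abbreviation (input) "ex \<theta> \<theta>' \<equiv> exponent (coxeter_C m n) (rhat m n \<theta>) (rhat m n \<theta>')"

lemma BijGroup_mult:
  "f \<in> Bij A \<Longrightarrow> g \<in> Bij A \<Longrightarrow> f \<otimes>\<^bsub>BijGroup A\<^esub> g = compose A f g"
  and BijGroup_carrier: "carrier (BijGroup A) = Bij A"
  and BijGroup_one: "\<one>\<^bsub>BijGroup A\<^esub> = (\<lambda>x\<in>A. x)"
  by (simp_all add: BijGroup_def)

lemma BijGroup_pow:
  assumes "f \<in> Bij A" "S \<in> A"
  shows "(f [^]\<^bsub>BijGroup A\<^esub> (k::nat)) S = (f ^^ k) S"
  using assms(2)
proof (induction k arbitrary: S)
  case 0
  then show ?case by (simp add: BijGroup_one nat_pow_def)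
next
  case (Suc k)
  interpret G: group "BijGroup A" by (rule group_BijGroup)
  have "f [^]\<^bsub>BijGroup A\<^esub> k \<in> Bij A"
    using G.nat_pow_closed[of f k] assms(1) unfolding BijGroup_carrier .
  then have "f [^]\<^bsub>BijGroup A\<^esub> Suc k = compose A (f [^]\<^bsub>BijGroup A\<^esub> k) f"
    unfolding G.nat_pow_Suc by (rule BijGroup_mult[OF _ assms(1)])
  then have "(f [^]\<^bsub>BijGroup A\<^esub> Suc k) S = (f [^]\<^bsub>BijGroup A\<^esub> k) (f S)"
    using Suc.prems unfolding compose_def by (simp only: restrict_apply if_True)
  also have "f S \<in> A" using Bij_imp_funcset[OF assms(1)] Suc.prems by blast
  then have "(f [^]\<^bsub>BijGroup A\<^esub> k) (f S) = (f ^^ k) (f S)" by (rule Suc.IH)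
  finally show ?case unfolding funpow_Suc_right comp_apply .
qed

text \<open>
  Translates orders in the super Weyl group into statements about iterating two
  reflections on Borel subalgebras.
\<close>

lemma exponent_dvd_iff:
  assumes \<theta>: "\<theta> \<in> R" "\<theta>' \<in> R"
  shows "ex \<theta> \<theta>' dvd k \<longleftrightarrow> (\<forall>S\<in>X. ((rh \<theta> \<circ> rh \<theta>') ^^ k) S = S)"
proof -
  let ?G = "BijGroup X" and ?W = "super_weyl_group m n"
  interpret G: group ?G by (rule group_BijGroup)
  interpret W: group ?W unfolding super_weyl_group_def by (rule G.group_subgroup_generated)
  have b: "rh \<theta> \<in> Bij X" "rh \<theta>' \<in> Bij X" using \<theta> rhat_Bij by blast+
  have "rh x \<in> carrier ?W" if "x \<in> R" for x
    unfolding super_weyl_group_def carrier_subgroup_generated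
    using rhat_Bij[OF that] that by (intro generate.incl IntI) (simp_all add: BijGroup_carrier)
  then have c: "rh \<theta> \<otimes>\<^bsub>?W\<^esub> rh \<theta>' \<in> carrier ?W" using \<theta> W.m_closed by blast
  have mult: "rh \<theta> \<otimes>\<^bsub>?W\<^esub> rh \<theta>' = compose X (rh \<theta>) (rh \<theta>')"
    unfolding super_weyl_group_def mult_subgroup_generated using b by (rule BijGroup_mult)
  have cb: "compose X (rh \<theta>) (rh \<theta>') \<in> Bij X" using b by (rule compose_Bij)
  (* Products in the group are restricted to the Borel subalgebras, where they agree with
     composition. *)
  have iter: "(compose X (rh \<theta>) (rh \<theta>') ^^ k) S = ((rh \<theta> \<circ> rh \<theta>') ^^ k) S
      \<and> ((rh \<theta> \<circ> rh \<theta>') ^^ k) S \<in> X" if "S \<in> X" for S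
    using that \<theta> by (induction k) (auto simp: compose_def rhat_borel)
  let ?p = "compose X (rh \<theta>) (rh \<theta>') [^]\<^bsub>?G\<^esub> k"
  have "ex \<theta> \<theta>' = W.ord (compose X (rh \<theta>) (rh \<theta>'))"
    unfolding coxeter_C_def coxeter_presentation.select_convs mult ..
  moreover have "compose X (rh \<theta>) (rh \<theta>') [^]\<^bsub>?W\<^esub> k = ?p"
    unfolding super_weyl_group_def pow_subgroup_generated ..
  moreover have "\<one>\<^bsub>?W\<^esub> = \<one>\<^bsub>?G\<^esub>" unfolding super_weyl_group_def one_subgroup_generated ..
  ultimately have "ex \<theta> \<theta>' dvd k \<longleftrightarrow> ?p = \<one>\<^bsub>?G\<^esub>"
    using W.pow_eq_id[OF c, of k] unfolding mult by metis
  also have "\<dots> \<longleftrightarrow> (\<forall>S\<in>X. ?p S = S)"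
  proof
    assume "\<forall>S\<in>X. ?p S = S"
    moreover have "?p \<in> Bij X"
      using G.nat_pow_closed[of "compose X (rh \<theta>) (rh \<theta>')" k] cb unfolding BijGroup_carrier .
    ultimately show "?p = \<one>\<^bsub>?G\<^esub>"
      unfolding BijGroup_one by (intro extensionalityI[of _ X]) (auto dest: Bij_imp_extensional)
  qed (simp add: BijGroup_one)
  also have "\<dots> \<longleftrightarrow> (\<forall>S\<in>X. ((rh \<theta> \<circ> rh \<theta>') ^^ k) S = S)"
    using BijGroup_pow[OF cb] iter by metis
  finally show ?thesis .
qed

text \<open>
  For involutions \<open>f\<close> and \<open>g\<close>, the product \<open>g f\<close> is the inverse of \<open>f g\<close>.
\<close>

lemma exponent_commute:
  assumes \<theta>: "\<theta> \<in> R" "\<theta>' \<in> R"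
  shows "ex \<theta> \<theta>' = ex \<theta>' \<theta>"
proof -
  have *: "ex b a dvd k" if "a \<in> R" "b \<in> R" "ex a b dvd k" for a b k
    unfolding exponent_dvd_iff[OF that(2,1)]
  proof
    fix S assume S: "S \<in> X"
    have "((rh b \<circ> rh a) ^^ k) (rh b (rh b S)) = rh b (((rh a \<circ> rh b) ^^ k) (rh b S))"
      using funpow_comp_swap[where k = k and g = "rh b" and f = "rh a" and x = "rh b S"] .
    then show "((rh b \<circ> rh a) ^^ k) S = S"
      using that exponent_dvd_iff[OF that(1,2)] rhat_involution[OF that(2) S] rhat_borel[OF that(2) S]
      by simp
  qed
  show ?thesis by (rule dvd_antisym) (use *[OF \<theta>(2,1) dvd_refl] *[OF \<theta> dvd_refl] in simp_all)
qed

text \<open>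
  Orthogonality means \<open>s\<^sub>a \<theta> = \<theta>\<close>, so the two reflections commute.  Their product is not the
  identity, since it takes a Borel subalgebra with simple root \<open>\<theta>\<close> to one with simple root \<open>-\<theta>\<close>.
  Here \<open>\<theta>\<close> may be odd.
\<close>

lemma exponent_2:
  assumes a: "a \<in> even_roots m n" and orth: "B \<theta> a = 0" and S: "S \<in> X" "\<theta> \<in> S"
  shows "ex a \<theta> = 2"
proof -
  have R: "a \<in> R" "\<theta> \<in> R" using even_is_root[OF a] borel_is_root[OF S] by auto
  have fix\<theta>: "root_reflection m n a \<theta> = \<theta>" using orth by (rule refl_eqs(1))
  have "((rh a \<circ> rh \<theta>) ^^ 2) T = T" if "T \<in> X" for T
    using rhat_conjugate[OF a R(2) rhat_borel[OF R(2) that]] rhat_involution[OF R(2) that]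
    by (simp add: fix\<theta> numeral_2_eq_2)
  then have d: "ex a \<theta> dvd 2" using exponent_dvd_iff[OF R] by blast
  moreover have "rh a (rh \<theta> S) \<noteq> S"
  proof
    assume eq: "rh a (rh \<theta> S) = S"
    have "root_reflection m n a (- \<theta>) \<in> rh a (rh \<theta> S)"
      using minus_in_rhat[OF S] rhat_even[OF a rhat_borel[OF R(2) S(1)]] by simp
    then show False using fix\<theta> eq borel_minus[OF S] by (simp add: refl_minus)
  qed
  then have "\<not> ex a \<theta> dvd 1" using exponent_dvd_iff[OF R, of 1] S by auto
  ultimately show ?thesis using divisor_eq(1) d by blast
qed

text \<open>
  The case of type \<open>A\<^sub>2\<close>: both \<open>r\<^sub>a r\<^sub>b r\<^sub>a\<close> and \<open>r\<^sub>b r\<^sub>a r\<^sub>b\<close> are the reflection in \<open>a + b\<close>.  If the product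
  fixed a Borel subalgebra with simple roots \<open>a\<close> and \<open>b\<close>, then \<open>-(a + b)\<close> would be simple, too,
  but these three roots add up to 0.
\<close>

lemma exponent_3:
  assumes a: "a \<in> even_roots m n" and b: "b \<in> even_roots m n"
    and ab: "root_reflection m n a b = a + b" "root_reflection m n b a = a + b"
    and S: "S \<in> X" "a \<in> S" "b \<in> S"
  shows "ex a b = 3"
proof -
  note aR = even_is_root[OF a] and bR = even_is_root[OF b]
  have R: "a + b \<in> R" using refl_root[OF a bR] ab by simp
  have "((rh a \<circ> rh b) ^^ 3) T = T" if T: "T \<in> X" for T
  proof -
    have T': "rh b (rh a (rh b T)) \<in> X" using T aR bR rhat_borel by simp
    have "rh a (rh b (rh a (rh b (rh a (rh b T))))) = rh (a + b) (rh (a + b) T)"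
      using rhat_conjugate[OF a bR T'] rhat_conjugate[OF b aR T] ab by simp
    then show ?thesis using rhat_involution[OF R T] by (simp add: numeral_3_eq_3)
  qed
  then have d: "ex a b dvd 3" using exponent_dvd_iff[OF aR bR] by blast
  moreover have "rh a (rh b S) \<noteq> S"
  proof
    assume eq: "rh a (rh b S) = S"
    have "root_reflection m n a (- b) \<in> rh a (rh b S)"
      using minus_in_rhat[OF S(1,3)] rhat_even[OF a rhat_borel[OF bR S(1)]] by simp
    then have "- (a + b) \<in> S" using ab eq by (simp add: refl_minus)
    then show False using borel_sum3[OF S, of "- (a + b)"] by simp
  qed
  then have "\<not> ex a b dvd 1" using exponent_dvd_iff[OF aR bR, of 1] S by auto
  ultimately show ?thesis using divisor_eq(2) by blast
qed

text \<open>
  The case of type \<open>C\<^sub>2\<close>: \<open>r\<^sub>a r\<^sub>b r\<^sub>a\<close> is the reflection in \<open>c = s\<^sub>a b\<close>, which commutes with \<open>r\<^sub>b\<close>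
  as \<open>b\<close> and \<open>c\<close> are orthogonal.  So the square of \<open>r\<^sub>a r\<^sub>b\<close> is the product of these two commuting
  involutions, which takes a Borel subalgebra with simple root \<open>b\<close> to one with simple root \<open>-b\<close>.
\<close>

lemma exponent_4:
  assumes a: "a \<in> even_roots m n" and b: "b \<in> even_roots m n"
    and orth: "B b (root_reflection m n a b) = 0" and S: "S \<in> X" "b \<in> S"
  shows "ex a b = 4"
proof -
  note aR = even_is_root[OF a] and bR = even_is_root[OF b]
  define c where "c = root_reflection m n a b"
  have c: "c \<in> even_roots m n" using refl_even_root[OF a b] by (simp add: c_def)
  note cR = even_is_root[OF c]
  have bc: "root_reflection m n b c = c" "root_reflection m n c b = b"
    using orth wform_commute[of c b] by (auto simp: c_def intro!: refl_eqs(1))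
  have conj: "rh a (rh b (rh a T)) = rh c T" if "T \<in> X" for T
    using rhat_conjugate[OF a bR that] by (simp add: c_def)
  have "((rh a \<circ> rh b) ^^ 4) T = T" if T: "T \<in> X" for T
  proof -
    have bT: "rh b T \<in> X" using rhat_borel[OF bR T] .
    have "((rh a \<circ> rh b) ^^ 4) T = rh c (rh b (rh c (rh b T)))"
      using conj[OF bT] conj[of "rh b (rh c (rh b T))"] rhat_borel[OF bR] rhat_borel[OF cR] bT
      by (simp add: eval_nat_numeral)
    also have "rh b (rh c (rh b T)) = rh c T"
      using rhat_conjugate[OF b cR T] bc by simp
    finally show ?thesis unfolding rhat_involution[OF cR T] .
  qed
  then have d: "ex a b dvd 4" using exponent_dvd_iff[OF aR bR] by blast
  moreover have "((rh a \<circ> rh b) ^^ 2) S \<noteq> S"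
  proof
    assume eq: "((rh a \<circ> rh b) ^^ 2) S = S"
    have bS: "rh b S \<in> X" using rhat_borel[OF bR S(1)] .
    have "root_reflection m n c (- b) \<in> rh c (rh b S)"
      using minus_in_rhat[OF S] rhat_even[OF c bS] by simp
    moreover have "rh c (rh b S) = S" using eq conj[OF bS] by (simp add: numeral_2_eq_2)
    ultimately show False using bc borel_minus[OF S] by (simp add: refl_minus)
  qed
  then have "\<not> ex a b dvd 2" using exponent_dvd_iff[OF aR bR, of 2] S by auto
  ultimately show ?thesis using divisor_eq(3) by blast
qed

text \<open>
  Simple roots never differ by a root, so if both odd reflections move \<open>S\<close>, then \<open>\<gamma>\<close> and \<open>-\<gamma>'\<close> are
  simple in \<open>S\<close>, up to a common sign.  After the first reflection \<open>-\<gamma>\<close> and \<open>\<gamma> - \<gamma>'\<close> are simple.  Then \<open>-\<gamma>'\<close>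
  cannot be simple, because it differs from \<open>-\<gamma>\<close> by a root, and \<open>\<gamma>'\<close> cannot, because it adds up
  to 0 with the other two.
\<close>

lemma odd_reflections_separate:
  assumes g: "\<gamma> \<in> odd_roots m n" "\<gamma>' \<in> odd_roots m n" and diff: "\<gamma> - \<gamma>' \<in> R"
    and nz: "B \<gamma> \<gamma>' \<noteq> 0" and S: "S \<in> X" and moved: "rh \<gamma> S \<noteq> S" "rh \<gamma>' S \<noteq> S"
  shows "rh \<gamma>' (rh \<gamma> S) = rh \<gamma> S"
proof -
  have fixed: "rh y (odd_step m n x S) = odd_step m n x S"
    if xy: "x \<in> odd_roots m n" "y \<in> odd_roots m n" "x - y \<in> R" "B x y \<noteq> 0" "x \<in> S" "- y \<in> S"
    for x y
  proof -
    let ?T = "odd_step m n x S"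
    have T: "?T \<in> X" using odd_step_borel(1)[OF S xy(5,1)] .
    have "B (- y) x \<noteq> 0" using xy(4) wform_commute[of x y] by (simp add: wform_minus)
    then have in_T: "- x \<in> ?T" "- y + x \<in> ?T"
      using odd_step_contains[of x S] odd_step_contains(2)[OF xy(6)] by auto
    have "y \<notin> ?T" using borel_sum3[OF T _ in_T(2,1), of y] by auto
    moreover have "- y \<notin> ?T" using borel_simple_difference[OF T _ in_T(1), of "- y"] xy(3) by auto
    ultimately show ?thesis using rhat_odd_simple(3)[OF xy(2) T] by blast
  qed
  have mem: "\<gamma> \<in> S \<or> - \<gamma> \<in> S" "\<gamma>' \<in> S \<or> - \<gamma>' \<in> S"
    using rhat_odd_simple(3) g S moved by blast+
  have diff': "- \<gamma> - - \<gamma>' \<in> R" using minus_root[OF diff] by simp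
  have "\<not> (\<gamma> \<in> S \<and> \<gamma>' \<in> S)" "\<not> (- \<gamma> \<in> S \<and> - \<gamma>' \<in> S)"
    using borel_simple_difference[OF S] diff diff' by blast+
  with mem consider "\<gamma> \<in> S" "- \<gamma>' \<in> S" | "- \<gamma> \<in> S" "- (- \<gamma>') \<in> S" by auto
  then show ?thesis
  proof cases
    case 1
    then show ?thesis using fixed[OF g diff nz] rhat_odd_simple(1)[OF g(1) S] by simp
  next
    case 2
    have "rh (- \<gamma>') (odd_step m n (- \<gamma>) S) = odd_step m n (- \<gamma>) S"
      using fixed[OF minus_odd[OF g(1)] minus_odd[OF g(2)] diff' _ 2] nz by (simp add: wform_linear)
    then show ?thesis
      using 2 rhat_odd_simple(2)[OF g(1) S] rhat_minus[OF odd_is_root[OF g(2)]] by simp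
  qed
qed

text \<open>
  Every orbit is a path along which \<open>f\<close> and \<open>g\<close> alternate.  By the hypothesis, a point moved by both
  is the middle of a path with three points, so the product \<open>f g\<close> acts on an orbit with order 1,
  2 or 3.
\<close>

lemma separating_involutions_order:
  assumes f: "\<And>x. x \<in> A \<Longrightarrow> f x \<in> A \<and> f (f x) = x" and g: "\<And>x. x \<in> A \<Longrightarrow> g x \<in> A \<and> g (g x) = x"
    and sep: "\<And>x. x \<in> A \<Longrightarrow> f x \<noteq> x \<Longrightarrow> g x \<noteq> x \<Longrightarrow> g (f x) = f x \<and> f (g x) = g x"
    and x: "x \<in> A"
  shows "((f \<circ> g) ^^ 6) x = x"
proof -
  have six: "((f \<circ> g) ^^ 6) x = f (g (f (g (f (g (f (g (f (g (f (g x)))))))))))"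
    by (simp add: eval_nat_numeral)
  consider "f x \<noteq> x" "g x \<noteq> x" | "f x \<noteq> x" "g x = x" | "f x = x" "g x \<noteq> x" | "f x = x" "g x = x"
    by blast
  then show ?thesis
  proof cases
    case 1
    then show ?thesis using six f[OF x] g[OF x] sep[OF x] by simp
  next
    case 2
    let ?y = "f x"
    (* Either the orbit is \<open>{x, ?y}\<close>, or \<open>?y\<close> is the middle of three points. *)
    have "g ?y = ?y \<or> f (g ?y) = g ?y" using sep[of ?y] f[OF x] 2 by metis
    then show ?thesis using six 2 f[OF x] g[of ?y] f[of "g ?y"] by auto
  next
    case 3
    let ?y = "g x"
    (* The same with \<open>f\<close> and \<open>g\<close> exchanged. *)
    have "f ?y = ?y \<or> g (f ?y) = f ?y" using sep[of ?y] g[OF x] 3 by metis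
    then show ?thesis using six 3 g[OF x] f[of ?y] g[of "f ?y"] by auto
  next
    case 4
    then show ?thesis using six by simp
  qed
qed

text \<open>
  The square of \<open>r\<^sub>\<gamma> r\<^sub>a\<close> is the product of the odd reflections in \<open>\<gamma>\<close> and \<open>\<gamma> + a\<close>, whose sixth power is
  trivial.  The Borel subalgebra \<open>S\<close> belongs to an orbit with three elements under these two, which
  excludes the fourth power of \<open>r\<^sub>\<gamma> r\<^sub>a\<close>, and \<open>T\<close> to one with two elements, which excludes the sixth power.
\<close>

lemma exponent_12:
  assumes g: "\<gamma> \<in> odd_roots m n" and a: "a \<in> even_roots m n" and nz: "B \<gamma> a \<noteq> 0"
    and ga: "root_reflection m n a \<gamma> = \<gamma> + a"
    and S: "S \<in> X" "\<gamma> \<in> S" "a \<in> S"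
    and T: "T \<in> X" "\<gamma> \<in> T" "a \<notin> T" "\<gamma> + a \<notin> T" "- (\<gamma> + a) \<notin> T"
  shows "ex \<gamma> a = 12"
proof -
  note gR = odd_is_root[OF g] and aR = even_is_root[OF a]
  have g': "\<gamma> + a \<in> odd_roots m n" using refl_odd_root[OF a g] ga by simp
  note g'R = odd_is_root[OF g']
  have nz': "B \<gamma> (\<gamma> + a) \<noteq> 0" "B a \<gamma> \<noteq> 0"
    using nz odd_isotropic[OF g] wform_commute[of a \<gamma>] by (simp_all add: wform_linear)
  let ?F = "rh \<gamma> \<circ> rh a" and ?H = "rh \<gamma> \<circ> rh (\<gamma> + a)"
  have clos: "?H U \<in> X" if "U \<in> X" for U using that gR g'R rhat_borel by simp
  have pow: "(?F ^^ (2 * k)) U = (?H ^^ k) U \<and> (?H ^^ k) U \<in> X" if "U \<in> X" for U k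
  proof (induction k)
    case 0 then show ?case using that by simp
  next
    case (Suc k)
    let ?V = "(?H ^^ k) U"
    note IH = conjunct1[OF Suc] and V = conjunct2[OF Suc]
    have "(?F ^^ (2 * Suc k)) U = ?F (?F ((?F ^^ (2 * k)) U))" by simp
    also have "\<dots> = rh \<gamma> (rh a (rh \<gamma> (rh a ?V)))" unfolding IH by simp
    also have "\<dots> = ?H ?V" unfolding rhat_conjugate[OF a gR V] ga by simp
    finally have F: "(?F ^^ (2 * Suc k)) U = ?H ?V" .
    have H: "(?H ^^ Suc k) U = ?H ?V" unfolding funpow.simps(2) comp_apply ..
    show ?case unfolding F H using clos[OF V] by blast
  qed
  have dvd_iff: "ex \<gamma> a dvd 2 * k \<longleftrightarrow> (\<forall>U\<in>X. (?H ^^ k) U = U)" for k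
    using exponent_dvd_iff[OF gR aR, of "2 * k"] pow by simp
  have diff: "\<gamma> - (\<gamma> + a) \<in> R" "(\<gamma> + a) - \<gamma> \<in> R" using aR minus_root[OF aR] by simp_all
  have sep: "rh (\<gamma> + a) (rh \<gamma> U) = rh \<gamma> U \<and> rh \<gamma> (rh (\<gamma> + a) U) = rh (\<gamma> + a) U"
    if "U \<in> X" "rh \<gamma> U \<noteq> U" "rh (\<gamma> + a) U \<noteq> U" for U
    using odd_reflections_separate[OF g g' diff(1) nz'(1) that]
      odd_reflections_separate[OF g' g diff(2) _ that(1,3,2)] nz'(1) wform_commute[of \<gamma> "\<gamma> + a"] by simp
  have "(?H ^^ 6) U = U" if "U \<in> X" for U
    by (rule separating_involutions_order[of X])
      (use rhat_borel rhat_involution gR g'R sep that in auto)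
  then have d12: "ex \<gamma> a dvd 12" using dvd_iff[of 6] by simp
  have moves: "rh x U \<noteq> U" if "U \<in> X" "x \<in> U" for x U
    using minus_in_rhat[OF that] borel_minus[OF that] by auto
  have "\<not> ex \<gamma> a dvd 4"
  proof
    assume "ex \<gamma> a dvd 4"
    then have H2: "\<forall>U\<in>X. (?H ^^ 2) U = U" using dvd_iff[of 2] by simp
    (* The middle of the orbit: \<open>-\<gamma>\<close> and \<open>\<gamma> + a\<close> are both simple here. *)
    let ?U = "rh \<gamma> S"
    have U: "?U \<in> X" using rhat_borel[OF gR S(1)] .
    have "?U = odd_step m n \<gamma> S" using rhat_odd_simple(1)[OF g S(1,2)] .
    then have "a + \<gamma> \<in> ?U" using odd_step_contains(2)[OF S(3) nz'(2)] by simp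
    then have m2: "rh (\<gamma> + a) ?U \<noteq> ?U" using moves[OF U] by (simp add: add.commute)
    have m1: "rh \<gamma> ?U \<noteq> ?U" using rhat_involution[OF gR S(1)] moves[OF S(1,2)] by metis
    have "(?H ^^ 2) ?U = rh \<gamma> (rh (\<gamma> + a) (rh \<gamma> (rh (\<gamma> + a) ?U)))" by (simp add: numeral_2_eq_2)
    also have "\<dots> = rh \<gamma> ?U" using sep[OF U m1 m2] rhat_involution[OF g'R U] by simp
    finally show False using H2 U m1 by simp
  qed
  moreover have "\<not> ex \<gamma> a dvd 6"
  proof
    assume "ex \<gamma> a dvd 6"
    then have H3: "\<forall>U\<in>X. (?H ^^ 3) U = U" using dvd_iff[of 3] by simp
    (* The other end of the orbit: it is not moved by the reflection in \<open>\<gamma> + a\<close> either. *)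
    let ?U = "rh \<gamma> T"
    have U: "?U \<in> X" using rhat_borel[OF gR T(1)] .
    have Us: "?U = odd_step m n \<gamma> T" using rhat_odd_simple(1)[OF g T(1,2)] .
    have "B \<gamma> (- \<gamma>) = 0" using odd_isotropic[OF g] by (simp add: wform_minus2)
    then have ne: "\<gamma> + a \<noteq> \<gamma>" "\<gamma> + a \<noteq> - \<gamma>"
      using nz' odd_isotropic[OF g] by metis+
    have "\<gamma> + (\<gamma> + a) \<notin> R"
      using isotropic_string_unique[OF g g'R] aR by (auto simp: add.commute)
    then have "- (\<gamma> + a) - \<gamma> \<notin> T"
      using borel_is_root[OF T(1)] minus_root_iff[of "\<gamma> + (\<gamma> + a)"] by force
    moreover have "- (\<gamma> + a) = x + \<gamma> \<Longrightarrow> x = - (\<gamma> + a) - \<gamma>" "\<gamma> + a = x + \<gamma> \<Longrightarrow> x = a" for x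
      by (metis add_diff_cancel_right') (simp add: add.commute)
    moreover have "- (\<gamma> + a) \<noteq> - \<gamma>" using ne(1) by simp
    ultimately have "\<gamma> + a \<notin> ?U" "- (\<gamma> + a) \<notin> ?U"
      unfolding Us odd_step_def using T(3-5) ne(2) by blast+
    then have fU: "rh (\<gamma> + a) ?U = ?U" using rhat_odd_simple(3)[OF g' U] by blast
    have fT: "rh (\<gamma> + a) T = T" using rhat_odd_simple(3)[OF g' T(1,4,5)] .
    have "(?H ^^ 3) T = ?U" using fU fT rhat_involution[OF gR T(1)] by (simp add: numeral_3_eq_3)
    then show False using H3 T(1) moves[OF T(1,2)] by simp
  qed
  ultimately show ?thesis using divisor_eq(4) d12 by blast
qed

end

section \<open>Borel subalgebras from integral functionals\<close>

text \<open>
  Twice the values of a functional on the \<open>\<delta>\<^sub>i\<close> and \<open>\<epsilon>\<^sub>j\<close>.  The functional takes the value 1 on all of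
  \<open>Pi_tilde\<close> except \<open>-2 \<delta>\<^sub>1\<close>.  The doubling admits half-integral functionals, which are
  integral on the roots as well: the negative label below takes the value 1 on all of \<open>Pi_tilde\<close> except
  \<open>\<epsilon>\<^bsub>n-1\<^esub> + \<epsilon>\<^sub>n\<close>.
\<close>

definition chamber_label :: "nat \<Rightarrow> nat \<Rightarrow> coord \<Rightarrow> int" where
  "chamber_label m n c =
     (case c of Dl i \<Rightarrow> 2 * (int m + int n - int i) | Ep j \<Rightarrow> 2 * (int n - int j))"

definition negative_label :: "nat \<Rightarrow> coord \<Rightarrow> int" where
  "negative_label m c =
     (case c of Dl i \<Rightarrow> 1 - 2 * int i | Ep j \<Rightarrow> 1 - 2 * (int m + int j))"

context spo
begin

text \<open>
  Distinct absolute values keep the roots with two different coordinates from vanishing, and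
  nonzero values on the \<open>\<delta>\<^sub>i\<close> do so for the long roots.  At most one \<open>\<epsilon>\<^sub>j\<close> may have the value 0,
  as in the chamber label above.
\<close>

lemma integral_label_nonzero:
  assumes inj: "inj_on (\<lambda>c. \<bar>k c\<bar>) (Dl ` {1..m} \<union> Ep ` {1..n})"
    and nz: "\<And>i. i \<in> {1..m} \<Longrightarrow> k (Dl i) \<noteq> 0" and parity: "\<And>c d. even (k c + k d)"
    and \<alpha>: "\<alpha> \<in> R"
  shows "\<exists>z::int. E (\<lambda>c. real_of_int (k c) / 2) \<alpha> = of_int z \<and> z \<noteq> 0"
proof -
  let ?h = "\<lambda>c. real_of_int (k c) / 2"
  obtain p q where pq: "p \<in> L" "q \<in> L" "\<alpha> = p + q" "q \<noteq> - p" "\<not> (p = q \<and> p \<in> eletters n)"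
    using \<alpha> by (rule rootE)
  obtain c \<sigma> where c: "\<sigma> = 1 \<or> \<sigma> = -1" "p = (\<lambda>e. if e = c then \<sigma> else 0)"
    "\<And>v. E v p = \<sigma> * v c" "c \<in> Dl ` {1..m} \<or> c \<in> Ep ` {1..n} \<and> p \<in> eletters n"
    by (rule letter_coordinate[OF pq(1)]) blast
  obtain d \<tau> where d: "\<tau> = 1 \<or> \<tau> = -1" "q = (\<lambda>e. if e = d then \<tau> else 0)"
    "\<And>v. E v q = \<tau> * v d" "d \<in> Dl ` {1..m} \<or> d \<in> Ep ` {1..n} \<and> q \<in> eletters n"
    by (rule letter_coordinate[OF pq(2)]) blast
  obtain s t :: int where st: "s = 1 \<or> s = -1" "t = 1 \<or> t = -1" "\<sigma> = of_int s" "\<tau> = of_int t"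
    using c(1) d(1) that[of 1 1] that[of 1 "-1"] that[of "-1" 1] that[of "-1" "-1"] by force
  have val: "E ?h \<alpha> = real_of_int (s * k c + t * k d) / 2"
    by (simp add: pq(3) eval_at_add c(3) d(3) st(3,4) add_divide_distrib)
  have "even (s * k c + t * k d)" using parity[of c d] st(1,2) by auto
  then obtain z where z: "s * k c + t * k d = 2 * z" by blast
  have "z \<noteq> 0"
  proof
    assume "z = 0"
    then have "s * k c = - (t * k d)" using z by simp
    then have abs: "\<bar>k c\<bar> = \<bar>k d\<bar>" using st(1,2) by auto
    have "c \<in> Dl ` {1..m} \<union> Ep ` {1..n}" "d \<in> Dl ` {1..m} \<union> Ep ` {1..n}"
      using c(4) d(4) by blast+
    then have cd: "c = d" using inj_onD[OF inj abs] by blast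
    have "s = t"
    proof (rule ccontr)
      assume "s \<noteq> t"
      then have "\<tau> = - \<sigma>" using st by auto
      then have "q = - p" using c(2) d(2) cd by (auto simp: fun_eq_iff)
      then show False using pq(4) by blast
    qed
    then have "p = q" unfolding c(2) d(2) cd st(3,4) \<open>s = t\<close> by simp
    then have "c \<in> Dl ` {1..m}" using c(4) pq(5) by blast
    then have "k c \<noteq> 0" using nz by blast
    then show False using z \<open>z = 0\<close> cd \<open>s = t\<close> st(1) by auto
  qed
  then show ?thesis using val z by (intro exI[of _ z]) simp
qed

text \<open>
  All positive roots have values at least 1, so those of value 1 are indecomposable.
\<close>

lemma integral_label_borel:
  assumes inj: "inj_on (\<lambda>c. \<bar>k c\<bar>) (Dl ` {1..m} \<union> Ep ` {1..n})"
    and nz: "\<And>i. i \<in> {1..m} \<Longrightarrow> k (Dl i) \<noteq> 0" and parity: "\<And>c d. even (k c + k d)"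
  obtains S where "S \<in> X"
    "\<And>\<alpha>. \<alpha> \<in> R \<Longrightarrow> E (\<lambda>c. real_of_int (k c) / 2) \<alpha> = 1 \<Longrightarrow> \<alpha> \<in> S"
    "\<And>\<alpha>. E (\<lambda>c. real_of_int (k c) / 2) \<alpha> < 0 \<Longrightarrow> \<alpha> \<notin> S"
    "\<And>\<beta> \<gamma>. \<beta> \<in> R \<Longrightarrow> \<gamma> \<in> R \<Longrightarrow> E (\<lambda>c. real_of_int (k c) / 2) \<beta> > 0 \<Longrightarrow>
       E (\<lambda>c. real_of_int (k c) / 2) \<gamma> > 0 \<Longrightarrow> \<beta> + \<gamma> \<notin> S"
proof -
  define h where "h = (\<lambda>c. real_of_int (k c) / 2)"
  define P where "P = {\<alpha> \<in> R. E h \<alpha> > 0}"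
  have int: "\<exists>z::int. E h \<alpha> = of_int z \<and> z \<noteq> 0" if "\<alpha> \<in> R" for \<alpha>
    unfolding h_def using integral_label_nonzero[OF inj nz parity that] by blast
  have "positive_system m n P"
    unfolding positive_system_def P_def by (intro exI[of _ h]) (use int in force)
  then have X: "simple_roots P \<in> X" unfolding borels_def by blast
  have ge1: "E h \<alpha> \<ge> 1" if "\<alpha> \<in> P" for \<alpha> using that int[of \<alpha>] unfolding P_def by auto
  have one: "\<alpha> \<in> simple_roots P" if "\<alpha> \<in> R" "E h \<alpha> = 1" for \<alpha>
  proof -
    have "\<alpha> \<noteq> \<beta> + \<gamma>" if "\<beta> \<in> P" "\<gamma> \<in> P" for \<beta> \<gamma>
      using ge1[OF that(1)] ge1[OF that(2)] \<open>E h \<alpha> = 1\<close> by (auto simp: eval_at_add)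
    then show ?thesis using that unfolding simple_roots_def P_def by auto
  qed
  show ?thesis
    by (rule that[OF X]; fold h_def)
      (use one in \<open>auto simp: P_def dest: simple_is_positive simple_indecomposable\<close>)
qed

lemma chamber_label_simps:
  "chamber_label m n (Dl i) = 2 * (int m + int n - int i)"
  "chamber_label m n (Ep j) = 2 * (int n - int j)"
  by (simp_all add: chamber_label_def)

lemma negative_label_simps:
  "negative_label m (Dl i) = 1 - 2 * int i"
  "negative_label m (Ep j) = 1 - 2 * (int m + int j)"
  by (simp_all add: negative_label_def)

lemma chamber_label_inj:
  assumes "n \<ge> 1"
  shows "inj_on (\<lambda>c. \<bar>chamber_label m n c\<bar>) (Dl ` {1..m} \<union> Ep ` {1..n})"
  by (rule inj_onI) (auto simp: chamber_label_simps)

lemma chamber_label_less: "c \<in> Dl ` {1..m} \<union> Ep ` {1..n} \<Longrightarrow> \<bar>chamber_label m n c\<bar> < 2 * (int m + int n)"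
  by (auto simp: chamber_label_simps)

lemma chamber_label_even: "even (chamber_label m n c)"
  by (cases c) (auto simp: chamber_label_simps)

text \<open>
  Giving one coordinate the largest absolute value puts it first in the order of the letters, with
  a sign of choice, and leaves the relative position of the others unchanged.
\<close>

lemma outer_label_inj:
  assumes "\<bar>v\<bar> = 2 * (int m + int n)"
  shows "inj_on (\<lambda>c. \<bar>((chamber_label m n)(c0 := v)) c\<bar>) (Dl ` {1..m} \<union> Ep ` {1..n})"
proof (cases "n \<ge> 1")
  case True
  show ?thesis
  proof (rule inj_onI)
    fix x y assume xy: "x \<in> Dl ` {1..m} \<union> Ep ` {1..n}" "y \<in> Dl ` {1..m} \<union> Ep ` {1..n}"
      and eq: "\<bar>((chamber_label m n)(c0 := v)) x\<bar> = \<bar>((chamber_label m n)(c0 := v)) y\<bar>"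
    show "x = y"
    proof (cases "x = c0 \<or> y = c0")
      case True
      then show ?thesis
        using eq assms chamber_label_less[OF xy(1)] chamber_label_less[OF xy(2)]
        by (auto split: if_splits)
    next
      case False
      then show ?thesis using eq inj_onD[OF chamber_label_inj[OF \<open>n \<ge> 1\<close>] _ xy] by simp
    qed
  qed
next
  case False
  then show ?thesis by (auto simp: inj_on_def chamber_label_simps assms)
qed

lemma negative_label_inj:
  "inj_on (\<lambda>c. \<bar>negative_label m c\<bar>) (Dl ` {1..m} \<union> Ep ` {1..n})"
  by (rule inj_onI) (auto simp: negative_label_simps)

lemmas label_values = eval_at_linear eval_at_delta eval_at_eps
  chamber_label_simps negative_label_simps

end

section \<open>Exponents along the edges of the diagram\<close>

text \<open>
  The edges of the diagram as pairs of roots with exponent.  Indices such as \<open>1 + 1\<close> and \<open>m - 1 + 1\<close>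
  are kept in this form because it is the one in which the reflections of the diagram are defined.
\<close>

definition diagram_links :: "nat \<Rightarrow> nat \<Rightarrow> (weight \<times> weight \<times> nat) set" where
  "diagram_links m n =
     (if m = 1 then {(- delta 1 - delta 1, delta m - eps 1, 12)}
      else {(- delta 1 - delta 1, delta 1 - delta (1 + 1), 4),
            (delta (m - 1) - delta (m - 1 + 1), delta m - eps 1, 12)})
     \<union> {(delta i - delta (i + 1), delta (i + 1) - delta (i + 1 + 1), 3) | i. 1 \<le> i \<and> i + 1 < m}
     \<union> {(delta m - eps 1, eps 1 - eps (1 + 1), 12)}
     \<union> {(eps j - eps (j + 1), eps (j + 1) - eps (j + 1 + 1), 3) | j. 1 \<le> j \<and> j + 1 < n}
     \<union> (if n = 2 then {(delta m - eps 1, eps (n - 1) + eps n, 12)}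
        else {(eps (n - 2) - eps (n - 2 + 1), eps (n - 1) + eps n, 3)})"

lemma diagram_links_intros:
  "m = 1 \<Longrightarrow> (- delta 1 - delta 1, delta m - eps 1, 12) \<in> diagram_links m n"
  "m \<noteq> 1 \<Longrightarrow> (- delta 1 - delta 1, delta 1 - delta (1 + 1), 4) \<in> diagram_links m n"
  "m \<noteq> 1 \<Longrightarrow> (delta (m - 1) - delta (m - 1 + 1), delta m - eps 1, 12) \<in> diagram_links m n"
  "1 \<le> i \<Longrightarrow> i + 1 < m \<Longrightarrow>
     (delta i - delta (i + 1), delta (i + 1) - delta (i + 1 + 1), 3) \<in> diagram_links m n"
  "(delta m - eps 1, eps 1 - eps (1 + 1), 12) \<in> diagram_links m n"
  "1 \<le> j \<Longrightarrow> j + 1 < n \<Longrightarrow>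
     (eps j - eps (j + 1), eps (j + 1) - eps (j + 1 + 1), 3) \<in> diagram_links m n"
  "n = 2 \<Longrightarrow> (delta m - eps 1, eps (n - 1) + eps n, 12) \<in> diagram_links m n"
  "n \<noteq> 2 \<Longrightarrow>
     (eps (n - 2) - eps (n - 2 + 1), eps (n - 1) + eps n, 3) \<in> diagram_links m n"
  unfolding diagram_links_def by (simp, simp, simp, blast, simp, blast, simp, simp)

lemma diagram_links_cases:
  assumes "(\<theta>, \<theta>', d) \<in> diagram_links m n"
  obtains
    "m = 1" "\<theta> = - delta 1 - delta 1" "\<theta>' = delta m - eps 1" "d = 12"
  | "m \<noteq> 1" "\<theta> = - delta 1 - delta 1" "\<theta>' = delta 1 - delta (1 + 1)" "d = 4"
  | "m \<noteq> 1" "\<theta> = delta (m - 1) - delta (m - 1 + 1)" "\<theta>' = delta m - eps 1" "d = 12"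
  | i where "1 \<le> i" "i + 1 < m" "\<theta> = delta i - delta (i + 1)"
      "\<theta>' = delta (i + 1) - delta (i + 1 + 1)" "d = 3"
  | "\<theta> = delta m - eps 1" "\<theta>' = eps 1 - eps (1 + 1)" "d = 12"
  | j where "1 \<le> j" "j + 1 < n" "\<theta> = eps j - eps (j + 1)"
      "\<theta>' = eps (j + 1) - eps (j + 1 + 1)" "d = 3"
  | "n = 2" "\<theta> = delta m - eps 1" "\<theta>' = eps (n - 1) + eps n" "d = 12"
  | "n \<noteq> 2" "\<theta> = eps (n - 2) - eps (n - 2 + 1)" "\<theta>' = eps (n - 1) + eps n" "d = 3"
  using assms unfolding diagram_links_def by (cases "m = 1"; cases "n = 2") (simp; blast)+

lemma Pi_tilde_intros:
  "- delta 1 - delta 1 \<in> Pi_tilde m n"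
  "1 \<le> i \<Longrightarrow> i < m \<Longrightarrow> delta i - delta (i + 1) \<in> Pi_tilde m n"
  "delta m - eps 1 \<in> Pi_tilde m n"
  "1 \<le> j \<Longrightarrow> j < n \<Longrightarrow> eps j - eps (j + 1) \<in> Pi_tilde m n"
  "eps (n - 1) + eps n \<in> Pi_tilde m n"
  unfolding Pi_tilde_def by blast+

lemma Pi_tilde_cases:
  assumes "\<theta> \<in> Pi_tilde m n"
  obtains "\<theta> = - delta 1 - delta 1"
  | i where "1 \<le> i" "i < m" "\<theta> = delta i - delta (i + 1)"
  | "\<theta> = delta m - eps 1"
  | j where "1 \<le> j" "j < n" "\<theta> = eps j - eps (j + 1)"
  | "\<theta> = eps (n - 1) + eps n"
  using assms unfolding Pi_tilde_def by blast

lemma Pi_tilde_distinct: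
  "delta k - eps 1 \<noteq> - delta 1 - delta 1" "delta k - eps 1 \<noteq> eps i + eps j"
  "- delta 1 - delta 1 \<noteq> eps i + eps j" "- delta 1 - delta 1 \<noteq> eps i - eps j"
  "- delta 1 - delta 1 \<noteq> delta i - delta (i + 1)"
proof -
  have neq: "v \<noteq> w" if "v c \<noteq> w c" for v w :: weight and c using that by auto
  note apply_simps = minus_apply uminus_apply plus_fun_apply delta_def eps_def
  show "delta k - eps 1 \<noteq> - delta 1 - delta 1"
    by (rule neq[of _ "Ep 1"]) (simp only: apply_simps, simp)
  show "delta k - eps 1 \<noteq> eps i + eps j"
    by (rule neq[of _ "Dl k"]) (simp only: apply_simps, simp)
  show "- delta 1 - delta 1 \<noteq> eps i + eps j" "- delta 1 - delta 1 \<noteq> eps i - eps j"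
    by (rule neq[of _ "Dl 1"], simp only: apply_simps, simp)+
  show "- delta 1 - delta 1 \<noteq> delta i - delta (i + 1)"
    by (rule neq[of _ "Dl 1"]) (simp only: apply_simps, simp)
qed

lemma even_rootsI:
  "i \<in> {1..m} \<Longrightarrow> k \<in> {1..m} - {i} \<Longrightarrow> delta i - delta k \<in> even_roots m n"
  "i \<in> {1..m} \<Longrightarrow> - delta i - delta i \<in> even_roots m n"
  "j \<in> {1..n} \<Longrightarrow> l \<in> {1..n} - {j} \<Longrightarrow> eps j - eps l \<in> even_roots m n"
  "j \<in> {1..n} \<Longrightarrow> l \<in> {1..n} - {j} \<Longrightarrow> eps j + eps l \<in> even_roots m n"
  "i \<in> {1..m} \<Longrightarrow> k \<in> {1..m} - {i} \<Longrightarrow> - delta i - delta k \<in> even_roots m n"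
  unfolding even_roots_def by blast+

lemma odd_rootsI:
  assumes "i \<in> {1..m}" "j \<in> {1..n}"
  shows "delta i + eps j \<in> odd_roots m n" "delta i - eps j \<in> odd_roots m n"
    "- delta i + eps j \<in> odd_roots m n" "- delta i - eps j \<in> odd_roots m n"
  using assms unfolding odd_roots_def by blast+

context spo
begin

lemma Pi_tilde_even:
  assumes "1 \<le> m" "2 \<le> n" "\<theta> \<in> Pi_tilde m n" "\<theta> \<noteq> delta m - eps 1"
  shows "\<theta> \<in> even_roots m n"
  using assms(3)
proof (cases rule: Pi_tilde_cases)
  case 1
  then show ?thesis using even_rootsI(2)[of 1 m n] assms(1) by simp
next
  case (2 i)
  then show ?thesis using even_rootsI(1)[of i m "i + 1" n] by simp
next
  case 3
  then show ?thesis using assms by simp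
next
  case (4 j)
  then show ?thesis using even_rootsI(3)[of j n "j + 1" m] by simp
next
  case 5
  then show ?thesis using even_rootsI(4)[of "n - 1" n n m] assms(2) by simp
qed

lemma Pi_tilde_odd: "1 \<le> m \<Longrightarrow> 2 \<le> n \<Longrightarrow> delta m - eps 1 \<in> odd_roots m n"
  using odd_rootsI(2)[of m m 1 n] by simp

lemma Pi_tilde_root: "1 \<le> m \<Longrightarrow> 2 \<le> n \<Longrightarrow> \<theta> \<in> Pi_tilde m n \<Longrightarrow> \<theta> \<in> R"
  using Pi_tilde_even Pi_tilde_odd even_is_root odd_is_root by metis

text \<open>
  The conclusions about \<open>\<delta>\<^sub>m + \<epsilon>\<^sub>1\<close> and \<open>-2 \<delta>\<^sub>1\<close> make this Borel subalgebra the one with an orbit of two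
  elements in the case \<open>m = 1\<close>.
\<close>

lemma distinguished_borel:
  assumes "1 \<le> m" "2 \<le> n"
  obtains S where "S \<in> X" "\<And>\<theta>. \<theta> \<in> Pi_tilde m n \<Longrightarrow> \<theta> \<noteq> - delta 1 - delta 1 \<Longrightarrow> \<theta> \<in> S"
    "- (delta m + eps 1) \<notin> S" "m = 1 \<Longrightarrow> delta m + eps 1 \<notin> S \<and> - delta 1 - delta 1 \<notin> S"
proof -
  let ?h = "\<lambda>c. real_of_int (chamber_label m n c) / 2"
  have "inj_on (\<lambda>c. \<bar>chamber_label m n c\<bar>) (Dl ` {1..m} \<union> Ep ` {1..n})"
    using assms by (intro chamber_label_inj) simp
  then obtain S where S: "S \<in> X" "\<And>\<alpha>. \<alpha> \<in> R \<Longrightarrow> E ?h \<alpha> = 1 \<Longrightarrow> \<alpha> \<in> S"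
    "\<And>\<alpha>. E ?h \<alpha> < 0 \<Longrightarrow> \<alpha> \<notin> S"
    "\<And>\<beta> \<gamma>. \<beta> \<in> R \<Longrightarrow> \<gamma> \<in> R \<Longrightarrow> E ?h \<beta> > 0 \<Longrightarrow> E ?h \<gamma> > 0 \<Longrightarrow> \<beta> + \<gamma> \<notin> S"
    by (rule integral_label_borel[of "chamber_label m n"])
      (use assms in \<open>auto simp: chamber_label_simps chamber_label_even\<close>)
  have one: "E ?h \<theta> = 1" if "\<theta> \<in> Pi_tilde m n" "\<theta> \<noteq> - delta 1 - delta 1" for \<theta>
    using that(1)
  proof (cases rule: Pi_tilde_cases)
    case 1
    then show ?thesis using that by simp
  next
    case (2 i)
    show ?thesis unfolding 2(3) eval_at_linear
      using 2 assms by (simp add: label_values field_simps)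
  next
    case 3
    show ?thesis unfolding 3 eval_at_linear
      using 3 assms by (simp add: label_values field_simps)
  next
    case (4 j)
    show ?thesis unfolding 4(3) eval_at_linear
      using 4 assms by (simp add: label_values field_simps)
  next
    case 5
    have "chamber_label m n (Ep (n - 1)) = 2" "chamber_label m n (Ep n) = 0"
      using assms by (simp_all add: chamber_label_def of_nat_diff)
    then show ?thesis unfolding 5 eval_at_linear
      using assms by (simp add: eval_at_eps)
  qed
  have mem: "\<theta> \<in> S" if "\<theta> \<in> Pi_tilde m n" "\<theta> \<noteq> - delta 1 - delta 1" for \<theta>
    using S(2) one[OF that] Pi_tilde_root[OF assms that(1)] by blast
  have "- (delta m + eps 1) \<notin> S"
    using assms by (intro S(3)) (simp add: label_values)
  moreover have "delta m + eps 1 \<notin> S \<and> - delta 1 - delta 1 \<notin> S" if "m = 1"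
  proof
    (* For \<open>m = 1\<close> the root \<open>\<delta>\<^sub>1 + \<epsilon>\<^sub>1\<close> is positive, but decomposable as \<open>n \<ge> 2\<close>. *)
    have "(delta m - eps 2) + (eps 1 + eps 2) \<notin> S"
    proof (rule S(4))
      show "delta m - eps 2 \<in> R" using odd_rootsI(2)[of m m 2 n] assms odd_is_root by simp
      show "eps 1 + eps 2 \<in> R" using even_rootsI(4)[of 1 n 2 m] assms even_is_root by simp
      show "E ?h (delta m - eps 2) > 0" "E ?h (eps 1 + eps 2) > 0"
        using assms by (simp_all add: label_values field_simps)
    qed
    then show "delta m + eps 1 \<notin> S" by (simp add: algebra_simps)
    show "- delta 1 - delta 1 \<notin> S"
    proof (rule S(3))
      show "E ?h (- delta 1 - delta 1) < 0"
        unfolding eval_at_linear using assms by (simp add: label_values)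
    qed
  qed
  ultimately show ?thesis using that[OF S(1)] mem by blast
qed

lemma negative_borel:
  assumes "1 \<le> m" "2 \<le> n"
  obtains S where "S \<in> X" "\<And>\<theta>. \<theta> \<in> Pi_tilde m n \<Longrightarrow> \<theta> \<noteq> eps (n - 1) + eps n \<Longrightarrow> \<theta> \<in> S"
proof -
  let ?h = "\<lambda>c. real_of_int (negative_label m c) / 2"
  obtain S where S: "S \<in> X" "\<And>\<alpha>. \<alpha> \<in> R \<Longrightarrow> E ?h \<alpha> = 1 \<Longrightarrow> \<alpha> \<in> S"
    by (rule integral_label_borel[of "negative_label m", OF negative_label_inj])
      (auto simp: negative_label_def split: coord.splits)
  have one: "E ?h \<theta> = 1" if "\<theta> \<in> Pi_tilde m n" "\<theta> \<noteq> eps (n - 1) + eps n" for \<theta>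
    using that(1)
  proof (cases rule: Pi_tilde_cases)
    case 1
    show ?thesis unfolding 1 eval_at_linear
      using 1 assms by (simp add: label_values field_simps)
  next
    case (2 i)
    show ?thesis unfolding 2(3) eval_at_linear
      using 2 assms by (simp add: label_values field_simps)
  next
    case 3
    show ?thesis unfolding 3 eval_at_linear
      using 3 assms by (simp add: label_values field_simps)
  next
    case (4 j)
    show ?thesis unfolding 4(3) eval_at_linear
      using 4 assms by (simp add: label_values field_simps)
  next
    case 5
    then show ?thesis using that by simp
  qed
  show ?thesis by (rule that[OF S(1)]) (use S(2) one Pi_tilde_root[OF assms] in blast)
qed

lemma outer_label_borel:
  assumes "1 \<le> m" "2 \<le> n" and v: "\<bar>v\<bar> = 2 * (int m + int n)"
  obtains S where "S \<in> X"
    "\<And>\<alpha>. \<alpha> \<in> R \<Longrightarrow> E (\<lambda>c. real_of_int (((chamber_label m n)(c0 := v)) c) / 2) \<alpha> = 1 \<Longrightarrow> \<alpha> \<in> S"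
    "\<And>\<alpha>. E (\<lambda>c. real_of_int (((chamber_label m n)(c0 := v)) c) / 2) \<alpha> < 0 \<Longrightarrow> \<alpha> \<notin> S"
    "\<And>\<beta> \<gamma>. \<beta> \<in> R \<Longrightarrow> \<gamma> \<in> R \<Longrightarrow>
       E (\<lambda>c. real_of_int (((chamber_label m n)(c0 := v)) c) / 2) \<beta> > 0 \<Longrightarrow>
       E (\<lambda>c. real_of_int (((chamber_label m n)(c0 := v)) c) / 2) \<gamma> > 0 \<Longrightarrow> \<beta> + \<gamma> \<notin> S"
proof (rule integral_label_borel[of "(chamber_label m n)(c0 := v)", OF outer_label_inj[OF v]])
  have ev: "even v" using v by (metis dvd_triv_left dvd_abs_iff)
  show "even (((chamber_label m n)(c0 := v)) c + ((chamber_label m n)(c0 := v)) d)" for c d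
    using ev chamber_label_even by simp
  show "((chamber_label m n)(c0 := v)) (Dl i) \<noteq> 0" if "i \<in> {1..m}" for i
    using that v assms by (auto simp: chamber_label_simps)
qed (use that in blast)

text \<open>
  The condition on the form says \<open>s\<^sub>a \<gamma> = \<gamma> + a\<close>.
\<close>

lemma exponent_12_from_norms:
  assumes "\<gamma> \<in> odd_roots m n" "a \<in> even_roots m n" "2 * B \<gamma> a = - B a a"
    and "S \<in> X" "\<gamma> \<in> S" "a \<in> S"
    and "T \<in> X" "\<gamma> \<in> T" "a \<notin> T" "\<gamma> + a \<notin> T" "- (\<gamma> + a) \<notin> T"
  shows "ex \<gamma> a = 12"
  using assms even_norm_nonzero[OF assms(2)] by (intro exponent_12[where S = S and T = T] refl_eqs(3)) auto

lemma exponent_3_from_norms: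
  assumes "a \<in> even_roots m n" "b \<in> even_roots m n" "2 * B a b = - B a a" "2 * B a b = - B b b"
    and "S \<in> X" "a \<in> S" "b \<in> S"
  shows "ex a b = 3"
proof (rule exponent_3[OF assms(1,2) _ _ assms(5-7)])
  show "root_reflection m n a b = a + b"
    using refl_eqs(3)[of b a] assms(3) even_norm_nonzero[OF assms(1)] wform_commute[of a b]
    by (simp add: add.commute)
  show "root_reflection m n b a = a + b"
    using refl_eqs(3)[of a b] assms(4) even_norm_nonzero[OF assms(2)] by simp
qed

lemmas wform_values = wform_linear wform_delta wform_eps delta_apply eps_apply

lemma exponent_delta1_odd:
  assumes "m = 1" "2 \<le> n"
  shows "ex (delta m - eps 1) (- delta 1 - delta 1) = 12"
proof -
  have m: "1 \<le> m" using assms by simp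
  obtain S where S: "S \<in> X" "\<And>\<theta>. \<theta> \<in> Pi_tilde m n \<Longrightarrow> \<theta> \<noteq> eps (n - 1) + eps n \<Longrightarrow> \<theta> \<in> S"
    using negative_borel[OF m assms(2)] by blast
  obtain T where T: "T \<in> X" "\<And>\<theta>. \<theta> \<in> Pi_tilde m n \<Longrightarrow> \<theta> \<noteq> - delta 1 - delta 1 \<Longrightarrow> \<theta> \<in> T"
    "- (delta m + eps 1) \<notin> T" "delta m + eps 1 \<notin> T" "- delta 1 - delta 1 \<notin> T"
    using distinguished_borel[OF m assms(2)] assms(1) by metis
  note ne = Pi_tilde_distinct(1)[of m] Pi_tilde_distinct(2)[of m "n - 1" n]
    Pi_tilde_distinct(3)[of "n - 1" n]
  have sum: "delta m - eps 1 + (- delta 1 - delta 1) = - (delta m + eps 1)"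
    "- (delta m - eps 1 + (- delta 1 - delta 1)) = delta m + eps 1"
    using assms(1) by simp_all
  show ?thesis
  proof (rule exponent_12_from_norms[OF Pi_tilde_odd[OF m assms(2)] _ _ S(1) _ _ T(1)])
    show "- delta 1 - delta 1 \<in> even_roots m n" using even_rootsI(2)[of 1 m n] m by simp
    have dm: "delta m = delta 1" using assms(1) by simp
    have "B (- delta 1 - delta 1) (- delta 1 - delta 1) = 4"
      "B (delta m - eps 1) (- delta 1 - delta 1) = -2"
      unfolding wform_linear dm using m assms(2) by (simp_all add: wform_values)
    then show "2 * B (delta m - eps 1) (- delta 1 - delta 1) = - B (- delta 1 - delta 1) (- delta 1 - delta 1)"
      by simp
    show "delta m - eps 1 \<in> S" "- delta 1 - delta 1 \<in> S"
      using S(2) Pi_tilde_intros(1,3)[of m n] ne by metis+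
    show "delta m - eps 1 \<in> T" using T(2) Pi_tilde_intros(3)[of m n] ne by metis
    show "- delta 1 - delta 1 \<notin> T" by (rule T(5))
    show "delta m - eps 1 + (- delta 1 - delta 1) \<notin> T" unfolding sum(1) by (rule T(3))
    show "- (delta m - eps 1 + (- delta 1 - delta 1)) \<notin> T" unfolding sum(2) by (rule T(4))
  qed
qed

lemma exponent_delta1_delta2:
  assumes "m \<ge> 2" "2 \<le> n"
  shows "ex (- delta 1 - delta 1) (delta 1 - delta (1 + 1)) = 4"
proof -
  have m: "1 \<le> m" using assms by simp
  obtain S where S: "S \<in> X" "\<And>\<theta>. \<theta> \<in> Pi_tilde m n \<Longrightarrow> \<theta> \<noteq> - delta 1 - delta 1 \<Longrightarrow> \<theta> \<in> S"
    using distinguished_borel[OF m assms(2)] by metis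
  let ?a = "- delta 1 - delta 1" and ?b = "delta 1 - delta (1 + 1)"
  have ne: "?b \<noteq> ?a" using Pi_tilde_distinct(5)[of 1] by metis
  have a: "?a \<in> even_roots m n" using even_rootsI(2)[of 1 m n] m by simp
  have b: "?b \<in> even_roots m n" using even_rootsI(1)[of 1 m "1 + 1" n] assms(1) by simp
  have v: "B ?a ?a = 4" "B ?b ?a = -2" "B ?b ?b = 2"
    unfolding wform_linear using assms by (simp_all add: wform_values)
  have "root_reflection m n ?a ?b = ?b + ?a" using v by (intro refl_eqs(3)) simp_all
  then have orth: "B ?b (root_reflection m n ?a ?b) = 0" using v by (simp only: wform_add2)
  have "?b \<in> S" using S(2) Pi_tilde_intros(2)[of 1 m n] assms ne by simp
  then show ?thesis using exponent_4[OF a b orth S(1)] by blast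
qed

text \<open>
  Placing \<open>-\<delta>\<^bsub>m-1\<^esub>\<close> in front of all other letters keeps \<open>\<gamma> = \<delta>\<^sub>m - \<epsilon>\<^sub>1\<close> simple and removes
  \<open>\<delta>\<^bsub>m-1\<^esub>\<close> from the neighbourhood of \<open>\<delta>\<^sub>m\<close> and \<open>\<epsilon>\<^sub>1\<close>.  This gives the orbit with two elements.
\<close>

lemma exponent_delta_odd:
  assumes "m \<ge> 2" "2 \<le> n"
  shows "ex (delta m - eps 1) (delta (m - 1) - delta (m - 1 + 1)) = 12"
proof -
  have m: "1 \<le> m" using assms by simp
  have mm: "m - 1 + 1 = m" using m by simp
  let ?g = "delta m - eps 1" and ?a = "delta (m - 1) - delta m"
  obtain S where S: "S \<in> X" "\<And>\<theta>. \<theta> \<in> Pi_tilde m n \<Longrightarrow> \<theta> \<noteq> - delta 1 - delta 1 \<Longrightarrow> \<theta> \<in> S"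
    using distinguished_borel[OF m assms(2)] by metis
  define v where "v = - 2 * (int m + int n)"
  let ?h = "\<lambda>c. real_of_int (((chamber_label m n)(Dl (m - 1) := v)) c) / 2"
  obtain T where T: "T \<in> X" "\<And>\<alpha>. \<alpha> \<in> R \<Longrightarrow> E ?h \<alpha> = 1 \<Longrightarrow> \<alpha> \<in> T"
    "\<And>\<alpha>. E ?h \<alpha> < 0 \<Longrightarrow> \<alpha> \<notin> T"
    "\<And>\<beta> \<gamma>. \<beta> \<in> R \<Longrightarrow> \<gamma> \<in> R \<Longrightarrow> E ?h \<beta> > 0 \<Longrightarrow> E ?h \<gamma> > 0 \<Longrightarrow> \<beta> + \<gamma> \<notin> T"
    by (rule outer_label_borel[OF m assms(2), of v "Dl (m - 1)"]) (simp add: v_def, blast)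
  have h: "E ?h (delta m) = n" "E ?h (delta (m - 1)) = - (real m + real n)"
    "E ?h (eps 1) = real n - 1"
    using assms by (simp_all add: eval_at_delta eval_at_eps chamber_label_simps v_def)
  have ne: "?g \<noteq> - delta 1 - delta 1" "?a \<noteq> - delta 1 - delta 1"
    using Pi_tilde_distinct(1)[of m] Pi_tilde_distinct(5)[of "m - 1"] mm by metis+
  note g = Pi_tilde_odd[OF m assms(2)]
  have a: "?a \<in> even_roots m n" using even_rootsI(1)[of "m - 1" m m n] assms(1) by auto
  have neg: "- (?g + ?a) = (eps 1 + delta m) + (- delta (m - 1) - delta m)"
    by (simp add: algebra_simps)
  show ?thesis
    unfolding mm
  proof (rule exponent_12_from_norms[OF g a _ S(1) _ _ T(1)])
    have "B ?a ?a = 2" "B ?g ?a = -1"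
      unfolding wform_linear using assms by (auto simp: wform_values)
    then show "2 * B ?g ?a = - B ?a ?a" by simp
    show "?g \<in> S" using S(2) Pi_tilde_intros(3)[of m n] ne by blast
    show "?a \<in> S" using S(2) Pi_tilde_intros(2)[of "m - 1" m n] ne assms(1) mm by auto
    show "?g \<in> T" using h by (intro T(2) odd_is_root[OF g]) (simp add: eval_at_linear)
    show "?a \<notin> T" using h assms by (intro T(3)) (simp add: eval_at_linear)
    show "?g + ?a \<notin> T" using h assms by (intro T(3)) (simp add: eval_at_linear)
    show "- (?g + ?a) \<notin> T" unfolding neg
    proof (rule T(4))
      show "eps 1 + delta m \<in> R"
        using odd_rootsI(1)[of m m 1 n] assms odd_is_root by (simp add: add.commute)
      show "- delta (m - 1) - delta m \<in> R"
        using even_rootsI(5)[of "m - 1" m m n] assms even_is_root by auto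
      show "E ?h (eps 1 + delta m) > 0" "E ?h (- delta (m - 1) - delta m) > 0"
        using h assms by (simp_all add: eval_at_linear)
    qed
  qed
qed

text \<open>
  The two even roots \<open>a = \<epsilon>\<^sub>1 - u\<close> that are linked to \<open>\<gamma> = \<delta>\<^sub>m - \<epsilon>\<^sub>1\<close> on the right, the second one only for \<open>n = 2\<close>,
  differ by the sign of \<open>\<epsilon>\<^sub>2\<close>.  Placing \<open>-u\<close> in front of all other letters gives the orbit with two elements.
\<close>

lemma exponent_odd_eps:
  assumes "1 \<le> m" "2 \<le> n" and a: "a = eps 1 - eps 2 \<and> u = eps 2 \<or> a = eps 1 + eps 2 \<and> u = - eps 2 \<and> n = 2"
  shows "ex (delta m - eps 1) a = 12"
proof -
  obtain S where S: "S \<in> X" "\<And>\<theta>. \<theta> \<in> Pi_tilde m n \<Longrightarrow> \<theta> \<noteq> - delta 1 - delta 1 \<Longrightarrow> \<theta> \<in> S"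
    using distinguished_borel[OF assms(1,2)] by metis
  let ?g = "delta m - eps 1"
  define v where "v = (if u = eps 2 then - 2 * (int m + int n) else 2 * (int m + int n))"
  let ?h = "\<lambda>c. real_of_int (((chamber_label m n)(Ep 2 := v)) c) / 2"
  obtain T where T: "T \<in> X" "\<And>\<alpha>. \<alpha> \<in> R \<Longrightarrow> E ?h \<alpha> = 1 \<Longrightarrow> \<alpha> \<in> T"
    "\<And>\<alpha>. E ?h \<alpha> < 0 \<Longrightarrow> \<alpha> \<notin> T"
    "\<And>\<beta> \<gamma>. \<beta> \<in> R \<Longrightarrow> \<gamma> \<in> R \<Longrightarrow> E ?h \<beta> > 0 \<Longrightarrow> E ?h \<gamma> > 0 \<Longrightarrow> \<beta> + \<gamma> \<notin> T"
    by (rule outer_label_borel[OF assms(1,2), of v "Ep 2"]) (simp add: v_def, blast)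
  have au: "a = eps 1 - u" using a by auto
  have ne2: "- eps 2 \<noteq> eps 2"
    using fun_cong[of "- eps 2" "eps 2" "Ep 2"] by (auto simp: eps_apply)
  have h: "E ?h (delta m) = n" "E ?h (eps 1) = real n - 1"
    using assms(1,2) by (simp_all add: eval_at_delta eval_at_eps chamber_label_simps)
  have e2: "E ?h (eps 2) = real_of_int v / 2" using assms(2) by (simp add: eval_at_eps)
  have hu: "E ?h u = - (real m + real n)"
    using a
  proof
    assume "a = eps 1 - eps 2 \<and> u = eps 2"
    then have u: "u = eps 2" and v: "v = - 2 * (int m + int n)" by (simp_all add: v_def)
    show ?thesis unfolding u e2 by (simp add: v field_simps)
  next
    assume "a = eps 1 + eps 2 \<and> u = - eps 2 \<and> n = 2"
    then have u: "u = - eps 2" and v: "v = 2 * (int m + int n)" using ne2 by (simp_all add: v_def)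
    show ?thesis unfolding u eval_at_minus e2 by (simp add: v field_simps)
  qed
  note h = h hu
  have ne: "?g \<noteq> - delta 1 - delta 1" "a \<noteq> - delta 1 - delta 1"
    using Pi_tilde_distinct(1)[of m] Pi_tilde_distinct(3,4)[of 1 2] a by metis+
  note g = Pi_tilde_odd[OF assms(1,2)]
  have even: "a \<in> even_roots m n"
    using a even_rootsI(3)[of 1 n 2 m] even_rootsI(4)[of 1 n 2 m] assms(2) by auto
  have mem: "a \<in> Pi_tilde m n"
    using a Pi_tilde_intros(4)[of 1 n m] Pi_tilde_intros(5)[of n m] assms(2)
    by (auto simp: numeral_2_eq_2)
  have r1: "eps 2 - eps 1 \<in> R"
    using even_is_root[OF even_rootsI(3)[of 2 n 1 m]] assms(2) by simp
  have "eps 1 + eps 2 \<in> R" using even_is_root[OF even_rootsI(4)[of 1 n 2 m]] assms(2) by simp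
  then have "- (eps 1 + eps 2) \<in> R" by (rule minus_root)
  moreover have "- (eps 1 + eps 2) = - eps 2 - eps 1" by (simp add: algebra_simps)
  ultimately have r2: "- eps 2 - eps 1 \<in> R" by (simp only:)
  have "- delta m + eps 2 \<in> R" "- delta m - eps 2 \<in> R" "delta m + eps 1 \<in> R"
    using odd_is_root[OF odd_rootsI(3)[of m m 2 n]] odd_is_root[OF odd_rootsI(4)[of m m 2 n]]
      odd_is_root[OF odd_rootsI(1)[of m m 1 n]] assms(1,2) by simp_all
  moreover have "- delta m + eps 2 = eps 2 - delta m" "- delta m - eps 2 = - eps 2 - delta m"
    by simp_all
  ultimately have u: "- u - eps 1 \<in> R" "- u - delta m \<in> R" "delta m + eps 1 \<in> R"
    using a r1 r2 by (metis minus_minus)+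
  show ?thesis
  proof (rule exponent_12_from_norms[OF g even _ S(1) _ _ T(1)])
    have v: "B (eps 1) (eps 1) = -1" "B (eps 2) (eps 2) = -1" "B (eps 1) (eps 2) = 0"
      "B (eps 2) (eps 1) = 0" "B (delta m) (eps 1) = 0" "B (delta m) (eps 2) = 0"
      using assms(1,2) by (simp_all add: wform_values)
    have "a = eps 1 - eps 2 \<or> a = eps 1 + eps 2" using a by blast
    then show "2 * B ?g a = - B a a"
    proof
      assume a: "a = eps 1 - eps 2"
      show ?thesis unfolding a wform_linear v by simp
    next
      assume a: "a = eps 1 + eps 2"
      show ?thesis unfolding a wform_linear v by simp
    qed
    show "?g \<in> S" using S(2) Pi_tilde_intros(3)[of m n] ne by blast
    show "a \<in> S" using S(2) mem ne by blast
    show "?g \<in> T" using h by (intro T(2) odd_is_root[OF g]) (simp add: eval_at_linear)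
    have "(delta m + eps 1) + (- u - delta m) \<notin> T"
      using h u assms(1,2) by (intro T(4)) (simp_all add: eval_at_linear)
    then show "a \<notin> T" by (simp add: au algebra_simps)
    have "(delta m + eps 1) + (- u - eps 1) \<notin> T"
      using h u assms(1,2) by (intro T(4)) (simp_all add: eval_at_linear)
    then show "?g + a \<notin> T" by (simp add: au algebra_simps)
    show "- (?g + a) \<notin> T" using h assms by (intro T(3)) (simp add: eval_at_linear au)
  qed
qed

lemma exponent_delta_delta:
  assumes "2 \<le> n" "1 \<le> i" "i + 1 < m"
  shows "ex (delta i - delta (i + 1)) (delta (i + 1) - delta (i + 1 + 1)) = 3"
proof -
  have m: "1 \<le> m" using assms by simp
  obtain S where S: "S \<in> X" "\<And>\<theta>. \<theta> \<in> Pi_tilde m n \<Longrightarrow> \<theta> \<noteq> - delta 1 - delta 1 \<Longrightarrow> \<theta> \<in> S"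
    using distinguished_borel[OF m assms(1)] by metis
  let ?a = "delta i - delta (i + 1)" and ?b = "delta (i + 1) - delta (i + 1 + 1)"
  have "B ?a ?a = 2" "B ?b ?b = 2" "B ?a ?b = -1"
    unfolding wform_linear using assms by (simp_all add: wform_values)
  moreover have "?a \<in> even_roots m n" "?b \<in> even_roots m n"
    using even_rootsI(1)[of i m "i + 1" n] even_rootsI(1)[of "i + 1" m "i + 1 + 1" n] assms by simp_all
  moreover have "?a \<in> S" "?b \<in> S"
    using S(2) Pi_tilde_intros(2)[of i m n] Pi_tilde_intros(2)[of "i + 1" m n]
      Pi_tilde_distinct(5)[of i] Pi_tilde_distinct(5)[of "i + 1"] assms by auto
  ultimately show ?thesis using S(1) by (intro exponent_3_from_norms[where S = S]) simp_all
qed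

lemma exponent_eps_eps:
  assumes "1 \<le> m" "1 \<le> j" "j + 1 < n"
  shows "ex (eps j - eps (j + 1)) (eps (j + 1) - eps (j + 1 + 1)) = 3"
proof -
  have n: "2 \<le> n" using assms by simp
  obtain S where S: "S \<in> X" "\<And>\<theta>. \<theta> \<in> Pi_tilde m n \<Longrightarrow> \<theta> \<noteq> - delta 1 - delta 1 \<Longrightarrow> \<theta> \<in> S"
    using distinguished_borel[OF assms(1) n] by metis
  let ?a = "eps j - eps (j + 1)" and ?b = "eps (j + 1) - eps (j + 1 + 1)"
  have "B ?a ?a = -2" "B ?b ?b = -2" "B ?a ?b = 1"
    unfolding wform_linear using assms by (simp_all add: wform_values)
  moreover have "?a \<in> even_roots m n" "?b \<in> even_roots m n"
    using even_rootsI(3)[of j n "j + 1" m] even_rootsI(3)[of "j + 1" n "j + 1 + 1" m] assms by simp_all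
  moreover have "?a \<in> S" "?b \<in> S"
    using S(2) Pi_tilde_intros(4)[of j n m] Pi_tilde_intros(4)[of "j + 1" n m]
      Pi_tilde_distinct(4)[of j "j + 1"] Pi_tilde_distinct(4)[of "j + 1" "j + 1 + 1"] assms by auto
  ultimately show ?thesis using S(1) by (intro exponent_3_from_norms[where S = S]) simp_all
qed

lemma exponent_eps_fork:
  assumes "1 \<le> m" "3 \<le> n"
  shows "ex (eps (n - 2) - eps (n - 2 + 1)) (eps (n - 1) + eps n) = 3"
proof -
  have n: "2 \<le> n" and eq: "n - 2 + 1 = n - 1" using assms by simp_all
  obtain S where S: "S \<in> X" "\<And>\<theta>. \<theta> \<in> Pi_tilde m n \<Longrightarrow> \<theta> \<noteq> - delta 1 - delta 1 \<Longrightarrow> \<theta> \<in> S"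
    using distinguished_borel[OF assms(1) n] by metis
  let ?a = "eps (n - 2) - eps (n - 1)" and ?b = "eps (n - 1) + eps n"
  have "n - 2 \<noteq> n - 1" "n - 1 \<noteq> n" "n - 2 \<noteq> n" "n - 2 \<in> {1..n}" "n - 1 \<in> {1..n}" "n \<in> {1..n}"
    using assms by auto
  note idx = this
  have "B ?a ?a = -2" "B ?b ?b = -2" "B ?a ?b = 1"
    unfolding wform_linear using idx by (simp_all add: wform_eps eps_apply)
  moreover have "?a \<in> even_roots m n" "?b \<in> even_roots m n"
    using idx by (auto intro!: even_rootsI)
  moreover have "?a \<in> S" "?b \<in> S"
    using S(2) Pi_tilde_intros(4)[of "n - 2" n m] Pi_tilde_intros(5)[of n m]
      Pi_tilde_distinct(3)[of "n - 1" n] Pi_tilde_distinct(4)[of "n - 2" "n - 1"] assms eq by auto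
  ultimately show ?thesis unfolding eq using S(1) by (intro exponent_3_from_norms[where S = S]) simp_all
qed

lemma diagram_link_exponent:
  assumes "1 \<le> m" "2 \<le> n" "(\<theta>, \<theta>', d) \<in> diagram_links m n"
  shows "\<theta> \<in> Pi_tilde m n \<and> \<theta>' \<in> Pi_tilde m n \<and> ex \<theta> \<theta>' = d \<and> 3 \<le> d"
proof -
  have Pi: "\<theta> \<in> Pi_tilde m n \<and> \<theta>' \<in> Pi_tilde m n \<and> 3 \<le> d"
    using assms(3)
  proof (cases rule: diagram_links_cases)
    case 1 then show ?thesis using Pi_tilde_intros(1,3)[of m n] by simp
  next
    case 2 then show ?thesis using Pi_tilde_intros(1)[of m n] Pi_tilde_intros(2)[of 1 m n] assms(1) by simp
  next
    case 3 then show ?thesis using Pi_tilde_intros(3)[of m n] Pi_tilde_intros(2)[of "m - 1" m n] assms(1) by simp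
  next
    case (4 i) then show ?thesis using Pi_tilde_intros(2)[of i m n] Pi_tilde_intros(2)[of "i + 1" m n] by simp
  next
    case 5 then show ?thesis using Pi_tilde_intros(3)[of m n] Pi_tilde_intros(4)[of 1 n m] assms(2) by simp
  next
    case (6 j) then show ?thesis using Pi_tilde_intros(4)[of j n m] Pi_tilde_intros(4)[of "j + 1" n m] by simp
  next
    case 7 then show ?thesis using Pi_tilde_intros(3,5)[of m n] Pi_tilde_intros(5)[of n m] by simp
  next
    case 8 then show ?thesis using Pi_tilde_intros(4)[of "n - 2" n m] Pi_tilde_intros(5)[of n m] assms(2) by simp
  qed
  then have R: "\<theta> \<in> R" "\<theta>' \<in> R" using Pi_tilde_root[OF assms(1,2)] by blast+
  have "ex \<theta> \<theta>' = d \<or> ex \<theta>' \<theta> = d"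
    using assms(3)
  proof (cases rule: diagram_links_cases)
    case 1 then show ?thesis using exponent_delta1_odd[OF _ assms(2)] by blast
  next
    case 2 then have "2 \<le> m" using assms(1) by linarith
    then show ?thesis using 2 exponent_delta1_delta2[OF _ assms(2)] by blast
  next
    case 3 then have "2 \<le> m" using assms(1) by linarith
    then show ?thesis using 3 exponent_delta_odd[OF _ assms(2)] by blast
  next
    case (4 i) then show ?thesis using exponent_delta_delta[OF assms(2)] by blast
  next
    case 5
    have "eps 1 - eps (1 + 1) = eps 1 - eps 2" by (simp add: numeral_2_eq_2)
    then show ?thesis using 5 exponent_odd_eps[OF assms(1,2), of "eps 1 - eps 2" "eps 2"] by metis
  next
    case (6 j) then show ?thesis using exponent_eps_eps[OF assms(1)] by blast
  next
    case 7
    then have "eps (n - 1) + eps n = eps 1 + eps 2" by simp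
    then show ?thesis using 7 exponent_odd_eps[OF assms(1,2), of "eps 1 + eps 2" "- eps 2"] by metis
  next
    case 8 then have "3 \<le> n" using assms(2) by linarith
    then show ?thesis using 8 exponent_eps_fork[OF assms(1)] by blast
  qed
  then show ?thesis using Pi exponent_commute[OF R] by auto
qed

section \<open>Comparison of the two graphs\<close>

lemma Pi_tilde_orthogonal_or_linked:
  assumes mn: "1 \<le> m" "2 \<le> n" and "\<theta> \<in> Pi_tilde m n" "\<theta>' \<in> Pi_tilde m n"
  shows "\<theta> = \<theta>' \<or> B \<theta> \<theta>' = 0
    \<or> (\<exists>d. (\<theta>, \<theta>', d) \<in> diagram_links m n \<or> (\<theta>', \<theta>, d) \<in> diagram_links m n)" (is "?Q \<theta> \<theta>'")
proof -
  let ?T = "- delta 1 - delta 1" and ?O = "delta m - eps 1" and ?F = "eps (n - 1) + eps n"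
  let ?D = "\<lambda>i. delta i - delta (i + 1)" and ?E = "\<lambda>j. eps j - eps (j + 1)"
  have sym: "?Q y x" if "?Q x y" for x y using that wform_commute[of x y] by auto
  note links = diagram_links_intros[where m = m and n = n]
  have TD: "?Q ?T (?D i)" if i: "1 \<le> i" "i < m" for i
  proof (cases "i = 1")
    case True
    then have "m \<noteq> 1" using i by simp
    then show ?thesis unfolding True using links(2) by blast
  next
    case False
    then have "B ?T (?D i) = 0" unfolding wform_linear using i by (simp add: wform_values)
    then show ?thesis by blast
  qed
  have TO: "?Q ?T ?O"
  proof (cases "m = 1")
    case True
    then show ?thesis using links(1) by blast
  next
    case False
    then have "B ?T ?O = 0" unfolding wform_linear using mn by (simp add: wform_values)
    then show ?thesis by blast
  qed
  have TE: "?Q ?T (?E j)" if "1 \<le> j" "j < n" for j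
  proof -
    have "B ?T (?E j) = 0" unfolding wform_linear using mn by (simp add: wform_values)
    then show ?thesis by blast
  qed
  have TF: "?Q ?T ?F"
  proof -
    have "B ?T ?F = 0" unfolding wform_linear using mn by (simp add: wform_values)
    then show ?thesis by blast
  qed
  have DD: "?Q (?D i) (?D k)" if ik: "1 \<le> i" "i < m" "1 \<le> k" "k < m" for i k
  proof -
    consider "i = k" | "k = i + 1" | "i = k + 1" | "i \<noteq> k" "k \<noteq> i + 1" "i \<noteq> k + 1" by blast
    then show ?thesis
    proof cases
      case 2
      then show ?thesis using links(4)[of i] ik by blast
    next
      case 3
      then show ?thesis using links(4)[of k] ik by blast
    next
      case 4
      then have "B (?D i) (?D k) = 0" unfolding wform_linear using ik by (simp add: wform_values)
      then show ?thesis by blast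
    qed simp
  qed
  have DO: "?Q (?D i) ?O" if i: "1 \<le> i" "i < m" for i
  proof (cases "i = m - 1")
    case True
    then have "m \<noteq> 1" using i by simp
    then show ?thesis unfolding True using links(3) by blast
  next
    case False
    then have "B (?D i) ?O = 0" unfolding wform_linear using i by (simp add: wform_values)
    then show ?thesis by blast
  qed
  have DE: "?Q (?D i) (?E j)" if "1 \<le> i" "i < m" for i j
  proof -
    have "B (?D i) (?E j) = 0" unfolding wform_linear using that by (simp add: wform_values)
    then show ?thesis by blast
  qed
  have DF: "?Q (?D i) ?F" if "1 \<le> i" "i < m" for i
  proof -
    have "B (?D i) ?F = 0" unfolding wform_linear using that by (simp add: wform_values)
    then show ?thesis by blast
  qed
  have OE: "?Q ?O (?E j)" if j: "1 \<le> j" "j < n" for j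
  proof (cases "j = 1")
    case True
    then show ?thesis using links(5) by blast
  next
    case False
    then have "B ?O (?E j) = 0" unfolding wform_linear using mn j by (simp add: wform_values)
    then show ?thesis by blast
  qed
  have OF: "?Q ?O ?F"
  proof (cases "n = 2")
    case True
    then show ?thesis using links(7) by blast
  next
    case False
    then have "n - 1 \<noteq> 1" "n \<noteq> 1" using mn by auto
    then have "B ?O ?F = 0" unfolding wform_linear using mn by (simp add: wform_values)
    then show ?thesis by blast
  qed
  have EE: "?Q (?E i) (?E k)" if ik: "1 \<le> i" "i < n" "1 \<le> k" "k < n" for i k
  proof -
    consider "i = k" | "k = i + 1" | "i = k + 1" | "i \<noteq> k" "k \<noteq> i + 1" "i \<noteq> k + 1" by blast
    then show ?thesis
    proof cases
      case 2
      then show ?thesis using links(6)[of i] ik by blast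
    next
      case 3
      then show ?thesis using links(6)[of k] ik by blast
    next
      case 4
      then have "B (?E i) (?E k) = 0" unfolding wform_linear using ik by (simp add: wform_values)
      then show ?thesis by blast
    qed simp
  qed
  have EF: "?Q (?E j) ?F" if j: "1 \<le> j" "j < n" for j
  proof (cases "j = n - 2 \<and> n \<noteq> 2")
    case True
    then show ?thesis using links(8) by blast
  next
    case False
    have "j = n - 1 \<or> j \<noteq> n - 1 \<and> j + 1 \<noteq> n - 1 \<and> j + 1 \<noteq> n \<and> j \<noteq> n" using False j mn by linarith
    moreover have "n - 1 + 1 = n" "n - 1 \<noteq> n" using mn by auto
    ultimately have "B (?E j) ?F = 0"
      unfolding wform_linear using j by (auto simp: wform_eps eps_apply)
    then show ?thesis by blast
  qed
  have D: "?Q (?D i) y" if "1 \<le> i" "i < m" "y \<in> Pi_tilde m n" for i y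
    using that(3) by (cases rule: Pi_tilde_cases)
      (use that TD[THEN sym] DD DO DE DF in blast)+
  have E': "?Q (?E j) y" if "1 \<le> j" "j < n" "y \<in> Pi_tilde m n" for j y
    using that(3) by (cases rule: Pi_tilde_cases)
      (use that TE[THEN sym] DE[THEN sym] OE[THEN sym] EE EF in blast)+
  from assms(3) show ?thesis
  proof (cases rule: Pi_tilde_cases)
    case 1
    from assms(4) show ?thesis unfolding 1
      by (cases rule: Pi_tilde_cases) (use TD TO TE TF in blast)+
  next
    case (2 i) then show ?thesis using D assms(4) by blast
  next
    case 3
    from assms(4) show ?thesis unfolding 3
      by (cases rule: Pi_tilde_cases) (use TO[THEN sym] DO[THEN sym] OE OF in blast)+
  next
    case (4 j) then show ?thesis using E' assms(4) by blast
  next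
    case 5
    from assms(4) show ?thesis unfolding 5
      by (cases rule: Pi_tilde_cases)
        (use TF[THEN sym] DF[THEN sym] OF[THEN sym] EF[THEN sym] in blast)+
  qed
qed

text \<open>
  At least one of the two roots is even.  The other one has to be simple in some Borel subalgebra,
  and the distinguished one serves unless this root is \<open>-2 \<delta>\<^sub>1\<close>; then the roles are exchanged, as
  \<open>-2 \<delta>\<^sub>1\<close> is even itself.
\<close>

lemma unlinked_exponent:
  assumes mn: "1 \<le> m" "2 \<le> n" and \<theta>: "\<theta> \<in> Pi_tilde m n" "\<theta>' \<in> Pi_tilde m n" "\<theta> \<noteq> \<theta>'"
    and unlinked: "\<And>d. (\<theta>, \<theta>', d) \<notin> diagram_links m n" "\<And>d. (\<theta>', \<theta>, d) \<notin> diagram_links m n"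
  shows "ex \<theta> \<theta>' = 2"
proof -
  have orth: "B \<theta> \<theta>' = 0" "B \<theta>' \<theta> = 0"
    using Pi_tilde_orthogonal_or_linked[OF mn \<theta>(1,2)] \<theta>(3) unlinked wform_commute by auto
  note R = Pi_tilde_root[OF mn \<theta>(1)] Pi_tilde_root[OF mn \<theta>(2)]
  obtain S where S: "S \<in> X" "\<And>\<theta>. \<theta> \<in> Pi_tilde m n \<Longrightarrow> \<theta> \<noteq> - delta 1 - delta 1 \<Longrightarrow> \<theta> \<in> S"
    using distinguished_borel[OF mn] by metis
  note even = Pi_tilde_even[OF mn]
  consider "\<theta> \<in> even_roots m n" "\<theta>' \<in> S" | "\<theta>' \<in> even_roots m n" "\<theta> \<in> S"
    using even[OF \<theta>(1)] even[OF \<theta>(2)] S(2)[OF \<theta>(1)] S(2)[OF \<theta>(2)] \<theta>(3)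
      Pi_tilde_distinct(1)[of m] by metis
  then show ?thesis
  proof cases
    case 1
    then show ?thesis using exponent_2[OF 1(1) orth(2) S(1)] by blast
  next
    case 2
    then show ?thesis using exponent_2[OF 2(1) orth(1) S(1)] exponent_commute[OF R] by simp
  qed
qed

text \<open>
  Equal reflections would have a product of order 1, but all orders found are at least 2.
\<close>

lemma rhat_inj_on_Pi_tilde:
  assumes mn: "1 \<le> m" "2 \<le> n"
  shows "inj_on (rhat m n) (Pi_tilde m n)"
proof (rule inj_onI, rule ccontr)
  fix \<theta> \<theta>' assume \<theta>: "\<theta> \<in> Pi_tilde m n" "\<theta>' \<in> Pi_tilde m n" "rh \<theta> = rh \<theta>'" "\<theta> \<noteq> \<theta>'"
  note R = Pi_tilde_root[OF mn \<theta>(1)] Pi_tilde_root[OF mn \<theta>(2)]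
  have "((rh \<theta> \<circ> rh \<theta>') ^^ 1) S = S" if "S \<in> X" for S
    using rhat_involution[OF R(1) that] \<theta>(3) by simp
  then have "ex \<theta> \<theta>' dvd 1" using exponent_dvd_iff[OF R] by blast
  then have one: "ex \<theta> \<theta>' = 1" by simp
  moreover have "ex \<theta> \<theta>' \<ge> 2"
  proof (cases "\<exists>d. (\<theta>, \<theta>', d) \<in> diagram_links m n \<or> (\<theta>', \<theta>, d) \<in> diagram_links m n")
    case True
    then show ?thesis using diagram_link_exponent[OF mn] exponent_commute[OF R] by fastforce
  next
    case False
    then have "ex \<theta> \<theta>' = 2" using unlinked_exponent[OF mn \<theta>(1,2,4)] by blast
    then show ?thesis by simp
  qed
  ultimately show False by simp
qed

abbreviation (input) "graph_edge \<equiv> \<lambda>(\<theta>, \<theta>', d). ({rh \<theta>, rh \<theta>'}, if d \<ge> 4 then Some d else (None :: nat option))"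

lemma coxeter_edges:
  assumes mn: "1 \<le> m" "2 \<le> n"
  shows "edges (coxeter_graph (coxeter_C m n)) = graph_edge ` diagram_links m n"
proof (intro Set.set_eqI iffI)
  fix e assume "e \<in> edges (coxeter_graph (coxeter_C m n))"
  then obtain \<theta> \<theta>' where \<theta>: "\<theta> \<in> Pi_tilde m n" "\<theta>' \<in> Pi_tilde m n" "rh \<theta> \<noteq> rh \<theta>'"
    and ge: "ex \<theta> \<theta>' \<ge> 3"
    and e: "e = ({rh \<theta>, rh \<theta>'}, if ex \<theta> \<theta>' \<ge> 4 then Some (ex \<theta> \<theta>') else None)"
    unfolding coxeter_graph_def by (auto simp: coxeter_C_def)
  note R = Pi_tilde_root[OF mn \<theta>(1)] Pi_tilde_root[OF mn \<theta>(2)]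
  have "\<theta> \<noteq> \<theta>'" using \<theta>(3) by blast
  then obtain d where "(\<theta>, \<theta>', d) \<in> diagram_links m n \<or> (\<theta>', \<theta>, d) \<in> diagram_links m n"
    using unlinked_exponent[OF mn \<theta>(1,2)] ge by fastforce
  then show "e \<in> graph_edge ` diagram_links m n"
  proof
    assume l: "(\<theta>, \<theta>', d) \<in> diagram_links m n"
    then show ?thesis using diagram_link_exponent[OF mn l] unfolding e by (intro image_eqI[OF _ l]) simp
  next
    assume l: "(\<theta>', \<theta>, d) \<in> diagram_links m n"
    then show ?thesis using diagram_link_exponent[OF mn l] exponent_commute[OF R]
      unfolding e by (intro image_eqI[OF _ l]) (simp add: insert_commute)
  qed
next
  fix e assume "e \<in> graph_edge ` diagram_links m n"
  then obtain \<theta> \<theta>' d where l: "(\<theta>, \<theta>', d) \<in> diagram_links m n"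
    and e: "e = ({rh \<theta>, rh \<theta>'}, if d \<ge> 4 then Some d else None)" by auto
  have x: "\<theta> \<in> Pi_tilde m n" "\<theta>' \<in> Pi_tilde m n" "ex \<theta> \<theta>' = d" "3 \<le> d"
    using diagram_link_exponent[OF mn l] by auto
  note R = Pi_tilde_root[OF mn x(1)] Pi_tilde_root[OF mn x(2)]
  have "rh \<theta> \<noteq> rh \<theta>'"
  proof
    assume "rh \<theta> = rh \<theta>'"
    then have "((rh \<theta> \<circ> rh \<theta>') ^^ 1) S = S" if "S \<in> X" for S
      using rhat_involution[OF R(1) that] by simp
    then have "ex \<theta> \<theta>' dvd 1" using exponent_dvd_iff[OF R] by blast
    then show False using x(3,4) by simp
  qed
  moreover have "rh \<theta> \<in> generators (coxeter_C m n)" "rh \<theta>' \<in> generators (coxeter_C m n)"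
    using x(1,2) by (simp_all add: coxeter_C_def)
  ultimately show "e \<in> edges (coxeter_graph (coxeter_C m n))"
    unfolding coxeter_graph_def labelled_graph.select_convs e using x(3,4) by blast
qed

lemma spo_diagram_edges: "edges (spo_diagram m n) = graph_edge ` diagram_links m n"
proof -
  have family: "graph_edge ` {(f i, g i, 3) | i. P i} = {({rh (f i), rh (g i)}, None) | i. P i}"
    for f g :: "nat \<Rightarrow> weight" and P
    by (simp add: setcompr_eq_image image_image)
  have link: "graph_edge ` {(x, y, 12)} = {({rh x, rh y}, Some 12)}"
    "graph_edge ` {(x, y, 4), (x', y', 12)} = {({rh x, rh y}, Some 4), ({rh x', rh y'}, Some 12)}"
    "graph_edge ` {(x, y, 3)} = {({rh x, rh y}, None)}" for x y x' y'
    by simp_all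
  show ?thesis
    unfolding spo_diagram_def diagram_links_def r_bar1_def r_bar_def r_odd_def r_eps_def r_prime_def
      labelled_graph.select_convs image_Un if_distrib[of "(`) graph_edge"] family link ..
qed

lemma spo_diagram_vertices: "vertices (spo_diagram m n) = rh ` Pi_tilde m n"
  unfolding spo_diagram_def Pi_tilde_def r_bar1_def r_bar_def r_odd_def r_eps_def r_prime_def
  by (auto simp: image_Un)

end

theorem theorem4p6:
  fixes m n :: nat
  assumes "1 \<le> m" and "2 \<le> n"
  shows "inj_on (rhat m n) (Pi_tilde m n) \<and> coxeter_graph (coxeter_C m n) = spo_diagram m n"
proof
  interpret spo m n .
  show "inj_on (rhat m n) (Pi_tilde m n)" using assms by (rule rhat_inj_on_Pi_tilde)
  have "vertices (coxeter_graph (coxeter_C m n)) = vertices (spo_diagram m n)"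
    unfolding spo_diagram_vertices by (simp add: coxeter_graph_def coxeter_C_def)
  moreover have "edges (coxeter_graph (coxeter_C m n)) = edges (spo_diagram m n)"
    unfolding spo_diagram_edges using assms by (rule coxeter_edges)
  ultimately show "coxeter_graph (coxeter_C m n) = spo_diagram m n"
    by (rule labelled_graph.equality) simp
qed

end
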